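(* Let $d\ge 1$ be an integer, let $s>\frac d2$ be real, and set $n=\lfloor s-\frac d2\rfloor$. There exists a constant $C_{d,s}>0$, depending only on $d$ and $s$, such that the following holds for every measurable $V:\mathbb{R}^d\to[0,\infty)$ with $v:=V^{1/2}\in L^2(\mathbb{R}^d)$. (i) If $s-\frac d2\notin\mathbb{N}_0$ and $\big\||x|^{s-\frac d2}v\big\|_{L^2}<\infty$, then $$N_{<0}(H_s)-\binom{d+n}{d}\le C_{d,s}\,\big\||x|^{s-\frac d2}\,v\big\|_{L^2}^2 .$$ (ii) If $s-\frac d2\in\mathbb{N}$ and $\big\|\langle x\rangle^{s-\frac d2}\sqrt{1+\ln\langle x\rangle}\,v\big\|_{L^2}<\infty$, then $$N_{<0}(H_s)-\binom{d+n}{d}\le C_{d,s}\,\big\|\langle x\rangle^{s-\frac d2}\sqrt{1+\ln\langle x\rangle}\,v\big\|_{L^2}^2 .$$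
   Context: $\mathbb{N}=\{1,2,\dots\}$, $\mathbb{N}_0=\mathbb{N}\cup\{0\}$, $\langle x\rangle=\sqrt{1+|x|^2}$, and $L^2=L^2(\mathbb{R}^d)$. The fractional Schrödinger operator $H_s=(-\Delta)^s-V(x)$ on $L^2(\mathbb{R}^d)$ is the self-adjoint operator associated, by the KLMN theorem, with the quadratic form $u\mapsto\int_{\mathbb{R}^d}|\xi|^{2s}|\hat u(\xi)|^2\,\mathrm{d}\xi-\int_{\mathbb{R}^d}V|u|^2\,\mathrm{d}x$ with form domain the Sobolev space $H^s(\mathbb{R}^d)$ (when $s>d/2$ and $V^{1/2}\in L^2$, this form is closed and bounded below, and the essential spectrum of $H_s$ is $[0,\infty)$). Here $\hat u$ is the unitary Fourier transform. $N_{<0}(H_s)$ denotes the number of negative eigenvalues of $H_s$, counted with multiplicity. *)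

theory Defs
  imports "HOL-Analysis.Analysis"
begin

text \<open>
  Elements of \<open>L\<^sup>2(\<real>\<^sup>d)\<close> are represented by functions; identification of functions agreeing
  almost everywhere is built into the notions below where it matters (the Fourier transform,
  and linear independence). ``Measurable'' means Lebesgue measurable.
\<close>

definition square_integrable :: "('a::euclidean_space \<Rightarrow> 'b::real_normed_vector) \<Rightarrow> bool" where
  "square_integrable f \<longleftrightarrow>
     f \<in> borel_measurable lebesgue \<and> integrable lebesgue (\<lambda>x. (norm (f x))\<^sup>2)"

definition L2_norm :: "('a::euclidean_space \<Rightarrow> 'b::real_normed_vector) \<Rightarrow> real" where
  "L2_norm f = sqrt (LINT x|lebesgue. (norm (f x))\<^sup>2)"

definition L2_inner :: "('a::euclidean_space \<Rightarrow> complex) \<Rightarrow> ('a \<Rightarrow> complex) \<Rightarrow> complex" where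
  "L2_inner f g = (LINT x|lebesgue. f x * cnj (g x))"

definition japanese_bracket :: "'a::euclidean_space \<Rightarrow> real" where
  "japanese_bracket x = sqrt (1 + (norm x)\<^sup>2)"

definition fourier_integral ::
  "('a::euclidean_space \<Rightarrow> complex) \<Rightarrow> 'a \<Rightarrow> complex" where
  "fourier_integral f \<xi> =
     of_real ((2 * pi) powr (- real DIM('a) / 2)) *
     (LINT x|lebesgue. cis (- (x \<bullet> \<xi>)) * f x)"

text \<open>
  The unitary Fourier transform on \<open>L\<^sup>2\<close> (meaningful for square integrable \<open>u\<close>): the \<open>L\<^sup>2\<close>-limit,
  unique up to null sets, of the Fourier integrals of the truncations of \<open>u\<close> to balls. The
  distance to the limit is taken in the extended sense, so that a non-integrable difference
  counts as infinite.
\<close>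

definition fourier :: "('a::euclidean_space \<Rightarrow> complex) \<Rightarrow> 'a \<Rightarrow> complex" where
  "fourier u = (SOME g. square_integrable g \<and>
     ((\<lambda>R::real. \<integral>\<^sup>+ \<xi>. ennreal ((norm
          (fourier_integral (\<lambda>x. indicator (cball 0 R) x * u x) \<xi> - g \<xi>))\<^sup>2) \<partial>lebesgue)
       \<longlongrightarrow> 0) at_top)"

definition sobolev_space :: "real \<Rightarrow> ('a::euclidean_space \<Rightarrow> complex) set" where
  "sobolev_space s = {u. square_integrable u \<and>
     square_integrable (\<lambda>\<xi>. of_real (japanese_bracket \<xi> powr s) * fourier u \<xi>)}"

definition schroedinger_quadratic_form ::
  "real \<Rightarrow> ('a::euclidean_space \<Rightarrow> real) \<Rightarrow> ('a \<Rightarrow> complex) \<Rightarrow> real" where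
  "schroedinger_quadratic_form s V u =
     (LINT \<xi>|lebesgue. norm \<xi> powr (2 * s) * (norm (fourier u \<xi>))\<^sup>2)
     - (LINT x|lebesgue. V x * (norm (u x))\<^sup>2)"

text \<open>The sesquilinear form (linear in the first argument) obtained from it by polarization.\<close>

definition schroedinger_form ::
  "real \<Rightarrow> ('a::euclidean_space \<Rightarrow> real) \<Rightarrow> ('a \<Rightarrow> complex) \<Rightarrow> ('a \<Rightarrow> complex) \<Rightarrow> complex" where
  "schroedinger_form s V u w =
     (LINT \<xi>|lebesgue. of_real (norm \<xi> powr (2 * s)) * fourier u \<xi> * cnj (fourier w \<xi>))
     - (LINT x|lebesgue. of_real (V x) * u x * cnj (w x))"

lemma schroedinger_form_diagonal:
  "schroedinger_form s V u u = of_real (schroedinger_quadratic_form s V u)"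
proof -
  have *: "of_real a * z * cnj z = complex_of_real (a * (cmod z)\<^sup>2)" for a z
    by (simp only: mult.assoc complex_norm_square [symmetric] of_real_mult of_real_power)
  show ?thesis
    unfolding schroedinger_form_def schroedinger_quadratic_form_def * integral_complex_of_real
    by simp
qed

text \<open>
  The operator associated with the closed semibounded form, as a graph: \<open>u\<close> lies in the domain and
  \<open>H\<^sub>s u = f\<close> iff \<open>u\<close> lies in the form domain, \<open>f \<in> L\<^sup>2\<close>, and the form at \<open>(u, w)\<close> equals
  \<open>\<langle>f, w\<rangle>\<close> for all \<open>w\<close> in the form domain (this determines \<open>f\<close> almost everywhere).
\<close>

definition schroedinger_operator ::
  "real \<Rightarrow> ('a::euclidean_space \<Rightarrow> real) \<Rightarrow> (('a \<Rightarrow> complex) \<times> ('a \<Rightarrow> complex)) set" where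
  "schroedinger_operator s V = {(u, f). u \<in> sobolev_space s \<and> square_integrable f \<and>
     (\<forall>w\<in>sobolev_space s. schroedinger_form s V u w = L2_inner f w)}"

definition eigenspace ::
  "(('a \<Rightarrow> complex) \<times> ('a \<Rightarrow> complex)) set \<Rightarrow> real \<Rightarrow> ('a \<Rightarrow> complex) set" where
  "eigenspace H \<mu> = {u. (u, \<lambda>x. of_real \<mu> * u x) \<in> H}"

definition ae_independent :: "nat \<Rightarrow> (nat \<Rightarrow> 'a::euclidean_space \<Rightarrow> complex) \<Rightarrow> bool" where
  "ae_independent k e \<longleftrightarrow>
     (\<forall>c::nat \<Rightarrow> complex. (AE x in lebesgue. (\<Sum>i<k. c i * e i x) = 0) \<longrightarrow> (\<forall>i<k. c i = 0))"

text \<open>Complex dimension modulo null functions.\<close>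

definition ae_dim :: "('a::euclidean_space \<Rightarrow> complex) set \<Rightarrow> enat" where
  "ae_dim E = Sup {enat k | k. \<exists>e. (\<forall>i<k. e i \<in> E) \<and> ae_independent k e}"

text \<open>
  A real \<open>\<mu>\<close> that is not an eigenvalue contributes \<open>0\<close> to the sum, and every family in \<open>enat\<close>
  is summable, so this is the number of negative eigenvalues counted with multiplicity.
\<close>

definition num_negative_eigenvalues ::
  "(('a::euclidean_space \<Rightarrow> complex) \<times> ('a \<Rightarrow> complex)) set \<Rightarrow> enat" where
  "num_negative_eigenvalues H = (\<Sum>\<^sub>\<infinity>\<mu>\<in>{..<0}. ae_dim (eigenspace H \<mu>))"

end

theory Submission
  imports Defs "HOL-Probability.Probability"
begin

text \<open>
  Let \<open>M\<close> be the span of eigenfunctions of negative eigenvalues; the form is nonpositive there.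
  With \<open>\<sigma> = s - d/2\<close> and the Fourier transform \<open>F\<close>, require that the moments \<open>\<integral> \<xi>\<^sup>\<alpha> F u(\<xi>) d\<xi>\<close>,
  \<open>|\<alpha>| \<le> n\<close>, of \<open>u \<in> M\<close> vanish; these are \<open>(d + n) choose d\<close> linear conditions. By Fourier inversion
  the remaining \<open>u\<close> satisfy \<open>u(x) = c \<integral> K(x, \<xi>) f(\<xi>) d\<xi>\<close>, where \<open>f(\<xi>) = |\<xi>|\<^sup>s F u(\<xi>)\<close> and \<open>K(x, \<xi>)\<close>
  is \<open>|\<xi>|\<^sup>-\<^sup>s\<close> times \<open>exp (i x\<cdot>\<xi>)\<close> minus its Taylor polynomial of degree \<open>n\<close>. For functions
  \<open>u\<^sub>1, \<dots>, u\<^sub>k\<close> whose \<open>f\<^sub>l\<close> are orthonormal, Bessel's inequality gives the pointwise bound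
  \<open>\<Sum>|u\<^sub>l(x)|\<^sup>2 \<le> c\<^sup>2 \<integral> |K(x, \<xi>)|\<^sup>2 d\<xi>\<close>, and \<open>1 = \<integral> |f\<^sub>l|\<^sup>2 \<le> \<integral> V |u\<^sub>l|\<^sup>2\<close> since the form is
  nonpositive; summing over \<open>l\<close> bounds \<open>k\<close>. The kernel integral is of order \<open>|x|\<^sup>2\<^sup>\<sigma>\<close> when
  \<open>n < \<sigma> < n + 1\<close>. When \<open>\<sigma> = n\<close> it diverges at high frequencies, so the terms of degree \<open>n\<close> are
  only subtracted for \<open>|\<xi>| \<le> 1\<close>, which produces the logarithm.
\<close>

section \<open>Linear algebra and multi-indices\<close>

text \<open>The moment conditions annihilate the integrals of \<open>(x \<bullet> \<xi>) ^ j\<close>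
  against F u for every x at once, so the Taylor polynomial can be subtracted under the integral
  sign. Some subtraction is forced: |\<xi>|^(-2s) is not integrable at 0 because 2s > d. Subtracting
  one more degree gains two powers of |\<xi>| at 0 and loses two at infinity; degree n makes both
  ends converge exactly when n < \<sigma> < n + 1, and rescaling \<xi> by |x| then explains the
  power |x|^(2 \<sigma>). The form is nonpositive on M because eigenfunctions of different
  eigenvalues are orthogonal, which makes its matrix block diagonal. The transform is given only as
  a chosen L^2 limit, fixed up to null sets. Gaussian regularisation supplies both the contraction
  estimate behind the existence of this limit and the inversion formula, which applies since s > d/2
  makes F u integrable. Linear combinations are formed from the functions
  \<open>fourier (e j)\<close> themselves, and inversion extends to them by linearity of the
  integral. The final constant is (2 pi)^(-d) times that of the kernel integral.\<close>

lemma underdetermined_system: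
  fixes a :: "'i \<Rightarrow> 'j \<Rightarrow> 'k::field"
  assumes "finite I" "finite J" "card I < card J"
  shows "\<exists>c. (\<exists>j\<in>J. c j \<noteq> 0) \<and> (\<forall>i\<in>I. (\<Sum>j\<in>J. a i j * c j) = 0)"
  using assms
proof (induction I arbitrary: J a rule: finite_induct)
  case empty
  then obtain j where "j \<in> J" by fastforce
  then show ?case by (intro exI[of _ "\<lambda>_. 1"]) auto
next
  case (insert i I)
  show ?case
  proof (cases "\<forall>j\<in>J. a i j = 0")
    case True
    have "card I < card J" using insert by simp
    from insert.IH[OF insert.prems(1) this, of a] obtain c
      where "\<exists>j\<in>J. c j \<noteq> 0" "\<forall>i\<in>I. (\<Sum>j\<in>J. a i j * c j) = 0" by blast
    with True show ?thesis by (intro exI[of _ c]) auto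
  next
    case False
    then obtain p where p: "p \<in> J" "a i p \<noteq> 0" by blast
    let ?J = "J - {p}"
    \<comment> \<open>One step of Gaussian elimination: row \<open>i\<close> has the pivot
      \<open>p\<close>, and \<open>b\<close> is what the other rows become once the multiple of row
      \<open>i\<close> that clears column \<open>p\<close> is subtracted.\<close>
    define b where "b k j = a k j - a k p * a i j / a i p" for k j
    have "card I < card ?J" using insert p by (simp add: card_Diff_singleton_if)
    from insert.IH[of ?J b, OF _ this] insert.prems obtain c
      where c: "\<exists>j\<in>?J. c j \<noteq> 0" "\<And>k. k \<in> I \<Longrightarrow> (\<Sum>j\<in>?J. b k j * c j) = 0" by auto
    define S where "S = (\<Sum>j\<in>?J. a i j * c j)"
    define c' where "c' = c(p := - S / a i p)"
    have sumJ: "(\<Sum>j\<in>J. a k j * c' j) = a k p * (- S / a i p) + (\<Sum>j\<in>?J. a k j * c j)" for k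
    proof -
      have "(\<Sum>j\<in>J. a k j * c' j) = a k p * c' p + (\<Sum>j\<in>?J. a k j * c' j)"
        using p insert.prems(1) by (simp add: sum.remove)
      also have "(\<Sum>j\<in>?J. a k j * c' j) = (\<Sum>j\<in>?J. a k j * c j)"
        by (rule sum.cong) (auto simp: c'_def)
      finally show ?thesis by (simp add: c'_def)
    qed
    have "(\<Sum>j\<in>J. a k j * c' j) = 0" if "k \<in> insert i I" for k
    proof (cases "k = i")
      case True
      show ?thesis unfolding sumJ True S_def[symmetric] using p by simp
    next
      case False
      with that have "k \<in> I" by simp
      have "(\<Sum>j\<in>?J. b k j * c j) = (\<Sum>j\<in>?J. a k j * c j - (a k p / a i p) * (a i j * c j))"
        by (rule sum.cong) (auto simp: b_def algebra_simps)
      also have "\<dots> = (\<Sum>j\<in>?J. a k j * c j) - (a k p / a i p) * S"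
        by (simp add: sum_subtractf sum_distrib_left S_def)
      finally show ?thesis using c(2)[OF \<open>k \<in> I\<close>] by (simp add: sumJ)
    qed
    moreover have "\<exists>j\<in>J. c' j \<noteq> 0" using c(1) by (auto simp: c'_def)
    ultimately show ?thesis by blast
  qed
qed

text \<open>A nonzero solution of the conditions \<open>L\<close> together with orthogonality to the
  vectors already found exists while there are more unknowns than equations, and definiteness lets
  it be normalised. Working with coefficient vectors and the Gram matrix \<open>A\<close> keeps null
  sets out of the argument.\<close>

lemma orthonormal_family_in_kernel:
  fixes J :: "'j set" and A :: "'j \<Rightarrow> 'j \<Rightarrow> complex" and L :: "'i \<Rightarrow> 'j \<Rightarrow> complex"
  defines "Q \<equiv> \<lambda>c e. \<Sum>i\<in>J. \<Sum>j\<in>J. c i * cnj (e j) * A i j"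
  assumes fin: "finite I" "finite J"
    and herm: "\<And>i j. A j i = cnj (A i j)"
    and pos: "\<And>c. \<exists>j\<in>J. c j \<noteq> 0 \<Longrightarrow> \<exists>r>0. Q c c = complex_of_real r"
    and "card I + k \<le> card J"
  shows "\<exists>e. (\<forall>l<k. \<forall>i\<in>I. (\<Sum>j\<in>J. L i j * e l j) = 0) \<and>
     (\<forall>l<k. \<forall>m<k. Q (e l) (e m) = (if l = m then 1 else 0))"
  using assms(6)
proof (induction k)
  case 0
  show ?case by simp
next
  case (Suc k)
  then obtain e where e: "\<And>l i. l < k \<Longrightarrow> i \<in> I \<Longrightarrow> (\<Sum>j\<in>J. L i j * e l j) = 0"
    "\<And>l m. l < k \<Longrightarrow> m < k \<Longrightarrow> Q (e l) (e m) = (if l = m then 1 else 0)"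
    by fastforce
  \<comment> \<open>Rows \<open>Inl i\<close> are the conditions \<open>L\<close>; row
    \<open>Inr l\<close> expresses that the new vector is orthogonal to \<open>e l\<close>.\<close>
  define a where "a = case_sum L (\<lambda>l j. \<Sum>i\<in>J. cnj (e l i) * A j i)"
  have "card (I <+> {..<k}) < card J" using Suc.prems fin by (simp add: card_Plus)
  from underdetermined_system[OF _ fin(2) this, of a] fin obtain c where
    c: "\<exists>j\<in>J. c j \<noteq> 0" "\<And>i. i \<in> I <+> {..<k} \<Longrightarrow> (\<Sum>j\<in>J. a i j * c j) = 0" by auto
  obtain r where r: "r > 0" "Q c c = complex_of_real r" using pos[OF c(1)] by blast
  define c' where "c' = (\<lambda>j. c j / of_real (sqrt r))"
  have Qc: "Q c (e l) = 0" if "l < k" for l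
  proof -
    have "Q c (e l) = (\<Sum>j\<in>J. a (Inr l) j * c j)"
      by (simp add: Q_def a_def sum_distrib_right sum_distrib_left mult_ac)
    then show ?thesis using c(2)[of "Inr l"] that by auto
  qed
  have flip: "Q x y = cnj (Q y x)" for x y
  proof -
    have "cnj (Q y x) = (\<Sum>i\<in>J. \<Sum>j\<in>J. cnj (y i) * x j * cnj (A i j))" by (simp add: Q_def)
    also have "\<dots> = (\<Sum>i\<in>J. \<Sum>j\<in>J. cnj (y i) * x j * A j i)" by (simp only: herm [symmetric])
    also have "\<dots> = (\<Sum>j\<in>J. \<Sum>i\<in>J. cnj (y i) * x j * A j i)" by (rule sum.swap)
    also have "\<dots> = Q x y" by (simp add: Q_def mult_ac)
    finally show ?thesis by simp
  qed
  have scale: "Q c' y = Q c y / of_real (sqrt r)" for y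
    by (simp add: Q_def c'_def sum_divide_distrib)
  have scale2: "Q c' c' = Q c c / of_real r"
  proof -
    have "Q c c' = cnj (Q c' c)" by (rule flip)
    also have "\<dots> = cnj (Q c c) / of_real (sqrt r)" by (simp add: scale)
    finally have "Q c c' = Q c c / of_real (sqrt r)" using r by simp
    then show ?thesis using r by (simp add: scale flip: of_real_mult)
  qed
  define f where "f = e(k := c')"
  have "(\<Sum>j\<in>J. L i j * f l j) = 0" if "l < Suc k" "i \<in> I" for l i
  proof (cases "l = k")
    case True
    have "(\<Sum>j\<in>J. L i j * c j) = 0" using c(2)[of "Inl i"] that by (auto simp: a_def)
    then have "(\<Sum>j\<in>J. L i j * c j) / of_real (sqrt r) = 0" by simp
    then show ?thesis by (simp add: True f_def c'_def sum_divide_distrib)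
  next
    case False
    then show ?thesis using e(1)[of l i] that by (simp add: f_def)
  qed
  moreover have "Q (f l) (f m) = (if l = m then 1 else 0)" if lm: "l < Suc k" "m < Suc k" for l m
  proof -
    consider "l < k" "m < k" | "l = k" "m < k" | "l < k" "m = k" | "l = k" "m = k"
      using lm by (auto simp: less_Suc_eq)
    then show ?thesis
    proof cases
      case 1 then show ?thesis using e(2)[of l m] by (simp add: f_def)
    next
      case 2 then show ?thesis by (simp add: f_def scale Qc)
    next
      case 3
      have "Q (e l) c' = cnj (Q c' (e l))" by (rule flip)
      then show ?thesis using 3 by (simp add: f_def scale Qc)
    next
      case 4 then show ?thesis using r by (simp add: f_def scale2)
    qed
  qed
  ultimately show ?case by blast
qed

text \<open>Indices are functions on the whole space; forcing the value 0 off \<open>Basis\<close>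
  makes them determined by their values on \<open>Basis\<close>, hence finite in number.\<close>

definition multi_indices :: "'a::euclidean_space itself \<Rightarrow> nat \<Rightarrow> ('a \<Rightarrow> nat) set" where
  "multi_indices _ n = {\<alpha>. (\<forall>b. b \<notin> Basis \<longrightarrow> \<alpha> b = 0) \<and> sum \<alpha> Basis \<le> n}"

text \<open>Appending the slack \<open>n - sum \<alpha> Basis\<close> turns an index into a list of
  \<open>DIM('a) + 1\<close> naturals with sum exactly \<open>n\<close>, and such lists are counted
  by stars and bars.\<close>

lemma multi_indices_card:
  "finite (multi_indices TYPE('a::euclidean_space) n)"
  "card (multi_indices TYPE('a) n) \<le> (DIM('a) + n) choose DIM('a)"
proof -
  obtain bs :: "'a list" where bs: "set bs = Basis" "distinct bs"
    using finite_distinct_list[OF finite_Basis] by blast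
  have len: "length bs = DIM('a)" using bs distinct_card by fastforce
  define h where "h \<alpha> = map \<alpha> bs @ [n - sum \<alpha> Basis]" for \<alpha> :: "'a \<Rightarrow> nat"
  let ?T = "{l::nat list. length l = DIM('a) + 1 \<and> sum_list l = n}"
  have inj: "inj_on h (multi_indices TYPE('a) n)"
  proof (rule inj_onI)
    fix \<alpha> \<beta> assume *: "\<alpha> \<in> multi_indices TYPE('a) n" "\<beta> \<in> multi_indices TYPE('a) n" "h \<alpha> = h \<beta>"
    then have "map \<alpha> bs = map \<beta> bs" by (simp add: h_def)
    then have "\<forall>b\<in>Basis. \<alpha> b = \<beta> b" using bs by simp
    then have "\<alpha> b = \<beta> b" for b using * by (cases "b \<in> Basis") (auto simp: multi_indices_def)
    then show "\<alpha> = \<beta>" by (rule ext)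
  qed
  have sub: "h ` multi_indices TYPE('a) n \<subseteq> ?T"
  proof safe
    fix \<alpha> :: "'a \<Rightarrow> nat" assume "\<alpha> \<in> multi_indices TYPE('a) n"
    then have "sum \<alpha> Basis \<le> n" by (simp add: multi_indices_def)
    moreover have "sum_list (map \<alpha> bs) = sum \<alpha> Basis"
      using bs by (simp add: sum_list_distinct_conv_sum_set)
    ultimately show "sum_list (h \<alpha>) = n" by (simp add: h_def)
  qed (simp add: h_def len)
  have cT: "card ?T = (DIM('a) + n) choose DIM('a)"
    using card_length_sum_list[of "DIM('a) + 1" n] binomial_symmetric[of n "n + DIM('a)"]
    by (simp add: add.commute)
  then have fin: "finite ?T" by (intro card_ge_0_finite) simp
  show "finite (multi_indices TYPE('a) n)"
    by (rule finite_imageD[OF finite_subset[OF sub fin] inj])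
  show "card (multi_indices TYPE('a) n) \<le> (DIM('a) + n) choose DIM('a)"
    using card_inj_on_le[OF inj sub fin] unfolding cT .
qed

text \<open>Multiplying by \<open>x \<bullet> \<xi>\<close>, expanded in coordinates, raises one
  exponent of each monomial by one. The coefficients depend on \<open>x\<close> but the monomials do
  not, so finitely many vanishing moments suffice for all \<open>x\<close>.\<close>

lemma inner_power_multi_index_expansion:
  fixes x :: "'a::euclidean_space"
  shows "\<exists>a. \<forall>\<xi>. (x \<bullet> \<xi>) ^ j =
     (\<Sum>\<alpha>\<in>{\<alpha>\<in>multi_indices TYPE('a) j. sum \<alpha> Basis = j}. a \<alpha> * (\<Prod>b\<in>Basis. (\<xi> \<bullet> b) ^ \<alpha> b))"
proof (induction j)
  case 0
  have "{\<alpha>\<in>multi_indices TYPE('a) 0. sum \<alpha> Basis = 0} = {\<lambda>_. 0}"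
    by (auto simp: multi_indices_def)
  then show ?case by (intro exI[of _ "\<lambda>_. 1"]) simp
next
  case (Suc j)
  define M where "M j = {\<alpha>\<in>multi_indices TYPE('a) j. sum \<alpha> Basis = j}" for j
  define m where "m \<alpha> \<xi> = (\<Prod>b\<in>Basis. (\<xi> \<bullet> b) ^ \<alpha> b)" for \<alpha> and \<xi> :: 'a
  from Suc obtain a where a: "\<And>\<xi>. (x \<bullet> \<xi>) ^ j = (\<Sum>\<alpha>\<in>M j. a \<alpha> * m \<alpha> \<xi>)"
    unfolding M_def m_def by blast
  define up where "up b \<alpha> = \<alpha>(b := Suc (\<alpha> b))" for b :: 'a and \<alpha> :: "'a \<Rightarrow> nat"
  have finM: "finite (M j)" for j unfolding M_def by (simp add: multi_indices_card)
  have m_up: "m (up b \<alpha>) \<xi> = (\<xi> \<bullet> b) * m \<alpha> \<xi>" if "b \<in> Basis" for b \<alpha> \<xi>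
  proof -
    have "m (up b \<alpha>) \<xi> = (\<xi> \<bullet> b) ^ Suc (\<alpha> b) * (\<Prod>b\<in>Basis - {b}. (\<xi> \<bullet> b) ^ \<alpha> b)"
      unfolding m_def using that
      by (subst prod.remove[OF _ that]) (auto simp: up_def intro!: prod.cong)
    also have "\<dots> = (\<xi> \<bullet> b) * m \<alpha> \<xi>" unfolding m_def by (simp add: prod.remove[OF finite_Basis that])
    finally show ?thesis .
  qed
  have up_M: "up b \<alpha> \<in> M (Suc j)" if "b \<in> Basis" "\<alpha> \<in> M j" for b \<alpha>
  proof -
    have "sum (up b \<alpha>) Basis = Suc (\<alpha> b) + sum \<alpha> (Basis - {b})"
      using that by (subst sum.remove[OF _ that(1)]) (auto simp: up_def intro!: sum.cong)
    also have "\<dots> = Suc (sum \<alpha> Basis)" by (simp add: sum.remove[OF finite_Basis that(1)])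
    finally show ?thesis using that by (auto simp: M_def multi_indices_def up_def)
  qed
  \<comment> \<open>Different pairs of a direction and an index can be raised to the same
    \<open>\<beta>\<close>; their contributions are collected here.\<close>
  define a' where "a' \<beta> = (\<Sum>(b,\<alpha>)\<in>{(b,\<alpha>)\<in>Basis \<times> M j. up b \<alpha> = \<beta>}. (x \<bullet> b) * a \<alpha>)" for \<beta>
  have "(x \<bullet> \<xi>) ^ Suc j = (\<Sum>\<beta>\<in>M (Suc j). a' \<beta> * m \<beta> \<xi>)" for \<xi>
  proof -
    have "(x \<bullet> \<xi>) ^ Suc j = (\<Sum>b\<in>Basis. (x \<bullet> b) * (\<xi> \<bullet> b)) * (\<Sum>\<alpha>\<in>M j. a \<alpha> * m \<alpha> \<xi>)"
      by (simp add: a[symmetric] euclidean_inner[symmetric])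
    also have "\<dots> = (\<Sum>(b,\<alpha>)\<in>Basis \<times> M j. (x \<bullet> b) * a \<alpha> * m (up b \<alpha>) \<xi>)"
      by (auto simp: sum_product sum.cartesian_product m_up mult_ac intro!: sum.cong)
    also have "\<dots> = (\<Sum>\<beta>\<in>M (Suc j). \<Sum>(b,\<alpha>)\<in>{p\<in>Basis \<times> M j. up (fst p) (snd p) = \<beta>}. (x \<bullet> b) * a \<alpha> * m (up b \<alpha>) \<xi>)"
      by (rule sum.group[symmetric]) (use finM up_M in auto)
    also have "\<dots> = (\<Sum>\<beta>\<in>M (Suc j). a' \<beta> * m \<beta> \<xi>)"
      unfolding a'_def sum_distrib_right by (intro sum.cong refl) (auto simp: case_prod_beta)
    finally show ?thesis .
  qed
  then show ?case unfolding M_def m_def by blast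
qed

section \<open>Square integrable functions\<close>

lemma cball_sets_borel [measurable]: "cball (a :: 'a::euclidean_space) r \<in> sets borel"
  by simp

lemma square_integrable_product:
  fixes f g :: "'a::euclidean_space \<Rightarrow> complex"
  assumes "square_integrable f" "square_integrable g"
  shows "integrable lebesgue (\<lambda>x. f x * g x)"
proof (rule Bochner_Integration.integrable_bound)
  show "integrable lebesgue (\<lambda>x. (norm (f x))\<^sup>2 + (norm (g x))\<^sup>2)"
    using assms by (auto simp: square_integrable_def)
  show "(\<lambda>x. f x * g x) \<in> borel_measurable lebesgue"
    using assms by (auto simp: square_integrable_def)
  have "norm (a * b) \<le> norm ((norm a)\<^sup>2 + (norm b)\<^sup>2)" for a b :: complex
  proof -
    have "0 \<le> norm a * norm b" by simp
    then show ?thesis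
      using sum_squares_bound[of "norm a" "norm b"] unfolding norm_mult real_norm_def by linarith
  qed
  then show "AE x in lebesgue. norm (f x * g x) \<le> norm ((norm (f x))\<^sup>2 + (norm (g x))\<^sup>2)" by simp
qed

lemma borel_measurable_cnj [measurable (raw)]:
  "f \<in> borel_measurable M \<Longrightarrow> (\<lambda>x. cnj (f x)) \<in> borel_measurable M"
  by (rule measurable_compose[OF _ borel_measurable_continuous_onI[OF continuous_on_cnj[OF continuous_on_id]]])

text \<open>The squared norm as an extended value over the Borel measure: estimates can be stated
  before finiteness is known, and Tonelli and Fatou apply directly.\<close>

abbreviation energy :: "('a::euclidean_space \<Rightarrow> 'b::real_normed_vector) \<Rightarrow> ennreal" where
  "energy f \<equiv> \<integral>\<^sup>+x. ennreal ((norm (f x))\<^sup>2) \<partial>lborel"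

lemma square_integrable_cnj:
  "square_integrable f \<Longrightarrow> square_integrable (\<lambda>x. cnj (f x))"
  by (auto simp: square_integrable_def)

lemma integrable_L2_inner:
  "square_integrable f \<Longrightarrow> square_integrable g \<Longrightarrow> integrable lebesgue (\<lambda>x. f x * cnj (g x))"
  by (rule square_integrable_product[OF _ square_integrable_cnj])

lemma square_integrable_cmult:
  "square_integrable f \<Longrightarrow> square_integrable (\<lambda>x. c * f x)" for c :: complex
  by (auto simp: square_integrable_def norm_mult power_mult_distrib)

lemma square_integrable_bound:
  fixes f :: "'a::euclidean_space \<Rightarrow> 'b::real_normed_vector" and g :: "'a \<Rightarrow> 'c::real_normed_vector"
  assumes "square_integrable g" "f \<in> borel_measurable lebesgue" "\<And>x. norm (f x) \<le> norm (g x)"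
  shows "square_integrable f"
  unfolding square_integrable_def
proof
  show "integrable lebesgue (\<lambda>x. (norm (f x))\<^sup>2)"
    by (rule Bochner_Integration.integrable_bound[of _ "\<lambda>x. (norm (g x))\<^sup>2"])
      (use assms in \<open>auto simp: square_integrable_def intro!: power_mono\<close>)
qed fact

lemma square_integrable_add:
  fixes f g :: "'a::euclidean_space \<Rightarrow> complex"
  assumes "square_integrable f" "square_integrable g"
  shows "square_integrable (\<lambda>x. f x + g x)"
  unfolding square_integrable_def
proof
  show "integrable lebesgue (\<lambda>x. (norm (f x + g x))\<^sup>2)"
  proof (rule Bochner_Integration.integrable_bound)
    show "integrable lebesgue (\<lambda>x. 2 * (norm (f x))\<^sup>2 + 2 * (norm (g x))\<^sup>2)"
      using assms by (auto simp: square_integrable_def)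
    have "norm ((norm (a + b))\<^sup>2) \<le> norm (2 * (norm a)\<^sup>2 + 2 * (norm b)\<^sup>2)" for a b :: complex
    proof -
      have "(norm (a + b))\<^sup>2 \<le> (norm a + norm b)\<^sup>2" by (intro power_mono norm_triangle_ineq) auto
      also have "\<dots> \<le> 2 * (norm a)\<^sup>2 + 2 * (norm b)\<^sup>2"
        using sum_squares_bound[of "norm a" "norm b"] by (simp add: power2_sum)
      finally show ?thesis by simp
    qed
    then show "AE x in lebesgue. norm ((norm (f x + g x))\<^sup>2) \<le> norm (2 * (norm (f x))\<^sup>2 + 2 * (norm (g x))\<^sup>2)"
      by simp
  qed (use assms in \<open>auto simp: square_integrable_def\<close>)
qed (use assms in \<open>auto simp: square_integrable_def\<close>)

lemma square_integrable_sum: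
  fixes f :: "'i \<Rightarrow> 'a::euclidean_space \<Rightarrow> complex"
  assumes "\<And>i. i \<in> I \<Longrightarrow> square_integrable (f i)"
  shows "square_integrable (\<lambda>x. \<Sum>i\<in>I. f i x)"
  using assms
proof (induction I rule: infinite_finite_induct)
  case (insert i I)
  then show ?case by (auto intro: square_integrable_add)
qed (auto simp: square_integrable_def)

lemma square_integrable_lincomb:
  fixes f :: "'i \<Rightarrow> 'a::euclidean_space \<Rightarrow> complex"
  shows "(\<And>i. i \<in> I \<Longrightarrow> square_integrable (f i)) \<Longrightarrow> square_integrable (\<lambda>x. \<Sum>i\<in>I. c i * f i x)"
  by (intro square_integrable_sum square_integrable_cmult)

lemma square_integrable_diff:
  fixes f g :: "'a::euclidean_space \<Rightarrow> complex"
  assumes "square_integrable f" "square_integrable g"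
  shows "square_integrable (\<lambda>x. f x - g x)"
  using square_integrable_add[OF assms(1) square_integrable_cmult[OF assms(2), of "-1"]] by simp

lemma L2_inner_commute: "L2_inner g f = cnj (L2_inner f g)"
  unfolding L2_inner_def Bochner_Integration.integral_cnj[symmetric] by (simp only: complex_cnj_mult complex_cnj_cnj mult.commute)

lemma L2_inner_lincomb_left:
  assumes "\<And>i. i \<in> I \<Longrightarrow> square_integrable (f i)" "square_integrable g"
  shows "L2_inner (\<lambda>x. \<Sum>i\<in>I. c i * f i x) g = (\<Sum>i\<in>I. c i * L2_inner (f i) g)"
proof -
  have "L2_inner (\<lambda>x. \<Sum>i\<in>I. c i * f i x) g = (LINT x|lebesgue. (\<Sum>i\<in>I. c i * (f i x * cnj (g x))))"
    by (simp add: L2_inner_def sum_distrib_right mult.assoc)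
  also have "\<dots> = (\<Sum>i\<in>I. (LINT x|lebesgue. c i * (f i x * cnj (g x))))"
    by (intro Bochner_Integration.integral_sum integrable_mult_right integrable_L2_inner assms)
  finally show ?thesis by (simp add: L2_inner_def)
qed

lemma L2_inner_lincomb_right:
  assumes "\<And>i. i \<in> I \<Longrightarrow> square_integrable (f i)" "square_integrable g"
  shows "L2_inner g (\<lambda>x. \<Sum>i\<in>I. c i * f i x) = (\<Sum>i\<in>I. cnj (c i) * L2_inner g (f i))"
  by (subst L2_inner_commute, subst L2_inner_lincomb_left[OF assms], simp)
    (simp add: L2_inner_commute[symmetric])

lemma L2_inner_diff_left:
  assumes "square_integrable f" "square_integrable g" "square_integrable h"
  shows "L2_inner (\<lambda>x. f x - g x) h = L2_inner f h - L2_inner g h"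
  using assms by (simp add: L2_inner_def left_diff_distrib integrable_L2_inner)

lemma L2_inner_diff_right:
  assumes "square_integrable f" "square_integrable g" "square_integrable h"
  shows "L2_inner h (\<lambda>x. f x - g x) = L2_inner h f - L2_inner h g"
  by (simp add: L2_inner_commute[of h] L2_inner_diff_left[OF assms])

lemma L2_inner_self: "L2_inner f f = of_real (LINT x|lebesgue. (norm (f x))\<^sup>2)"
  by (simp add: L2_inner_def complex_norm_square[symmetric] flip: of_real_power)

lemma L2_inner_lincomb_self:
  assumes "\<And>i. i \<in> I \<Longrightarrow> square_integrable (f i)"
  shows "L2_inner (\<lambda>x. \<Sum>i\<in>I. c i * f i x) (\<lambda>x. \<Sum>i\<in>I. e i * f i x) =
    (\<Sum>i\<in>I. \<Sum>j\<in>I. c i * cnj (e j) * L2_inner (f i) (f j))"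
  by (subst L2_inner_lincomb_left, use assms in \<open>auto intro: square_integrable_lincomb\<close>)
    (use assms in \<open>simp add: L2_inner_lincomb_right sum_distrib_left mult.assoc\<close>)

lemma L2_inner_self_eq_0:
  assumes "square_integrable f" "L2_inner f f = 0"
  shows "AE x in lebesgue. f x = 0"
proof -
  have "(LINT x|lebesgue. (norm (f x))\<^sup>2) = 0" using assms(2) by (simp add: L2_inner_self)
  then have "AE x in lebesgue. (norm (f x))\<^sup>2 = 0"
    using assms(1) by (subst (asm) integral_nonneg_eq_0_iff_AE) (auto simp: square_integrable_def)
  then show ?thesis by simp
qed

text \<open>The residual \<open>h\<close> of \<open>g\<close> after projection is orthogonal to the
  projection \<open>p\<close>, so its squared norm is the difference of the two sides.\<close>

lemma L2_bessel_inequality: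
  fixes f :: "nat \<Rightarrow> 'a::euclidean_space \<Rightarrow> complex"
  assumes f: "\<And>l. l < k \<Longrightarrow> square_integrable (f l)" and g: "square_integrable g"
    and orth: "\<And>l m. l < k \<Longrightarrow> m < k \<Longrightarrow> L2_inner (f l) (f m) = (if l = m then 1 else 0)"
  shows "(\<Sum>l<k. (norm (L2_inner g (f l)))\<^sup>2) \<le> (LINT x|lebesgue. (norm (g x))\<^sup>2)"
proof -
  define a where "a l = L2_inner g (f l)" for l
  define p where "p x = (\<Sum>l<k. a l * f l x)" for x
  define h where "h x = g x - p x" for x
  have hh: "h = (\<lambda>x. g x - p x)" by (simp add: h_def fun_eq_iff)
  have p: "square_integrable p" unfolding p_def using f by (intro square_integrable_lincomb) auto
  have h: "square_integrable h" unfolding h_def by (intro square_integrable_diff g p)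
  have "L2_inner h (f m) = 0" if "m < k" for m
  proof -
    have "L2_inner h (f m) = a m - L2_inner p (f m)"
      unfolding h_def a_def by (intro L2_inner_diff_left g p f that)
    also have "L2_inner p (f m) = (\<Sum>l<k. a l * L2_inner (f l) (f m))"
      unfolding p_def using f that by (intro L2_inner_lincomb_left) auto
    also have "\<dots> = (\<Sum>l<k. if l = m then a m else 0)" using that by (intro sum.cong) (auto simp: orth)
    finally show ?thesis using that by simp
  qed
  then have hp: "L2_inner h p = 0"
    unfolding p_def using f h by (subst L2_inner_lincomb_right) auto
  have "L2_inner p g = (\<Sum>l<k. a l * L2_inner (f l) g)"
    unfolding p_def using f g by (intro L2_inner_lincomb_left) auto
  also have "\<dots> = (\<Sum>l<k. of_real ((norm (a l))\<^sup>2))"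
    by (intro sum.cong refl) (simp add: a_def L2_inner_commute[of "f _"] complex_norm_square[symmetric] flip: of_real_power)
  finally have pg: "L2_inner p g = of_real (\<Sum>l<k. (norm (a l))\<^sup>2)" by simp
  have "L2_inner h h = L2_inner h g - L2_inner h p"
    by (subst (2) hh) (intro L2_inner_diff_right g p h)
  also have "\<dots> = L2_inner g g - L2_inner p g" unfolding hp by (simp add: hh L2_inner_diff_left g p)
  finally have "of_real (LINT x|lebesgue. (norm (h x))\<^sup>2) =
      complex_of_real ((LINT x|lebesgue. (norm (g x))\<^sup>2) - (\<Sum>l<k. (norm (a l))\<^sup>2))"
    by (simp add: L2_inner_self pg)
  then have "(LINT x|lebesgue. (norm (h x))\<^sup>2) = (LINT x|lebesgue. (norm (g x))\<^sup>2) - (\<Sum>l<k. (norm (a l))\<^sup>2)"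
    by (simp only: of_real_eq_iff)
  moreover have "0 \<le> (LINT x|lebesgue. (norm (h x))\<^sup>2)" by simp
  ultimately show ?thesis by (simp add: a_def)
qed

section \<open>Gaussian summation of Fourier integrals\<close>

lemma measurable_cis [measurable (raw)]:
  "f \<in> borel_measurable M \<Longrightarrow> (\<lambda>x. cis (f x)) \<in> borel_measurable M"
  by (rule measurable_compose[OF _ borel_measurable_continuous_onI]) (auto intro: continuous_intros)

lemma nn_integral_affine:
  fixes f :: "'a::euclidean_space \<Rightarrow> ennreal"
  assumes [measurable]: "f \<in> borel_measurable borel" and "c \<noteq> 0"
  shows "(\<integral>\<^sup>+x. f x \<partial>lborel) = ennreal (\<bar>c\<bar> ^ DIM('a)) * (\<integral>\<^sup>+x. f (t + c *\<^sub>R x) \<partial>lborel)"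
  by (subst lborel_affine[OF \<open>c \<noteq> 0\<close>, of t])
     (simp add: nn_integral_density nn_integral_distr nn_integral_cmult)

lemma lborel_integral_affine:
  fixes f :: "'a::euclidean_space \<Rightarrow> 'b::{banach,second_countable_topology}"
  assumes [measurable]: "f \<in> borel_measurable borel" and "c \<noteq> 0"
  shows "(\<integral>x. f x \<partial>lborel) = \<bar>c\<bar> ^ DIM('a) *\<^sub>R (\<integral>x. f (t + c *\<^sub>R x) \<partial>lborel)"
  by (subst lborel_affine[OF \<open>c \<noteq> 0\<close>, of t]) (simp add: integral_density integral_distr)

lemma lborel_integrable_affine:
  fixes f :: "'a::euclidean_space \<Rightarrow> 'b::{banach,second_countable_topology}"
  assumes "integrable lborel f" "c \<noteq> 0"
  shows "integrable lborel (\<lambda>x. f (t + c *\<^sub>R x))"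
proof -
  have [measurable]: "f \<in> borel_measurable borel" using assms(1) by auto
  have "integrable (density (distr lborel borel (\<lambda>x. t + c *\<^sub>R x)) (\<lambda>_. ennreal (\<bar>c\<bar> ^ DIM('a)))) f"
    using assms(1) lborel_affine[OF \<open>c \<noteq> 0\<close>, of t] by simp
  then have "integrable lborel (\<lambda>x. \<bar>c\<bar> ^ DIM('a) *\<^sub>R f (t + c *\<^sub>R x))"
    by (simp add: integrable_density integrable_distr_eq)
  note 1 = this
  have "integrable lborel (\<lambda>x. inverse (\<bar>c\<bar> ^ DIM('a)) *\<^sub>R \<bar>c\<bar> ^ DIM('a) *\<^sub>R f (t + c *\<^sub>R x))"
    by (rule integrable_scaleR_right) (rule 1)
  moreover have "(\<lambda>x. inverse (\<bar>c\<bar> ^ DIM('a)) *\<^sub>R \<bar>c\<bar> ^ DIM('a) *\<^sub>R f (t + c *\<^sub>R x)) = (\<lambda>x. f (t + c *\<^sub>R x))"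
    using \<open>c \<noteq> 0\<close> by (simp add: fun_eq_iff)
  ultimately show ?thesis by (simp only:)
qed

text \<open>\<open>lborel\<close> is the image of a product of one-dimensional Lebesgue measures, so
  integrands that split along the basis integrate factor by factor. This reduces the Gaussian
  transform to dimension one.\<close>

lemma lborel_prod_integral:
  fixes f :: "'a::euclidean_space \<Rightarrow> real \<Rightarrow> 'b::{real_normed_field,banach,second_countable_topology}"
  assumes "\<And>b. b \<in> Basis \<Longrightarrow> integrable lborel (f b)"
  shows "integrable lborel (\<lambda>x. \<Prod>b\<in>Basis. f b (x \<bullet> b))"
    and "(\<integral>x. (\<Prod>b\<in>Basis. f b (x \<bullet> b)) \<partial>lborel) = (\<Prod>b\<in>Basis. \<integral>x. f b x \<partial>lborel)"
proof -
  interpret product_sigma_finite "\<lambda>_::'a. lborel :: real measure" ..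
  have [measurable]: "f b \<in> borel_measurable borel" if "b \<in> Basis" for b using assms[OF that] by auto
  have inner: "(\<Sum>b'\<in>Basis. x b' *\<^sub>R b') \<bullet> b = x b" if "b \<in> Basis" for x and b :: 'a
    using that by simp
  show "integrable lborel (\<lambda>x. \<Prod>b\<in>Basis. f b (x \<bullet> b))"
    unfolding lborel_eq[where 'a='a]
    by (subst integrable_distr_eq) (auto simp: assms intro!: product_integrable_prod)
  show "(\<integral>x. (\<Prod>b\<in>Basis. f b (x \<bullet> b)) \<partial>lborel) = (\<Prod>b\<in>Basis. \<integral>x. f b x \<partial>lborel)"
    unfolding lborel_eq[where 'a='a]
    by (subst integral_distr) (auto simp: assms product_integral_prod)
qed

text \<open>Up to the factor \<open>sqrt (2 * pi)\<close> of its density, this is the characteristic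
  function of the standard normal law.\<close>

lemma gaussian_fourier_real:
  "integrable lborel (\<lambda>x. cis (t * x) * of_real (exp (- x\<^sup>2 / 2)))"
  "(\<integral>x. cis (t * x) * of_real (exp (- x\<^sup>2 / 2)) \<partial>lborel) = of_real (sqrt (2 * pi) * exp (- t\<^sup>2 / 2))"
proof -
  have d: "complex_of_real (exp (- x\<^sup>2 / 2)) = of_real (sqrt (2 * pi)) * of_real (std_normal_density x)" for x
    unfolding of_real_mult[symmetric] of_real_eq_iff by (simp add: std_normal_density_def)
  have "integrable lborel (\<lambda>x. complex_of_real (std_normal_density x))"
    using integrable_std_normal_moment[of 0] by simp
  then have "integrable lborel (\<lambda>x. complex_of_real (exp (- x\<^sup>2 / 2)))"
    unfolding d by (intro integrable_mult_right)
  then show "integrable lborel (\<lambda>x. cis (t * x) * of_real (exp (- x\<^sup>2 / 2)))"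
    by (rule Bochner_Integration.integrable_bound) (auto simp: norm_mult)
  have "char std_normal_distribution t = (\<integral>x. std_normal_density x *\<^sub>R cis (t * x) \<partial>lborel)"
    unfolding char_def by (subst integral_density) (auto simp: cis_conv_exp)
  then have "(\<integral>x. std_normal_density x *\<^sub>R cis (t * x) \<partial>lborel) = of_real (exp (- t\<^sup>2 / 2))"
    by (simp add: char_std_normal_distribution)
  then have "of_real (sqrt (2 * pi)) * (\<integral>x. std_normal_density x *\<^sub>R cis (t * x) \<partial>lborel) = of_real (sqrt (2 * pi) * exp (- t\<^sup>2 / 2))"
    by simp
  then show "(\<integral>x. cis (t * x) * of_real (exp (- x\<^sup>2 / 2)) \<partial>lborel) = of_real (sqrt (2 * pi) * exp (- t\<^sup>2 / 2))"
    unfolding d integral_mult_right_zero[symmetric] by (simp add: scaleR_conv_of_real mult_ac)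
qed

section \<open>Gaussians in several variables\<close>

definition gauss :: "'a::euclidean_space \<Rightarrow> real" where
  "gauss x = exp (- (norm x)\<^sup>2 / 2)"

lemma gauss_measurable [measurable]: "gauss \<in> borel_measurable borel"
  unfolding gauss_def by measurable

lemma gauss_nonneg [simp]: "0 \<le> gauss x" and gauss_le_1 [simp]: "gauss x \<le> 1"
  by (auto simp: gauss_def)

lemma gauss_prod: "gauss x = (\<Prod>b\<in>Basis. exp (- (x \<bullet> b)\<^sup>2 / 2))"
  by (simp add: gauss_def exp_sum[symmetric] norm_eq_sqrt_inner euclidean_inner[of x x] sum_negf
      sum_divide_distrib[symmetric] power2_eq_square sum_nonneg)

lemma gaussian_fourier:
  fixes x :: "'a::euclidean_space"
  shows "integrable lborel (\<lambda>\<xi>. cis (x \<bullet> \<xi>) * of_real (gauss \<xi>))"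
    and "(\<integral>\<xi>. cis (x \<bullet> \<xi>) * of_real (gauss \<xi>) \<partial>lborel) = of_real ((2 * pi) powr (DIM('a) / 2) * gauss x)"
proof -
  have *: "cis (x \<bullet> \<xi>) * of_real (gauss \<xi>) = (\<Prod>b\<in>Basis. cis ((x \<bullet> b) * (\<xi> \<bullet> b)) * of_real (exp (- (\<xi> \<bullet> b)\<^sup>2 / 2)))" for \<xi>
  proof -
    have "cis (x \<bullet> \<xi>) = (\<Prod>b\<in>Basis. cis ((x \<bullet> b) * (\<xi> \<bullet> b)))"
      by (subst euclidean_inner) (simp add: cis_conv_exp exp_sum sum_distrib_left)
    then show ?thesis by (simp add: gauss_prod prod.distrib)
  qed
  show "integrable lborel (\<lambda>\<xi>. cis (x \<bullet> \<xi>) * of_real (gauss \<xi>))"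
    unfolding * by (rule lborel_prod_integral(1)[OF gaussian_fourier_real(1)])
  have "sqrt (2 * pi) ^ DIM('a) = (2 * pi) powr (DIM('a) / 2)"
    by (simp add: powr_half_sqrt[symmetric] powr_powr flip: powr_realpow)
  then have "complex_of_real (sqrt (2 * pi)) ^ DIM('a) = of_real ((2 * pi) powr (DIM('a) / 2))"
    by (metis of_real_power)
  then show "(\<integral>\<xi>. cis (x \<bullet> \<xi>) * of_real (gauss \<xi>) \<partial>lborel) = of_real ((2 * pi) powr (DIM('a) / 2) * gauss x)"
    unfolding * lborel_prod_integral(2)[OF gaussian_fourier_real(1)] gaussian_fourier_real(2)
    by (simp add: gauss_prod prod.distrib)
qed

lemma integrable_gauss: "integrable lborel (gauss :: 'a::euclidean_space \<Rightarrow> real)"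
  and integral_gauss: "(\<integral>\<xi>. gauss (\<xi> :: 'a) \<partial>lborel) = (2 * pi) powr (DIM('a) / 2)"
proof -
  have 1: "integrable lborel (\<lambda>\<xi>::'a. complex_of_real (gauss \<xi>))"
    using gaussian_fourier(1)[of "0::'a"] by simp
  then show "integrable lborel (gauss :: 'a \<Rightarrow> real)" unfolding complex_of_real_integrable_eq .
  have "complex_of_real (\<integral>\<xi>. gauss (\<xi> :: 'a) \<partial>lborel) = of_real ((2 * pi) powr (DIM('a) / 2))"
    using gaussian_fourier(2)[of "0::'a"] by (simp add: gauss_def)
  then show "(\<integral>\<xi>. gauss (\<xi> :: 'a) \<partial>lborel) = (2 * pi) powr (DIM('a) / 2)"
    using of_real_eq_iff by blast
qed

section \<open>Fourier integrals of integrable functions\<close>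

definition fourier_const :: "'a::euclidean_space itself \<Rightarrow> real" where
  "fourier_const _ = (2 * pi) powr (- real DIM('a) / 2)"

lemma fourier_const_pos: "fourier_const TYPE('a::euclidean_space) > 0"
  by (simp add: fourier_const_def)

text \<open>The second factor is the total mass of \<open>gauss\<close>. This cancellation is why no
  constants survive in the Gaussian inversion formulas and in the contraction estimate.\<close>

lemma fourier_const_inverse:
  "fourier_const TYPE('a::euclidean_space) * (2 * pi) powr (real DIM('a) / 2) = 1"
  by (simp add: fourier_const_def powr_minus)

lemma fourier_integral_lborel:
  fixes u :: "'a::euclidean_space \<Rightarrow> complex"
  assumes [measurable]: "u \<in> borel_measurable borel"
  shows "fourier_integral u \<xi> =
    of_real (fourier_const TYPE('a)) * (\<integral>x. cis (- (x \<bullet> \<xi>)) * u x \<partial>lborel)"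
proof -
  show ?thesis unfolding fourier_integral_def fourier_const_def by (subst integral_completion) auto
qed

lemma fourier_integral_measurable [measurable]:
  fixes u :: "'a::euclidean_space \<Rightarrow> complex"
  assumes [measurable]: "u \<in> borel_measurable borel"
  shows "fourier_integral u \<in> borel_measurable borel"
proof -
  have "(\<lambda>\<xi>. \<integral>x. cis (- (x \<bullet> \<xi>)) * u x \<partial>lborel) \<in> borel_measurable borel" by measurable
  then show ?thesis by (subst measurable_cong[OF fourier_integral_lborel]) auto
qed

lemma integrable_pair_product:
  fixes f :: "'a::euclidean_space \<Rightarrow> complex" and g :: "'b::euclidean_space \<Rightarrow> complex"
  assumes f: "integrable lborel f" and g: "integrable lborel g"
    and [measurable]: "case_prod h \<in> borel_measurable (borel \<Otimes>\<^sub>M borel)"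
    and h: "\<And>x y. norm (h x y) \<le> 1"
  shows "integrable (lborel \<Otimes>\<^sub>M lborel) (\<lambda>(x, y). h x y * (f x * g y))"
proof (rule Bochner_Integration.integrable_bound)
  have [measurable]: "f \<in> borel_measurable borel" "g \<in> borel_measurable borel" using f g by auto
  show "integrable (lborel \<Otimes>\<^sub>M lborel) (\<lambda>(x, y). f x * g y)"
    by (rule lborel_pair.Fubini_integrable) (use f g in \<open>auto simp: norm_mult\<close>)
  show "(\<lambda>(x, y). h x y * (f x * g y)) \<in> borel_measurable (lborel \<Otimes>\<^sub>M lborel)" by measurable
  show "AE p in lborel \<Otimes>\<^sub>M lborel. norm (case p of (x, y) \<Rightarrow> h x y * (f x * g y)) \<le> norm (case p of (x, y) \<Rightarrow> f x * g y)"
    using h by (auto simp: norm_mult intro!: AE_I2 mult_left_le_one_le)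
qed

text \<open>A mean that is not normalised: a constant \<open>u\<close> is multiplied by
  \<open>(2 * pi) powr (DIM('a) / 2)\<close>. The factor is removed by \<open>fourier_const\<close>
  when \<open>\<epsilon>\<close> tends to 0.\<close>

abbreviation gauss_mean :: "('a::euclidean_space \<Rightarrow> complex) \<Rightarrow> real \<Rightarrow> 'a \<Rightarrow> complex" where
  "gauss_mean u \<epsilon> a \<equiv> \<integral>t. of_real (gauss t) * u (a + \<epsilon> *\<^sub>R t) \<partial>lborel"

abbreviation gauss_wave :: "real \<Rightarrow> 'a::euclidean_space \<Rightarrow> 'a \<Rightarrow> complex" where
  "gauss_wave \<epsilon> a \<xi> \<equiv> cis (a \<bullet> \<xi>) * of_real (gauss (\<epsilon> *\<^sub>R \<xi>))"

text \<open>Fubini moves the frequency integral onto the damped wave, whose transform is a Gaussian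
  of width \<open>\<epsilon>\<close> centred at \<open>a\<close>. The damping is what makes the
  double integral absolutely convergent, since the Fourier integral of \<open>u\<close> need not be
  integrable.\<close>

lemma gaussian_inversion_L1:
  fixes u :: "'a::euclidean_space \<Rightarrow> complex"
  assumes u: "integrable lborel u" and "\<epsilon> > 0"
  shows "(\<integral>\<xi>. fourier_integral u \<xi> * gauss_wave \<epsilon> a \<xi> \<partial>lborel) =
    gauss_mean u \<epsilon> a"
proof -
  let ?c = "complex_of_real (fourier_const TYPE('a))"
  have [measurable]: "u \<in> borel_measurable borel" using u by auto
  have "integrable lborel (\<lambda>\<xi>::'a. gauss (0 + \<epsilon> *\<^sub>R \<xi>))"
    using \<open>\<epsilon> > 0\<close> by (intro lborel_integrable_affine integrable_gauss) auto
  then have G: "integrable lborel (\<lambda>\<xi>::'a. complex_of_real (gauss (\<epsilon> *\<^sub>R \<xi>)))" by simp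
  define k where "k z = (\<integral>\<xi>. cis (z \<bullet> \<xi>) * of_real (gauss (\<epsilon> *\<^sub>R \<xi>)) \<partial>lborel)" for z :: 'a
  have k: "k z = of_real ((2 * pi) powr (DIM('a) / 2) / \<epsilon> ^ DIM('a) * gauss ((1 / \<epsilon>) *\<^sub>R z))" for z
  proof -
    have "k z = \<bar>1 / \<epsilon>\<bar> ^ DIM('a) *\<^sub>R (\<integral>\<xi>. cis (z \<bullet> (0 + (1 / \<epsilon>) *\<^sub>R \<xi>)) * of_real (gauss (\<epsilon> *\<^sub>R (0 + (1 / \<epsilon>) *\<^sub>R \<xi>))) \<partial>lborel)"
      unfolding k_def using \<open>\<epsilon> > 0\<close> by (intro lborel_integral_affine) auto
    also have "(\<integral>\<xi>. cis (z \<bullet> (0 + (1 / \<epsilon>) *\<^sub>R \<xi>)) * of_real (gauss (\<epsilon> *\<^sub>R (0 + (1 / \<epsilon>) *\<^sub>R \<xi>))) \<partial>lborel)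
       = (\<integral>\<xi>. cis (((1 / \<epsilon>) *\<^sub>R z) \<bullet> \<xi>) * of_real (gauss \<xi>) \<partial>lborel)"
      using \<open>\<epsilon> > 0\<close> by simp
    finally show ?thesis
      using \<open>\<epsilon> > 0\<close> unfolding gaussian_fourier(2) by (simp add: scaleR_conv_of_real power_divide)
  qed
  have "integrable (lborel \<Otimes>\<^sub>M lborel) (\<lambda>(\<xi>, x). cis ((a - x) \<bullet> \<xi>) * (of_real (gauss (\<epsilon> *\<^sub>R \<xi>)) * u x))"
    by (rule integrable_pair_product[OF G u]) auto
  note Fub = lborel_pair.Fubini_integral[OF this]
  have "(\<integral>\<xi>. fourier_integral u \<xi> * gauss_wave \<epsilon> a \<xi> \<partial>lborel)
      = ?c * (\<integral>\<xi>. (\<integral>x. cis ((a - x) \<bullet> \<xi>) * (of_real (gauss (\<epsilon> *\<^sub>R \<xi>)) * u x) \<partial>lborel) \<partial>lborel)"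
  proof -
    have "fourier_integral u \<xi> * gauss_wave \<epsilon> a \<xi> =
      ?c * (\<integral>x. cis ((a - x) \<bullet> \<xi>) * (of_real (gauss (\<epsilon> *\<^sub>R \<xi>)) * u x) \<partial>lborel)" for \<xi>
    proof -
      have "cis ((a - x) \<bullet> \<xi>) = cis (- (x \<bullet> \<xi>)) * cis (a \<bullet> \<xi>)" for x
        by (simp add: inner_diff_left cis_mult)
      then have eq: "cis ((a - x) \<bullet> \<xi>) * (of_real (gauss (\<epsilon> *\<^sub>R \<xi>)) * u x) =
          cis (- (x \<bullet> \<xi>)) * u x * gauss_wave \<epsilon> a \<xi>" for x
        by (simp only: mult_ac)
      show ?thesis unfolding eq integral_mult_left_zero by (simp add: fourier_integral_lborel)
    qed
    then show ?thesis by simp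
  qed
  also have "\<dots> = ?c * (\<integral>x. (\<integral>\<xi>. cis ((a - x) \<bullet> \<xi>) * (of_real (gauss (\<epsilon> *\<^sub>R \<xi>)) * u x) \<partial>lborel) \<partial>lborel)"
    by (simp only: Fub)
  also have "\<dots> = ?c * (\<integral>x. k (a - x) * u x \<partial>lborel)"
    by (simp add: k_def mult.assoc[symmetric])
  \<comment> \<open>Substituting \<open>x = a + \<epsilon> *\<^sub>R t\<close>, the Jacobian cancels
    the power of \<open>\<epsilon>\<close> in the denominator of \<open>k\<close>.\<close>
  also have "(\<integral>x. k (a - x) * u x \<partial>lborel) = \<bar>\<epsilon>\<bar> ^ DIM('a) *\<^sub>R (\<integral>t. k (a - (a + \<epsilon> *\<^sub>R t)) * u (a + \<epsilon> *\<^sub>R t) \<partial>lborel)"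
    unfolding k using \<open>\<epsilon> > 0\<close> by (intro lborel_integral_affine) auto
  also have "\<dots> = (\<integral>t. of_real ((2 * pi) powr (DIM('a) / 2)) * (of_real (gauss t) * u (a + \<epsilon> *\<^sub>R t)) \<partial>lborel)"
    unfolding integral_scaleR_right[symmetric] k
    using \<open>\<epsilon> > 0\<close> by (intro Bochner_Integration.integral_cong) (auto simp: scaleR_conv_of_real gauss_def)
  also have "\<dots> = of_real ((2 * pi) powr (DIM('a) / 2)) * gauss_mean u \<epsilon> a"
    by simp
  also have "?c * \<dots> = gauss_mean u \<epsilon> a"
    unfolding mult.assoc[symmetric] of_real_mult[symmetric] fourier_const_inverse by simp
  finally show ?thesis .
qed

lemma norm_integral_le_nn_integral:
  fixes f :: "'a \<Rightarrow> 'b::{banach,second_countable_topology}"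
  shows "ennreal (norm (integral\<^sup>L M f)) \<le> (\<integral>\<^sup>+x. norm (f x) \<partial>M)"
  by (cases "integrable M f") (auto simp: integral_norm_bound_ennreal not_integrable_integral_eq)

lemma fourier_integral_bounded:
  fixes u :: "'a::euclidean_space \<Rightarrow> complex"
  assumes "integrable lborel u"
  shows "norm (fourier_integral u \<xi>) \<le> fourier_const TYPE('a) * (\<integral>x. norm (u x) \<partial>lborel)"
proof -
  have [measurable]: "u \<in> borel_measurable borel" using assms by auto
  have "norm (\<integral>x. cis (- (x \<bullet> \<xi>)) * u x \<partial>lborel) \<le> (\<integral>x. norm (cis (- (x \<bullet> \<xi>)) * u x) \<partial>lborel)"
    by (rule integral_norm_bound)
  then show ?thesis using fourier_const_pos[where 'a='a]
    by (simp add: fourier_integral_lborel norm_mult mult_left_mono)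
qed

text \<open>The damped energy equals \<open>fourier_const\<close> times the integral of a Gaussian
  mean of \<open>u\<close> against the conjugate of \<open>u\<close>. Bounding the product of the
  two values by half the sum of their squares, and using translation invariance, leaves the energy
  of \<open>u\<close> times the mass of \<open>gauss\<close>, so the constant is exactly 1.\<close>

lemma fourier_integral_gauss_bound:
  fixes u :: "'a::euclidean_space \<Rightarrow> complex"
  assumes u: "integrable lborel u" and "\<epsilon> > 0"
  shows "(\<integral>\<^sup>+\<xi>. ennreal ((norm (fourier_integral u \<xi>))\<^sup>2 * gauss (\<epsilon> *\<^sub>R \<xi>)) \<partial>lborel)
    \<le> energy u"
proof -
  let ?c = "fourier_const TYPE('a)"
  let ?h = "\<lambda>a t. gauss t * ((norm (u (a + \<epsilon> *\<^sub>R t)))\<^sup>2 / 2 + (norm (u a))\<^sup>2 / 2)"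
  have [measurable]: "u \<in> borel_measurable borel" using u by auto
  define U where "U = fourier_integral u"
  have [measurable]: "U \<in> borel_measurable borel" unfolding U_def by measurable
  let ?e = "(\<integral>\<xi>. (norm (U \<xi>))\<^sup>2 * gauss (\<epsilon> *\<^sub>R \<xi>) \<partial>lborel)"
  let ?F = "\<lambda>\<xi> a. cis (a \<bullet> \<xi>) * ((U \<xi> * of_real (gauss (\<epsilon> *\<^sub>R \<xi>))) * cnj (u a))"
  define B where "B = ?c * (\<integral>x. norm (u x) \<partial>lborel)"
  have B: "norm (U \<xi>) \<le> B" for \<xi> unfolding U_def B_def by (rule fourier_integral_bounded[OF u])
  have "integrable lborel (\<lambda>\<xi>::'a. gauss (0 + \<epsilon> *\<^sub>R \<xi>))"
    using \<open>\<epsilon> > 0\<close> by (intro lborel_integrable_affine integrable_gauss) auto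
  then have G: "integrable lborel (\<lambda>\<xi>::'a. gauss (\<epsilon> *\<^sub>R \<xi>))" by simp
  have UG: "integrable lborel (\<lambda>\<xi>. U \<xi> * of_real (gauss (\<epsilon> *\<^sub>R \<xi>)))"
  proof (rule Bochner_Integration.integrable_bound)
    show "integrable lborel (\<lambda>\<xi>::'a. B * gauss (\<epsilon> *\<^sub>R \<xi>))" using G by (rule integrable_mult_right)
    show "AE \<xi> in lborel. norm (U \<xi> * of_real (gauss (\<epsilon> *\<^sub>R \<xi>))) \<le> norm (B * gauss (\<epsilon> *\<^sub>R \<xi>))"
      using B by (auto simp: norm_mult abs_mult intro!: AE_I2 mult_right_mono intro: order_trans[OF _ abs_ge_self])
  qed auto
  have UUG: "integrable lborel (\<lambda>\<xi>. (norm (U \<xi>))\<^sup>2 * gauss (\<epsilon> *\<^sub>R \<xi>))"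
  proof (rule Bochner_Integration.integrable_bound)
    show "integrable lborel (\<lambda>\<xi>::'a. B\<^sup>2 * gauss (\<epsilon> *\<^sub>R \<xi>))" using G by (rule integrable_mult_right)
    show "AE \<xi> in lborel. norm ((norm (U \<xi>))\<^sup>2 * gauss (\<epsilon> *\<^sub>R \<xi>)) \<le> norm (B\<^sup>2 * gauss (\<epsilon> *\<^sub>R \<xi>))"
      using B by (auto simp: norm_mult abs_mult intro!: AE_I2 mult_right_mono power_mono)
  qed auto
  have ucnj: "integrable lborel (\<lambda>x. cnj (u x))" using u by simp
  have int: "integrable (lborel \<Otimes>\<^sub>M lborel) (\<lambda>(\<xi>, a). (?F \<xi> a))"
    by (rule integrable_pair_product[OF UG ucnj]) auto
  \<comment> \<open>One factor of the squared modulus is written out as a Fourier integral, so that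
    after exchanging integrals the damped inversion formula applies to the other.\<close>
  have "of_real ?e
      = (\<integral>\<xi>. U \<xi> * of_real (gauss (\<epsilon> *\<^sub>R \<xi>)) * cnj (U \<xi>) \<partial>lborel)"
    by (simp add: integral_complex_of_real[symmetric] complex_norm_square mult_ac del: integral_complex_of_real of_real_power flip: of_real_power)
  also have "\<dots> = of_real ?c * (\<integral>\<xi>. (\<integral>a. (?F \<xi> a) \<partial>lborel) \<partial>lborel)"
  proof -
    have "cnj (U \<xi>) = of_real ?c * (\<integral>a. cis (a \<bullet> \<xi>) * cnj (u a) \<partial>lborel)" for \<xi>
    proof -
      have "cnj (U \<xi>) = of_real ?c * (\<integral>a. cnj (cis (- (a \<bullet> \<xi>)) * u a) \<partial>lborel)"
        unfolding Bochner_Integration.integral_cnj U_def by (simp add: fourier_integral_lborel)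
      then show ?thesis by (simp add: cis_cnj)
    qed
    note U = this
    have comm: "(?F \<xi> a) =
       (U \<xi> * of_real (gauss (\<epsilon> *\<^sub>R \<xi>))) * (cis (a \<bullet> \<xi>) * cnj (u a))" for a \<xi> by (simp add: mult_ac)
    show ?thesis
      unfolding comm integral_mult_right_zero U
      by (subst integral_mult_right_zero[symmetric]) (simp only: mult_ac)
  qed
  also have "\<dots> = of_real ?c * (\<integral>a. (\<integral>\<xi>. (?F \<xi> a) \<partial>lborel) \<partial>lborel)"
    by (simp only: lborel_pair.Fubini_integral[OF int])
  also have "\<dots> = of_real ?c * (\<integral>a. gauss_mean u \<epsilon> a * cnj (u a) \<partial>lborel)"
  proof -
    have "(\<integral>\<xi>. (?F \<xi> a) \<partial>lborel)
      = gauss_mean u \<epsilon> a * cnj (u a)" for a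
      unfolding gaussian_inversion_L1[OF u \<open>\<epsilon> > 0\<close>, symmetric] integral_mult_left_zero[symmetric] U_def
      by (simp add: mult_ac)
    then show ?thesis by simp
  qed
  finally have eq: "complex_of_real ?e =
    of_real ?c * (\<integral>a. gauss_mean u \<epsilon> a * cnj (u a) \<partial>lborel)" .
  have "(\<integral>\<^sup>+\<xi>. ennreal ((norm (U \<xi>))\<^sup>2 * gauss (\<epsilon> *\<^sub>R \<xi>)) \<partial>lborel)
      = ennreal ?e"
    by (intro nn_integral_eq_integral UUG) auto
  also have "?e
      = norm (complex_of_real ?e)"
    by (simp add: integral_nonneg_AE)
  also have "\<dots> = ?c * norm (\<integral>a. gauss_mean u \<epsilon> a * cnj (u a) \<partial>lborel)"
    unfolding eq norm_mult using fourier_const_pos[where 'a='a] by simp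
  also have "ennreal \<dots> \<le> ennreal ?c * (\<integral>\<^sup>+a. norm (gauss_mean u \<epsilon> a * cnj (u a)) \<partial>lborel)"
    using fourier_const_pos[where 'a='a] by (simp add: ennreal_mult norm_integral_le_nn_integral mult_left_mono)
  also have "\<dots> \<le> ennreal ?c * (\<integral>\<^sup>+a. (\<integral>\<^sup>+t. ennreal (?h a t) \<partial>lborel) \<partial>lborel)"
  proof (intro mult_left_mono nn_integral_mono)
    fix a :: 'a
    have "ennreal (norm (gauss_mean u \<epsilon> a * cnj (u a)))
        = ennreal (norm (\<integral>t. of_real (gauss t) * u (a + \<epsilon> *\<^sub>R t) * cnj (u a) \<partial>lborel))"
      by simp
    also have "\<dots> \<le> (\<integral>\<^sup>+t. norm (of_real (gauss t) * u (a + \<epsilon> *\<^sub>R t) * cnj (u a)) \<partial>lborel)"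
      by (rule norm_integral_le_nn_integral)
    also have "\<dots> \<le> (\<integral>\<^sup>+t. ennreal (?h a t) \<partial>lborel)"
    proof (intro nn_integral_mono ennreal_leI)
      fix t :: 'a
      have "norm (u (a + \<epsilon> *\<^sub>R t)) * norm (u a) \<le> (norm (u (a + \<epsilon> *\<^sub>R t)))\<^sup>2 / 2 + (norm (u a))\<^sup>2 / 2"
        using sum_squares_bound[of "norm (u (a + \<epsilon> *\<^sub>R t))" "norm (u a)"] by simp
      then show "norm (of_real (gauss t) * u (a + \<epsilon> *\<^sub>R t) * cnj (u a)) \<le> ?h a t"
        by (simp add: norm_mult mult.assoc mult_left_mono)
    qed
    finally show "ennreal (norm (gauss_mean u \<epsilon> a * cnj (u a))) \<le>
      (\<integral>\<^sup>+t. ennreal (?h a t) \<partial>lborel)" .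
  qed simp
  also have "(\<integral>\<^sup>+a. (\<integral>\<^sup>+t. ennreal (?h a t) \<partial>lborel) \<partial>lborel)
    = (\<integral>\<^sup>+t. (\<integral>\<^sup>+a. ennreal (?h a t) \<partial>lborel) \<partial>lborel)"
    by (intro lborel_pair.Fubini') measurable
  also have "\<dots> = (\<integral>\<^sup>+t. ennreal (gauss (t::'a)) * energy u \<partial>lborel)"
  proof (intro nn_integral_cong)
    fix t :: 'a
    \<comment> \<open>Translation invariance gives both halves of \<open>?h\<close> the same
      integral over \<open>a\<close>, whatever \<open>t\<close> is.\<close>
    have shift: "(\<integral>\<^sup>+a. ennreal ((norm (u (a + \<epsilon> *\<^sub>R t)))\<^sup>2 / 2) \<partial>lborel) = (\<integral>\<^sup>+x. ennreal ((norm (u x))\<^sup>2 / 2) \<partial>lborel)"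
      by (subst (2) nn_integral_affine[where c=1 and t="\<epsilon> *\<^sub>R t"]) (auto simp: add.commute)
    have "(\<integral>\<^sup>+a. ennreal (?h a t) \<partial>lborel)
       = (\<integral>\<^sup>+a. ennreal (gauss t) * (ennreal ((norm (u (a + \<epsilon> *\<^sub>R t)))\<^sup>2 / 2) + ennreal ((norm (u a))\<^sup>2 / 2)) \<partial>lborel)"
      by (intro nn_integral_cong) (simp add: ennreal_mult flip: ennreal_plus)
    also have "\<dots> = ennreal (gauss t) * ((\<integral>\<^sup>+a. ennreal ((norm (u (a + \<epsilon> *\<^sub>R t)))\<^sup>2 / 2) \<partial>lborel) + (\<integral>\<^sup>+a. ennreal ((norm (u a))\<^sup>2 / 2) \<partial>lborel))"
      by (subst nn_integral_cmult) (auto simp: nn_integral_add)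
    also have "(\<integral>\<^sup>+a. ennreal ((norm (u (a + \<epsilon> *\<^sub>R t)))\<^sup>2 / 2) \<partial>lborel) + (\<integral>\<^sup>+a. ennreal ((norm (u a))\<^sup>2 / 2) \<partial>lborel)
        = (\<integral>\<^sup>+a. ennreal ((norm (u a))\<^sup>2 / 2) + ennreal ((norm (u a))\<^sup>2 / 2) \<partial>lborel)"
      unfolding shift by (subst nn_integral_add) auto
    also have "\<dots> = energy u"
      by (intro nn_integral_cong) (simp flip: ennreal_plus)
    finally show "(\<integral>\<^sup>+a. ennreal (?h a t) \<partial>lborel)
      = ennreal (gauss t) * energy u" .
  qed
  also have "\<dots> = (\<integral>\<^sup>+t. ennreal (gauss (t::'a)) \<partial>lborel) * energy u"
    by (rule nn_integral_multc) auto
  also have "(\<integral>\<^sup>+t. ennreal (gauss (t::'a)) \<partial>lborel) = ennreal ((2 * pi) powr (DIM('a) / 2))"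
    by (subst nn_integral_eq_integral[OF integrable_gauss]) (auto simp: integral_gauss)
  also have "ennreal ?c * (\<dots> * energy u) = energy u"
    using fourier_const_pos[where 'a='a]
    by (simp add: mult.assoc[symmetric] fourier_const_inverse flip: ennreal_mult)
  finally show ?thesis unfolding U_def .
qed

text \<open>The damping factor tends to 1 pointwise, and Fatou's lemma carries the uniform bound to
  the limit. The energy of \<open>u\<close> may be infinite here.\<close>

lemma fourier_integral_contraction:
  fixes u :: "'a::euclidean_space \<Rightarrow> complex"
  assumes u: "integrable lborel u"
  shows "energy (fourier_integral u) \<le> energy u"
proof -
  have [measurable]: "u \<in> borel_measurable borel" using u by auto
  define f where "f k \<xi> = ennreal ((norm (fourier_integral u \<xi>))\<^sup>2 * gauss ((1 / real (Suc k)) *\<^sub>R \<xi>))" for k \<xi>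
  have [measurable]: "f k \<in> borel_measurable borel" for k unfolding f_def by measurable
  have "(\<lambda>k. f k \<xi>) \<longlonglongrightarrow> ennreal ((norm (fourier_integral u \<xi>))\<^sup>2)" for \<xi>
  proof -
    have "(\<lambda>k. 1 / real (Suc k)) \<longlonglongrightarrow> 0" using LIMSEQ_inverse_real_of_nat by (simp add: inverse_eq_divide)
    then have "(\<lambda>k. (norm (fourier_integral u \<xi>))\<^sup>2 * exp (- (norm ((1 / real (Suc k)) *\<^sub>R \<xi>))\<^sup>2 / 2))
        \<longlonglongrightarrow> (norm (fourier_integral u \<xi>))\<^sup>2 * exp (- (norm (0 *\<^sub>R \<xi>))\<^sup>2 / 2)"
      by (intro tendsto_intros) auto
    then show ?thesis unfolding f_def gauss_def by (intro tendsto_ennrealI) simp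
  qed
  then have "energy (fourier_integral u) = (\<integral>\<^sup>+\<xi>. liminf (\<lambda>k. f k \<xi>) \<partial>lborel)"
    by (intro nn_integral_cong lim_imp_Liminf[symmetric]) auto
  also have "\<dots> \<le> liminf (\<lambda>k. \<integral>\<^sup>+\<xi>. f k \<xi> \<partial>lborel)" by (rule nn_integral_liminf) auto
  also have "\<dots> \<le> liminf (\<lambda>k::nat. energy u)"
    unfolding f_def by (intro Liminf_mono always_eventually allI fourier_integral_gauss_bound[OF u]) auto
  finally show ?thesis by (simp add: Liminf_const)
qed

section \<open>The Fourier transform on square integrable functions\<close>

lemma L2_Cauchy_Schwarz:
  fixes f g :: "'a \<Rightarrow> complex"
  assumes [measurable]: "f \<in> borel_measurable M" "g \<in> borel_measurable M"
  shows "(\<integral>\<^sup>+x. norm (f x * g x) \<partial>M)\<^sup>2 \<le>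
    (\<integral>\<^sup>+x. ennreal ((norm (f x))\<^sup>2) \<partial>M) * (\<integral>\<^sup>+x. ennreal ((norm (g x))\<^sup>2) \<partial>M)"
  using Cauchy_Schwarz_nn_integral[of "\<lambda>x. ennreal (norm (f x))" M "\<lambda>x. ennreal (norm (g x))"]
  by (simp add: norm_mult ennreal_mult ennreal_power)

text \<open>The Riesz-Fischer argument. With squared distances below \<open>(1 / 4) ^ k\<close>, the
  weights \<open>2 ^ k\<close> still leave a summable series of integrals; almost everywhere the
  weighted squares are then bounded, so the increments decay like \<open>(1 / sqrt 2) ^ k\<close>
  and the sequence converges.\<close>

lemma L2_Cauchy_limit:
  fixes F :: "nat \<Rightarrow> 'a::euclidean_space \<Rightarrow> complex"
  assumes [measurable]: "\<And>k. F k \<in> borel_measurable lborel"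
    and F: "\<And>k. energy (\<lambda>x. F (Suc k) x - F k x) \<le> ennreal ((1 / 4) ^ k)"
  obtains g where "g \<in> borel_measurable lborel" "AE x in lborel. (\<lambda>k. F k x) \<longlonglongrightarrow> g x"
proof -
  define d where "d k x = norm (F (Suc k) x - F k x)" for k x
  have "(\<integral>\<^sup>+x. (\<Sum>k. ennreal (2 ^ k * (d k x)\<^sup>2)) \<partial>lborel) = (\<Sum>k. \<integral>\<^sup>+x. ennreal (2 ^ k * (d k x)\<^sup>2) \<partial>lborel)"
    unfolding d_def by (rule nn_integral_suminf) measurable
  also have "\<dots> \<le> (\<Sum>k. ennreal ((1 / 2) ^ k))"
  proof (intro suminf_le allI summableI)
    fix k
    have "(\<integral>\<^sup>+x. ennreal (2 ^ k * (d k x)\<^sup>2) \<partial>lborel) = ennreal (2 ^ k) * (\<integral>\<^sup>+x. ennreal ((d k x)\<^sup>2) \<partial>lborel)"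
      unfolding d_def by (subst nn_integral_cmult[symmetric]) (auto simp: ennreal_mult)
    also have "\<dots> \<le> ennreal (2 ^ k) * ennreal ((1 / 4) ^ k)"
      unfolding d_def by (intro mult_left_mono F) auto
    also have "\<dots> = ennreal ((1 / 2) ^ k)" by (simp add: power_mult_distrib[symmetric] flip: ennreal_mult)
    finally show "(\<integral>\<^sup>+x. ennreal (2 ^ k * (d k x)\<^sup>2) \<partial>lborel) \<le> ennreal ((1 / 2) ^ k)" .
  qed
  also have "\<dots> < \<infinity>" by (subst suminf_ennreal2) (auto simp: summable_geometric)
  finally have "AE x in lborel. (\<Sum>k. ennreal (2 ^ k * (d k x)\<^sup>2)) \<noteq> \<infinity>"
    by (intro nn_integral_PInf_AE) (auto simp: d_def)
  then have conv: "AE x in lborel. convergent (\<lambda>k. F k x)"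
  proof eventually_elim
    fix x assume *: "(\<Sum>k. ennreal (2 ^ k * (d k x)\<^sup>2)) \<noteq> \<infinity>"
    have "summable (\<lambda>k. 2 ^ k * (d k x)\<^sup>2)"
      using * by (intro summable_suminf_not_top) auto
    then have "Bseq (\<lambda>k. 2 ^ k * (d k x)\<^sup>2)"
      by (rule summable_imp_Bseq)
    then obtain K where K: "K > 0" "\<And>k. norm (2 ^ k * (d k x)\<^sup>2) \<le> K" by (auto elim: BseqE)
    have le: "d k x \<le> sqrt K * (1 / sqrt 2) ^ k" for k
    proof -
      have "(d k x)\<^sup>2 \<le> K / 2 ^ k" using K(2)[of k] by (simp add: abs_mult field_simps)
      then have "d k x \<le> sqrt (K / 2 ^ k)" by (rule real_le_rsqrt)
      then show ?thesis by (simp add: real_sqrt_divide real_sqrt_power power_one_over)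
    qed
    have "summable (\<lambda>k. sqrt K * (1 / sqrt 2) ^ k)"
      by (intro summable_mult summable_geometric) auto
    then have "summable (\<lambda>k. norm (F (Suc k) x - F k x))"
      by (rule summable_comparison_test'[where N=0]) (use le in \<open>simp add: d_def\<close>)
    then have "summable (\<lambda>k. F (Suc k) x - F k x)" by (rule summable_norm_cancel)
    then have "convergent (\<lambda>n. \<Sum>k<n. F (Suc k) x - F k x)" by (simp add: summable_iff_convergent)
    then have "convergent (\<lambda>n. F n x - F 0 x)" unfolding sum_lessThan_telescope[of "\<lambda>k. F k x"] .
    then show "convergent (\<lambda>n. F n x)" by (simp add: convergent_diff_const_right_iff)
  qed
  have "(\<lambda>x. lim (\<lambda>k. F k x)) \<in> borel_measurable lborel" by measurable
  moreover have "AE x in lborel. (\<lambda>k. F k x) \<longlonglongrightarrow> lim (\<lambda>k. F k x)"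
    using conv by eventually_elim (rule convergent_LIMSEQ_iff[THEN iffD1])
  ultimately show ?thesis by (rule that)
qed

text \<open>Fubini and affine substitution are applied to Borel functions, whereas square integrable
  functions are only Lebesgue measurable; this is the passage between the two.\<close>

lemma borel_representative:
  fixes u :: "'a::euclidean_space \<Rightarrow> complex"
  assumes [measurable]: "u \<in> borel_measurable lebesgue"
  obtains u' where "u' \<in> borel_measurable borel" "AE x in lebesgue. u x = u' x"
proof -
  obtain a where a: "a \<in> borel_measurable borel" "AE x in lborel. Re (u x) = a x"
    using completion_ex_borel_measurable_real[of "\<lambda>x. Re (u x)" lborel] by auto
  obtain b where b: "b \<in> borel_measurable borel" "AE x in lborel. Im (u x) = b x"
    using completion_ex_borel_measurable_real[of "\<lambda>x. Im (u x)" lborel] by auto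
  show ?thesis
  proof (rule that)
    show "(\<lambda>x. of_real (a x) + \<i> * of_real (b x)) \<in> borel_measurable borel" using a b by measurable
    have "AE x in lborel. u x = of_real (a x) + \<i> * of_real (b x)"
      using a(2) b(2) by eventually_elim (metis complex_eq)
    then show "AE x in lebesgue. u x = of_real (a x) + \<i> * of_real (b x)" by (rule AE_completion)
  qed
qed

lemma fourier_integral_cong_AE:
  fixes u v :: "'a::euclidean_space \<Rightarrow> complex"
  assumes "u \<in> borel_measurable lebesgue" "v \<in> borel_measurable lebesgue" "AE x in lebesgue. u x = v x"
  shows "fourier_integral u = fourier_integral v"
proof
  fix \<xi>
  have [measurable]: "(\<lambda>x::'a. cis (- (x \<bullet> \<xi>))) \<in> borel_measurable lebesgue"
    by (rule measurable_completion) measurable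
  have "(LINT x|lebesgue. cis (- (x \<bullet> \<xi>)) * u x) = (LINT x|lebesgue. cis (- (x \<bullet> \<xi>)) * v x)"
    using assms by (intro integral_cong_AE) auto
  then show "fourier_integral u \<xi> = fourier_integral v \<xi>" by (simp add: fourier_integral_def)
qed

abbreviation trunc :: "real \<Rightarrow> ('a::euclidean_space \<Rightarrow> complex) \<Rightarrow> 'a \<Rightarrow> complex" where
  "trunc R u \<equiv> (\<lambda>x. indicator (cball 0 R) x * u x)"

lemma integrable_trunc:
  fixes u :: "'a::euclidean_space \<Rightarrow> complex"
  assumes [measurable]: "u \<in> borel_measurable borel"
    and u: "integrable lborel (\<lambda>x. (norm (u x))\<^sup>2)"
  shows "integrable lborel (trunc R u)"
proof (rule Bochner_Integration.integrable_bound)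
  have "integrable lborel (indicator (cball 0 R) :: 'a \<Rightarrow> real)"
    using emeasure_lborel_cball_finite[of "0::'a" R] by (intro integrable_real_indicator) auto
  then show "integrable lborel (\<lambda>x. indicator (cball 0 R) x + (norm (u x))\<^sup>2)"
    using u by simp
  have "norm z \<le> 1 + (norm z)\<^sup>2" for z :: complex
    using sum_squares_bound[of 1 "norm z"] norm_ge_zero[of z] by (simp only: power_one mult_1_right)
  then show "AE x in lborel. norm (trunc R u x) \<le> norm (indicator (cball 0 R) x + (norm (u x))\<^sup>2)"
    by (auto simp: indicator_def intro!: AE_I2)
qed auto

lemma fourier_integral_diff:
  fixes u v :: "'a::euclidean_space \<Rightarrow> complex"
  assumes u: "integrable lborel u" and v: "integrable lborel v"
  shows "fourier_integral (\<lambda>x. u x - v x) \<xi> = fourier_integral u \<xi> - fourier_integral v \<xi>"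
proof -
  have [measurable]: "u \<in> borel_measurable borel" "v \<in> borel_measurable borel" using u v by auto
  have "integrable lborel (\<lambda>x. cis (- (x \<bullet> \<xi>)) * u x)"
    by (rule Bochner_Integration.integrable_bound[OF u]) (auto simp: norm_mult)
  moreover have "integrable lborel (\<lambda>x. cis (- (x \<bullet> \<xi>)) * v x)"
    by (rule Bochner_Integration.integrable_bound[OF v]) (auto simp: norm_mult)
  ultimately show ?thesis by (simp add: fourier_integral_lborel right_diff_distrib)
qed

definition tail_energy :: "('a::euclidean_space \<Rightarrow> complex) \<Rightarrow> real \<Rightarrow> ennreal" where
  "tail_energy u R = ennreal (\<integral>x. indicator (- cball 0 R) x * (norm (u x))\<^sup>2 \<partial>lborel)"

lemma tail_energy_tendsto:
  fixes u :: "'a::euclidean_space \<Rightarrow> complex"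
  assumes [measurable]: "u \<in> borel_measurable borel"
    and u: "integrable lborel (\<lambda>x. (norm (u x))\<^sup>2)"
  shows "(tail_energy u \<longlongrightarrow> 0) at_top"
proof -
  have "((\<lambda>R. \<integral>x. indicator (- cball 0 R) x * (norm (u x))\<^sup>2 \<partial>lborel) \<longlongrightarrow> (\<integral>x. 0 \<partial>(lborel :: 'a measure))) at_top"
  proof (rule integral_dominated_convergence_at_top)
    show "integrable lborel (\<lambda>x. (norm (u x))\<^sup>2)" by (rule u)
    show "\<forall>\<^sub>F R in at_top. AE x in lborel. norm (indicator (- cball 0 R) x * (norm (u x))\<^sup>2) \<le> (norm (u x))\<^sup>2"
      by (auto simp: indicator_def intro!: always_eventually)
    show "AE x in lborel. ((\<lambda>R. indicator (- cball 0 R) x * (norm (u x))\<^sup>2) \<longlongrightarrow> 0) at_top"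
    proof (rule AE_I2)
      fix x :: 'a
      have "eventually (\<lambda>R. indicator (- cball 0 R) x * (norm (u x))\<^sup>2 = 0) at_top"
        using eventually_ge_at_top[of "norm x"] by eventually_elim (auto simp: indicator_def)
      then show "((\<lambda>R. indicator (- cball 0 R) x * (norm (u x))\<^sup>2) \<longlongrightarrow> 0) at_top"
        by (rule tendsto_eventually)
    qed
  qed auto
  then show ?thesis unfolding tail_energy_def by (auto dest: tendsto_ennrealI)
qed

text \<open>The two truncations differ only outside the smaller ball, and their difference is
  integrable, so the contraction estimate applies to it.\<close>

lemma fourier_integral_trunc_diff:
  fixes u :: "'a::euclidean_space \<Rightarrow> complex"
  assumes [measurable]: "u \<in> borel_measurable borel"
    and u: "integrable lborel (\<lambda>x. (norm (u x))\<^sup>2)"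
  shows "energy (\<lambda>\<xi>. fourier_integral (trunc R u) \<xi> - fourier_integral (trunc S u) \<xi>)
    \<le> tail_energy u (min R S)"
proof -
  note i = integrable_trunc[OF assms]
  have "energy (\<lambda>\<xi>. fourier_integral (trunc R u) \<xi> - fourier_integral (trunc S u) \<xi>)
      = energy (fourier_integral (\<lambda>x. trunc R u x - trunc S u x))"
    by (simp add: fourier_integral_diff[OF i i])
  also have "\<dots> \<le> energy (\<lambda>x. trunc R u x - trunc S u x)"
    by (intro fourier_integral_contraction Bochner_Integration.integrable_diff i)
  also have "\<dots> \<le> (\<integral>\<^sup>+x. ennreal (indicator (- cball 0 (min R S)) x * (norm (u x))\<^sup>2) \<partial>lborel)"
    by (intro nn_integral_mono ennreal_leI) (auto simp: indicator_def)
  also have "\<dots> = tail_energy u (min R S)"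
    unfolding tail_energy_def
    by (intro nn_integral_eq_integral Bochner_Integration.integrable_bound[OF u]) (auto simp: indicator_def)
  finally show ?thesis .
qed

text \<open>Transforms of truncations form a Cauchy family by the tail estimate. A limit is first
  found along radii with rapidly decreasing tails and then shown to be the limit along all
  radii.\<close>

lemma fourier_limit_exists:
  fixes u :: "'a::euclidean_space \<Rightarrow> complex"
  assumes [measurable]: "u \<in> borel_measurable borel"
    and u: "integrable lborel (\<lambda>x. (norm (u x))\<^sup>2)"
  shows "\<exists>g\<in>borel_measurable borel. integrable lborel (\<lambda>x. (norm (g x))\<^sup>2) \<and>
    ((\<lambda>R. \<integral>\<^sup>+\<xi>. ennreal ((norm (fourier_integral (trunc R u) \<xi> - g \<xi>))\<^sup>2) \<partial>lborel) \<longlongrightarrow> 0) at_top"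
proof -
  note T = tail_energy_tendsto[OF assms]
  have "\<exists>R. \<forall>k. tail_energy u (R k) \<le> ennreal ((1 / 4) ^ k)"
  proof (rule choice, rule allI)
    fix k :: nat
    have "eventually (\<lambda>R. tail_energy u R < ennreal ((1 / 4) ^ k)) at_top"
      by (rule order_tendstoD(2)[OF T]) simp
    then show "\<exists>R. tail_energy u R \<le> ennreal ((1 / 4) ^ k)"
      by (metis eventually_happens' less_imp_le trivial_limit_at_top_linorder)
  qed
  then obtain r where r: "\<And>k. tail_energy u (r k) \<le> ennreal ((1 / 4) ^ k)" by blast
  define U where "U R = fourier_integral (trunc R u)" for R
  have Um [measurable]: "U R \<in> borel_measurable borel" for R unfolding U_def by measurable
  \<comment> \<open>The radii \<open>r k\<close> are chosen one by one and may come in any order;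
    the sum covers both cases of the minimum.\<close>
  have min_le: "tail_energy u (min R S) \<le> tail_energy u R + tail_energy u S" for R S
    by (cases "R \<le> S") (auto simp: min_def)
  have pw: "(1 / 4 :: real) ^ Suc k \<le> (1 / 4) ^ k" for k by simp
  have "energy (\<lambda>x. U (r (Suc k)) x - U (r k) x) \<le> ennreal ((1 / 4) ^ k)" for k
  proof -
    have "energy (\<lambda>x. U (r (Suc k)) x - U (r k) x) \<le> tail_energy u (min (r (Suc k)) (r k))"
      unfolding U_def by (rule fourier_integral_trunc_diff[OF assms])
    also have "\<dots> \<le> ennreal ((1 / 4) ^ k)"
      using r[of k] order_trans[OF r[of "Suc k"] ennreal_leI[OF pw]] by (auto simp: min_def)
    finally show ?thesis .
  qed
  note Cauchy = this
  have Um': "U (r k) \<in> borel_measurable lborel" for k by simp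
  obtain g where "g \<in> borel_measurable lborel" and g: "AE x in lborel. (\<lambda>k. U (r k) x) \<longlonglongrightarrow> g x"
    by (rule L2_Cauchy_limit[of "\<lambda>k. U (r k)", OF Um' Cauchy])
  then have gm [measurable]: "g \<in> borel_measurable borel" by simp
  \<comment> \<open>Fatou along the radii \<open>r k\<close> turns the estimate between two
    truncations into one between a truncation and the limit, with a bound that tends to 0.\<close>
  have bound: "energy (\<lambda>\<xi>. U R \<xi> - g \<xi>) \<le> tail_energy u R" for R
  proof -
    have "energy (\<lambda>\<xi>. U R \<xi> - g \<xi>) = (\<integral>\<^sup>+\<xi>. liminf (\<lambda>k. ennreal ((norm (U R \<xi> - U (r k) \<xi>))\<^sup>2)) \<partial>lborel)"
    proof (rule nn_integral_cong_AE)
      show "AE \<xi> in lborel. ennreal ((norm (U R \<xi> - g \<xi>))\<^sup>2) = liminf (\<lambda>k. ennreal ((norm (U R \<xi> - U (r k) \<xi>))\<^sup>2))"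
        using g
      proof eventually_elim
        case (elim \<xi>)
        then have "(\<lambda>k. ennreal ((norm (U R \<xi> - U (r k) \<xi>))\<^sup>2)) \<longlonglongrightarrow> ennreal ((norm (U R \<xi> - g \<xi>))\<^sup>2)"
          by (intro tendsto_ennrealI tendsto_intros)
        then show ?case by (intro lim_imp_Liminf[symmetric]) auto
      qed
    qed
    also have "\<dots> \<le> liminf (\<lambda>k. \<integral>\<^sup>+\<xi>. ennreal ((norm (U R \<xi> - U (r k) \<xi>))\<^sup>2) \<partial>lborel)"
      by (rule nn_integral_liminf) measurable
    also have "\<dots> \<le> liminf (\<lambda>k. tail_energy u R + ennreal ((1 / 4) ^ k))"
    proof (intro Liminf_mono always_eventually allI)
      fix k
      have "energy (\<lambda>\<xi>. U R \<xi> - U (r k) \<xi>) \<le> tail_energy u (min R (r k))"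
        unfolding U_def by (rule fourier_integral_trunc_diff[OF assms])
      also have "\<dots> \<le> tail_energy u R + tail_energy u (r k)" by (rule min_le)
      also have "\<dots> \<le> tail_energy u R + ennreal ((1 / 4) ^ k)" by (intro add_left_mono r)
      finally show "energy (\<lambda>\<xi>. U R \<xi> - U (r k) \<xi>) \<le> tail_energy u R + ennreal ((1 / 4) ^ k)" .
    qed
    also have "\<dots> = tail_energy u R"
    proof (rule lim_imp_Liminf)
      have "(\<lambda>k. tail_energy u R + ennreal ((1 / 4) ^ k)) \<longlonglongrightarrow> tail_energy u R + ennreal 0"
        by (intro tendsto_add tendsto_const tendsto_ennrealI LIMSEQ_realpow_zero) auto
      then show "(\<lambda>k. tail_energy u R + ennreal ((1 / 4) ^ k)) \<longlonglongrightarrow> tail_energy u R" by simp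
    qed simp
    finally show ?thesis .
  qed
  have lim: "((\<lambda>R. \<integral>\<^sup>+\<xi>. ennreal ((norm (U R \<xi> - g \<xi>))\<^sup>2) \<partial>lborel) \<longlongrightarrow> 0) at_top"
    by (rule tendsto_sandwich[OF _ _ tendsto_const T]) (auto simp: bound intro!: always_eventually)
  \<comment> \<open>\<open>g\<close> is compared with the transform of the truncation to radius 0:
    the distance is at most the tail energy, and the transform itself is controlled by the
    contraction estimate.\<close>
  have "energy g < \<infinity>"
  proof -
    have "(norm (g \<xi>))\<^sup>2 \<le> 2 * (norm (U 0 \<xi> - g \<xi>))\<^sup>2 + 2 * (norm (U 0 \<xi>))\<^sup>2" for \<xi>
    proof -
      have "(norm (g \<xi>))\<^sup>2 \<le> (norm (U 0 \<xi> - g \<xi>) + norm (U 0 \<xi>))\<^sup>2"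
        using norm_triangle_ineq4[of "U 0 \<xi>" "U 0 \<xi> - g \<xi>"] by (intro power_mono) auto
      also have "\<dots> \<le> 2 * (norm (U 0 \<xi> - g \<xi>))\<^sup>2 + 2 * (norm (U 0 \<xi>))\<^sup>2"
        using sum_squares_bound[of "norm (U 0 \<xi> - g \<xi>)" "norm (U 0 \<xi>)"] by (simp add: power2_sum)
      finally show ?thesis .
    qed
    then have "energy g
        \<le> (\<integral>\<^sup>+\<xi>. 2 * ennreal ((norm (U 0 \<xi> - g \<xi>))\<^sup>2) + 2 * ennreal ((norm (U 0 \<xi>))\<^sup>2) \<partial>lborel)"
      by (intro nn_integral_mono) (simp add: ennreal_mult[symmetric] ennreal_leI flip: ennreal_plus ennreal_numeral)
    also have "\<dots> = 2 * energy (\<lambda>\<xi>. U 0 \<xi> - g \<xi>) + 2 * energy (U 0)"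
      by (simp add: nn_integral_add nn_integral_cmult)
    also have "\<dots> \<le> 2 * tail_energy u 0 + 2 * energy (trunc 0 u)"
      unfolding U_def by (intro add_mono mult_left_mono bound[unfolded U_def] fourier_integral_contraction integrable_trunc assms) auto
    also have "\<dots> \<le> 2 * tail_energy u 0 + 2 * energy u"
      by (intro add_mono mult_left_mono nn_integral_mono ennreal_leI) (auto simp: indicator_def)
    also have "\<dots> < \<infinity>"
      using u by (auto simp: tail_energy_def integrable_iff_bounded ennreal_mult_less_top)
    finally show ?thesis .
  qed
  then have "integrable lborel (\<lambda>x. (norm (g x))\<^sup>2)" by (auto simp: integrable_iff_bounded)
  with lim gm show ?thesis unfolding U_def by blast
qed

text \<open>\<open>fourier u\<close> is chosen by \<open>SOME\<close>, so everything about it rests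
  on the existence of a limit. A Borel representative of \<open>u\<close> has truncations with the
  same Fourier integrals, and for it the limit was constructed.\<close>

lemma fourier_spec:
  fixes u :: "'a::euclidean_space \<Rightarrow> complex"
  assumes "square_integrable u"
  shows "square_integrable (fourier u)"
    and "((\<lambda>R::real. \<integral>\<^sup>+ \<xi>. ennreal ((norm (fourier_integral (trunc R u) \<xi> - fourier u \<xi>))\<^sup>2) \<partial>lebesgue) \<longlongrightarrow> 0) at_top"
proof -
  have um [measurable]: "u \<in> borel_measurable lebesgue" using assms by (simp add: square_integrable_def)
  obtain v where v [measurable]: "v \<in> borel_measurable borel" and uv: "AE x in lebesgue. u x = v x"
    using borel_representative[OF um] .
  have vm [measurable]: "v \<in> borel_measurable lebesgue" by (rule measurable_completion) simp
  have "integrable lebesgue (\<lambda>x. (norm (v x))\<^sup>2)"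
    using assms uv by (subst integrable_cong_AE[of _ _ "\<lambda>x. (norm (u x))\<^sup>2"]) (auto simp: square_integrable_def)
  then have "integrable lborel (\<lambda>x. (norm (v x))\<^sup>2)" by (subst (asm) integrable_completion) auto
  from fourier_limit_exists[OF v this] obtain g where
    g [measurable]: "g \<in> borel_measurable borel" and g2: "integrable lborel (\<lambda>x. (norm (g x))\<^sup>2)"
    and lim: "((\<lambda>R. \<integral>\<^sup>+\<xi>. ennreal ((norm (fourier_integral (trunc R v) \<xi> - g \<xi>))\<^sup>2) \<partial>lborel) \<longlongrightarrow> 0) at_top" by blast
  have ind [measurable]: "(indicator (cball 0 R) :: 'a \<Rightarrow> complex) \<in> borel_measurable lebesgue" for R
    by (rule measurable_completion) simp
  have "fourier_integral (trunc R u) = fourier_integral (trunc R v)" for R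
    by (rule fourier_integral_cong_AE) (use uv in auto)
  with lim have lim': "((\<lambda>R. \<integral>\<^sup>+\<xi>. ennreal ((norm (fourier_integral (trunc R u) \<xi> - g \<xi>))\<^sup>2) \<partial>lebesgue) \<longlongrightarrow> 0) at_top"
    by (simp add: nn_integral_completion)
  have "square_integrable g"
    unfolding square_integrable_def using g2 by (auto simp: integrable_completion intro: measurable_completion)
  with lim' have "\<exists>g. square_integrable g \<and> ((\<lambda>R::real. \<integral>\<^sup>+ \<xi>. ennreal ((norm
          (fourier_integral (trunc R u) \<xi> - g \<xi>))\<^sup>2) \<partial>lebesgue) \<longlongrightarrow> 0) at_top" by blast
  from someI_ex[OF this] show "square_integrable (fourier u)"
    "((\<lambda>R::real. \<integral>\<^sup>+ \<xi>. ennreal ((norm (fourier_integral (trunc R u) \<xi> - fourier u \<xi>))\<^sup>2) \<partial>lebesgue) \<longlongrightarrow> 0) at_top"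
    unfolding fourier_def by auto
qed

section \<open>Fourier inversion\<close>

lemma measurable_lebesgueI: "f \<in> borel_measurable borel \<Longrightarrow> f \<in> borel_measurable lebesgue"
  by (rule measurable_completion) simp

lemma square_integrable_borel_iff:
  assumes [measurable]: "f \<in> borel_measurable borel"
  shows "square_integrable f \<longleftrightarrow> integrable lborel (\<lambda>x. (norm (f x))\<^sup>2)"
  unfolding square_integrable_def using measurable_lebesgueI[OF assms] by (simp add: integrable_completion)

lemma square_integrable_cong_AE:
  assumes "square_integrable f" "g \<in> borel_measurable lebesgue" "AE x in lebesgue. f x = g x"
  shows "square_integrable g"
  using assms unfolding square_integrable_def
  by (auto intro!: integrable_cong_AE_imp[where g = "\<lambda>x. (norm (f x))\<^sup>2"])

lemma fourier_borel_representatives: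
  fixes u :: "'a::euclidean_space \<Rightarrow> complex"
  assumes u: "square_integrable u"
  obtains v g where
    "v \<in> borel_measurable borel" "AE x in lebesgue. u x = v x" "integrable lborel (\<lambda>x. (norm (v x))\<^sup>2)"
    "g \<in> borel_measurable borel" "AE \<xi> in lebesgue. fourier u \<xi> = g \<xi>" "integrable lborel (\<lambda>x. (norm (g x))\<^sup>2)"
    "((\<lambda>R. \<integral>\<^sup>+\<xi>. ennreal ((norm (fourier_integral (trunc R v) \<xi> - g \<xi>))\<^sup>2) \<partial>lborel) \<longlongrightarrow> 0) at_top"
proof -
  have um [measurable]: "u \<in> borel_measurable lebesgue" and hm: "fourier u \<in> borel_measurable lebesgue"
    using u fourier_spec(1)[OF u] by (auto simp: square_integrable_def)
  obtain v where v [measurable]: "v \<in> borel_measurable borel" and uv: "AE x in lebesgue. u x = v x"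
    using borel_representative[OF um] .
  obtain g where g [measurable]: "g \<in> borel_measurable borel" and ug: "AE \<xi> in lebesgue. fourier u \<xi> = g \<xi>"
    using borel_representative[OF hm] .
  have vm [measurable]: "v \<in> borel_measurable lebesgue" by (rule measurable_lebesgueI) simp
  have "square_integrable v" by (rule square_integrable_cong_AE[OF u vm uv])
  moreover have "square_integrable g"
    by (rule square_integrable_cong_AE[OF fourier_spec(1)[OF u] measurable_lebesgueI[OF g] ug])
  moreover have ind [measurable]: "(indicator (cball 0 R) :: 'a \<Rightarrow> complex) \<in> borel_measurable lebesgue" for R
    by (rule measurable_lebesgueI) simp
  have "fourier_integral (trunc R u) = fourier_integral (trunc R v)" for R
    by (rule fourier_integral_cong_AE) (use uv in auto)
  then have "(\<integral>\<^sup>+\<xi>. ennreal ((norm (fourier_integral (trunc R u) \<xi> - fourier u \<xi>))\<^sup>2) \<partial>lebesgue) =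
      (\<integral>\<^sup>+\<xi>. ennreal ((norm (fourier_integral (trunc R v) \<xi> - g \<xi>))\<^sup>2) \<partial>lebesgue)" for R
    using ug by (intro nn_integral_cong_AE) auto
  then have "((\<lambda>R. \<integral>\<^sup>+\<xi>. ennreal ((norm (fourier_integral (trunc R v) \<xi> - g \<xi>))\<^sup>2) \<partial>lborel) \<longlongrightarrow> 0) at_top"
    using fourier_spec(2)[OF u] by (simp add: nn_integral_completion)
  ultimately show ?thesis using that[OF v uv _ g ug] by (simp add: square_integrable_borel_iff)
qed

lemma gauss_square_integrable:
  fixes a :: "'a::euclidean_space"
  assumes "\<epsilon> > 0"
  shows "integrable lborel (\<lambda>\<xi>::'a. gauss (\<epsilon> *\<^sub>R \<xi>))"
    and "square_integrable (\<lambda>\<xi>. cis (a \<bullet> \<xi>) * complex_of_real (gauss (\<epsilon> *\<^sub>R \<xi>)))"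
proof -
  have "integrable lborel (\<lambda>\<xi>::'a. gauss (0 + \<epsilon> *\<^sub>R \<xi>))"
    using assms by (intro lborel_integrable_affine integrable_gauss) auto
  then show G: "integrable lborel (\<lambda>\<xi>::'a. gauss (\<epsilon> *\<^sub>R \<xi>))" by simp
  have "integrable lborel (\<lambda>\<xi>::'a. (norm (cis (a \<bullet> \<xi>) * complex_of_real (gauss (\<epsilon> *\<^sub>R \<xi>))))\<^sup>2)"
    by (rule Bochner_Integration.integrable_bound[OF G])
      (auto simp: norm_mult power2_eq_square intro!: AE_I2 mult_left_le)
  then show "square_integrable (\<lambda>\<xi>. cis (a \<bullet> \<xi>) * complex_of_real (gauss (\<epsilon> *\<^sub>R \<xi>)))"
    by (subst square_integrable_borel_iff) auto
qed

lemma integrable_gauss_translate: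
  fixes v :: "'a::euclidean_space \<Rightarrow> complex"
  assumes [measurable]: "v \<in> borel_measurable borel" and v: "integrable lborel (\<lambda>x. (norm (v x))\<^sup>2)"
    and "\<epsilon> > 0"
  shows "integrable lborel (\<lambda>t. of_real (gauss t) * v (a + \<epsilon> *\<^sub>R t))"
proof (rule Bochner_Integration.integrable_bound)
  show "integrable lborel (\<lambda>t. gauss t + (norm (v (a + \<epsilon> *\<^sub>R t)))\<^sup>2)"
    using \<open>\<epsilon> > 0\<close> by (intro Bochner_Integration.integrable_add integrable_gauss
      lborel_integrable_affine[where f="\<lambda>x. (norm (v x))\<^sup>2"] v) auto
  have "gauss t * r \<le> gauss t + r\<^sup>2" if "r \<ge> 0" for r and t :: 'a
  proof -
    have "gauss t * r \<le> gauss t * (1 + r\<^sup>2)"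
      using sum_squares_bound[of 1 r] that by (intro mult_left_mono) (auto simp: algebra_simps)
    also have "\<dots> \<le> gauss t + r\<^sup>2" by (simp add: distrib_left mult_left_le_one_le)
    finally show ?thesis .
  qed
  then show "AE t in lborel. norm (of_real (gauss t) * v (a + \<epsilon> *\<^sub>R t)) \<le> norm (gauss t + (norm (v (a + \<epsilon> *\<^sub>R t)))\<^sup>2)"
    by (auto simp: norm_mult intro!: AE_I2 intro: order_trans[OF _ abs_ge_self])
qed auto

text \<open>The integrable version holds for each truncation. As the radius grows, the left side
  converges by Cauchy-Schwarz because the damped wave is square integrable, and the right side by
  dominated convergence.\<close>

lemma gaussian_inversion_L2:
  fixes v g :: "'a::euclidean_space \<Rightarrow> complex"
  assumes vm [measurable]: "v \<in> borel_measurable borel" and v: "integrable lborel (\<lambda>x. (norm (v x))\<^sup>2)"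
    and gm [measurable]: "g \<in> borel_measurable borel" and g: "integrable lborel (\<lambda>x. (norm (g x))\<^sup>2)"
    and lim: "((\<lambda>R. \<integral>\<^sup>+\<xi>. ennreal ((norm (fourier_integral (trunc R v) \<xi> - g \<xi>))\<^sup>2) \<partial>lborel) \<longlongrightarrow> 0) at_top"
    and "\<epsilon> > 0"
  shows "(\<integral>\<xi>. g \<xi> * gauss_wave \<epsilon> a \<xi> \<partial>lborel) =
    gauss_mean v \<epsilon> a"
proof -
  define \<psi> where "\<psi> \<xi> = cis (a \<bullet> \<xi>) * complex_of_real (gauss (\<epsilon> *\<^sub>R \<xi>))" for \<xi>
  have [measurable]: "\<psi> \<in> borel_measurable borel" unfolding \<psi>_def by measurable
  have psi2: "square_integrable \<psi>" unfolding \<psi>_def by (rule gauss_square_integrable[OF \<open>\<epsilon> > 0\<close>])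
  have prod_int: "integrable lborel (\<lambda>\<xi>. h \<xi> * \<psi> \<xi>)" if [measurable]: "h \<in> borel_measurable borel" and "integrable lborel (\<lambda>\<xi>. (norm (h \<xi>))\<^sup>2)" for h
    using square_integrable_product[of h \<psi>, OF _ psi2] that
    by (simp add: square_integrable_borel_iff integrable_completion)
  define U where "U R = fourier_integral (trunc R v)" for R
  have Um [measurable]: "U R \<in> borel_measurable borel" for R unfolding U_def by measurable
  let ?z = "\<lambda>R. (\<integral>\<xi>. U R \<xi> * \<psi> \<xi> \<partial>lborel) - (\<integral>\<xi>. g \<xi> * \<psi> \<xi> \<partial>lborel)"
  have U2: "integrable lborel (\<lambda>\<xi>. (norm (U R \<xi>))\<^sup>2)" for R
  proof -
    have "energy (U R) \<le> energy (trunc R v)"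
      unfolding U_def by (intro fourier_integral_contraction integrable_trunc vm v)
    also have "\<dots> \<le> energy v"
      by (intro nn_integral_mono ennreal_leI) (auto simp: indicator_def)
    also have "\<dots> < \<infinity>" using v by (simp add: integrable_iff_bounded)
    finally show ?thesis by (simp add: integrable_iff_bounded)
  qed
  define D where "D R = energy (\<lambda>\<xi>. U R \<xi> - g \<xi>)" for R
  define K where "K = energy \<psi>"
  have K: "K < \<infinity>" using psi2 unfolding K_def by (simp add: square_integrable_borel_iff integrable_iff_bounded)
  have le: "ennreal ((norm (?z R))\<^sup>2) \<le> K * D R" for R
  proof -
    have "(?z R) = (\<integral>\<xi>. (U R \<xi> - g \<xi>) * \<psi> \<xi> \<partial>lborel)"
      by (simp add: left_diff_distrib prod_int U2 g)
    then have "ennreal (norm (?z R)) \<le> (\<integral>\<^sup>+\<xi>. norm ((U R \<xi> - g \<xi>) * \<psi> \<xi>) \<partial>lborel)"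
      by (simp add: norm_integral_le_nn_integral)
    then have "(ennreal (norm (?z R)))\<^sup>2 \<le> (\<integral>\<^sup>+\<xi>. norm ((U R \<xi> - g \<xi>) * \<psi> \<xi>) \<partial>lborel)\<^sup>2"
      by (intro power_mono) auto
    also have "\<dots> \<le> D R * K" unfolding D_def K_def by (intro L2_Cauchy_Schwarz) auto
    finally show ?thesis by (simp add: ennreal_power mult.commute)
  qed
  have "((\<lambda>R. K * D R) \<longlongrightarrow> K * 0) at_top"
    using lim K unfolding D_def[symmetric] U_def[symmetric] by (intro tendsto_mult_ennreal tendsto_const) auto
  then have KD: "((\<lambda>R. K * D R) \<longlongrightarrow> 0) at_top" by simp
  have "((\<lambda>R. ennreal ((norm (?z R))\<^sup>2)) \<longlongrightarrow> ennreal 0) at_top"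
    by (rule tendsto_sandwich[where f = "\<lambda>_. 0" and h = "\<lambda>R. K * D R"]) (use KD in \<open>simp_all add: le\<close>)
  then have "((\<lambda>R. (norm (?z R))\<^sup>2) \<longlongrightarrow> 0) at_top"
    by (subst (asm) tendsto_ennreal_iff) auto
  then have "((\<lambda>R. norm (?z R)) \<longlongrightarrow> 0) at_top"
    by (auto dest: tendsto_real_sqrt)
  then have "((\<lambda>R. (\<integral>\<xi>. U R \<xi> * \<psi> \<xi> \<partial>lborel)) \<longlongrightarrow> (\<integral>\<xi>. g \<xi> * \<psi> \<xi> \<partial>lborel)) at_top"
    by (simp add: tendsto_norm_zero_iff LIM_zero_iff)
  note l1 = this
  have l2: "((\<lambda>R. gauss_mean (trunc R v) \<epsilon> a) \<longlongrightarrow>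
      gauss_mean v \<epsilon> a) at_top"
  proof (rule integral_dominated_convergence_at_top)
    show "integrable lborel (\<lambda>t. norm (of_real (gauss t) * v (a + \<epsilon> *\<^sub>R t)))"
      by (intro integrable_norm integrable_gauss_translate vm v \<open>\<epsilon> > 0\<close>)
    show "\<forall>\<^sub>F R in at_top. AE t in lborel. norm (of_real (gauss t) * trunc R v (a + \<epsilon> *\<^sub>R t)) \<le> norm (of_real (gauss t) * v (a + \<epsilon> *\<^sub>R t))"
      by (auto simp: indicator_def norm_mult intro!: always_eventually)
    show "AE t in lborel. ((\<lambda>R. of_real (gauss t) * trunc R v (a + \<epsilon> *\<^sub>R t)) \<longlongrightarrow> of_real (gauss t) * v (a + \<epsilon> *\<^sub>R t)) at_top"
    proof (rule AE_I2)
      fix t :: 'a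
      have "eventually (\<lambda>R. of_real (gauss t) * trunc R v (a + \<epsilon> *\<^sub>R t) = of_real (gauss t) * v (a + \<epsilon> *\<^sub>R t)) at_top"
        using eventually_ge_at_top[of "norm (a + \<epsilon> *\<^sub>R t)"] by eventually_elim (auto simp: indicator_def)
      then show "((\<lambda>R. of_real (gauss t) * trunc R v (a + \<epsilon> *\<^sub>R t)) \<longlongrightarrow> of_real (gauss t) * v (a + \<epsilon> *\<^sub>R t)) at_top"
        by (rule tendsto_eventually)
    qed
  qed auto
  have l3: "gauss_mean (trunc R v) \<epsilon> a = (\<integral>\<xi>. U R \<xi> * \<psi> \<xi> \<partial>lborel)" for R
    unfolding U_def \<psi>_def by (rule gaussian_inversion_L1[OF integrable_trunc[OF vm v] \<open>\<epsilon> > 0\<close>, symmetric])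
  show ?thesis
    using tendsto_unique[OF trivial_limit_at_top_linorder l1 l2[unfolded l3]] by (simp only: \<psi>_def)
qed

text \<open>The translation is moved from \<open>v\<close> to the indicator of the box, which
  converges off the boundary of the box, a null set.\<close>

lemma local_average_continuous:
  fixes v :: "'a::euclidean_space \<Rightarrow> complex"
  assumes [measurable]: "v \<in> borel_measurable borel" and v: "integrable lborel (\<lambda>x. (norm (v x))\<^sup>2)"
    and \<tau>: "\<tau> \<longlonglongrightarrow> 0"
  shows "(\<lambda>k. \<integral>x. indicator (cbox p q) x * v (x + \<tau> k) \<partial>lborel) \<longlonglongrightarrow> (\<integral>x. indicator (cbox p q) x * v x \<partial>lborel)"
proof -
  have shift: "(\<integral>x. indicator (cbox p q) x * v (x + s) \<partial>lborel) = (\<integral>x. indicator (cbox p q) (x - s) * v x \<partial>lborel)" for s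
    by (subst (2) lborel_integral_affine[where c=1 and t=s]) (auto simp: add.commute)
  obtain r where r: "\<And>x. x \<in> cbox p q \<Longrightarrow> norm x \<le> r" using bounded_cbox[of p q] by (auto simp: bounded_iff)
  \<comment> \<open>Convergent shifts are bounded, so all shifted boxes lie in one ball; the
    truncation of \<open>v\<close> to it is integrable and dominates.\<close>
  have "Bseq \<tau>" by (rule convergent_imp_Bseq[OF convergentI[OF \<tau>]])
  then obtain T where T: "\<And>k. norm (\<tau> k) \<le> T" unfolding Bseq_def by blast
  have "(\<lambda>k. \<integral>x. indicator (cbox p q) (x - \<tau> k) * v x \<partial>lborel) \<longlonglongrightarrow> (\<integral>x. indicator (cbox p q) x * v x \<partial>lborel)"
  proof (rule integral_dominated_convergence)
    show "integrable lborel (\<lambda>x. norm (trunc (r + T) v x))"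
      by (intro integrable_norm integrable_trunc assms)
    show "AE x in lborel. norm (indicator (cbox p q) (x - \<tau> k) * v x) \<le> norm (trunc (r + T) v x)" for k
    proof (rule AE_I2)
      fix x
      have "norm x \<le> r + T" if "x - \<tau> k \<in> cbox p q"
        using norm_triangle_ineq[of "x - \<tau> k" "\<tau> k"] r[OF that] T[of k] by simp
      then show "norm (indicator (cbox p q) (x - \<tau> k) * v x) \<le> norm (trunc (r + T) v x)"
        by (auto simp: indicator_def)
    qed
    show "AE x in lborel. (\<lambda>k. indicator (cbox p q) (x - \<tau> k) * v x) \<longlonglongrightarrow> indicator (cbox p q) x * v x"
      using AE_not_in[OF null_sets_cbox_Diff_box[of p q]]
    proof eventually_elim
      fix x assume x: "x \<notin> cbox p q - box p q"
      have lim: "(\<lambda>k. x - \<tau> k) \<longlonglongrightarrow> x" using tendsto_diff[OF tendsto_const \<tau>, of x] by simp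
      have "eventually (\<lambda>k. indicator (cbox p q) (x - \<tau> k) = (indicator (cbox p q) x :: complex)) sequentially"
      proof (cases "x \<in> box p q")
        case True
        have "eventually (\<lambda>k. x - \<tau> k \<in> box p q) sequentially"
          by (rule topological_tendstoD[OF lim open_box True])
        then show ?thesis by eventually_elim (use True box_subset_cbox in \<open>auto simp: indicator_def\<close>)
      next
        case False
        with x have "x \<in> - cbox p q" by auto
        then have "eventually (\<lambda>k. x - \<tau> k \<in> - cbox p q) sequentially"
          by (intro topological_tendstoD[OF lim]) auto
        then show ?thesis by eventually_elim (use \<open>x \<in> - cbox p q\<close> in \<open>auto simp: indicator_def\<close>)
      qed
      then have "eventually (\<lambda>k. indicator (cbox p q) (x - \<tau> k) * v x = indicator (cbox p q) x * v x) sequentially"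
        by eventually_elim simp
      then show "(\<lambda>k. indicator (cbox p q) (x - \<tau> k) * v x) \<longlonglongrightarrow> indicator (cbox p q) x * v x"
        by (rule tendsto_eventually)
    qed
  qed auto
  then show ?thesis by (simp only: shift)
qed

text \<open>Integrating \<open>inv\<close> over a box before \<open>\<epsilon>\<close> tends to 0
  replaces pointwise convergence of Gaussian means by continuity of box averages under
  translation.\<close>

lemma averaged_inversion:
  fixes v g :: "'a::euclidean_space \<Rightarrow> complex"
  assumes vm [measurable]: "v \<in> borel_measurable borel" and v: "integrable lborel (\<lambda>x. (norm (v x))\<^sup>2)"
    and gm [measurable]: "g \<in> borel_measurable borel" and g: "integrable lborel g"
    and inv: "\<And>\<epsilon> a. \<epsilon> > 0 \<Longrightarrow> (\<integral>\<xi>. g \<xi> * gauss_wave \<epsilon> a \<xi> \<partial>lborel) =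
      gauss_mean v \<epsilon> a"
  shows "(\<integral>a. indicator (cbox p q) a * (of_real (fourier_const TYPE('a)) * (\<integral>\<xi>. cis (a \<bullet> \<xi>) * g \<xi> \<partial>lborel)) \<partial>lborel)
     = (\<integral>a. indicator (cbox p q) a * v a \<partial>lborel)"
proof -
  let ?B = "indicator (cbox p q) :: 'a \<Rightarrow> complex"
  define \<epsilon> where "\<epsilon> k = 1 / real (Suc k)" for k
  let ?G = "\<lambda>k t a. of_real (gauss t) * (?B a * v (a + \<epsilon> k *\<^sub>R t))"
  have \<epsilon>: "\<epsilon> k > 0" for k by (simp add: \<epsilon>_def)
  have \<epsilon>0: "\<epsilon> \<longlonglongrightarrow> 0" unfolding \<epsilon>_def using LIMSEQ_inverse_real_of_nat by (simp add: inverse_eq_divide)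
  define w where "w a = (\<integral>\<xi>. cis (a \<bullet> \<xi>) * g \<xi> \<partial>lborel)" for a
  define R where "R k a = (\<integral>\<xi>. g \<xi> * (cis (a \<bullet> \<xi>) * of_real (gauss (\<epsilon> k *\<^sub>R \<xi>))) \<partial>lborel)" for k a
  have Rm [measurable]: "R k \<in> borel_measurable borel" for k unfolding R_def by measurable
  have wm [measurable]: "w \<in> borel_measurable borel" unfolding w_def by measurable
  have Rw: "(\<lambda>k. R k a) \<longlonglongrightarrow> w a" for a
    unfolding R_def w_def
  proof (rule integral_dominated_convergence)
    show "integrable lborel (\<lambda>\<xi>. norm (g \<xi>))" using g by simp
    show "AE \<xi> in lborel. norm (g \<xi> * (cis (a \<bullet> \<xi>) * of_real (gauss (\<epsilon> k *\<^sub>R \<xi>)))) \<le> norm (g \<xi>)" for k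
      by (auto simp: norm_mult intro!: AE_I2 mult_left_le)
    show "AE \<xi> in lborel. (\<lambda>k. g \<xi> * (cis (a \<bullet> \<xi>) * of_real (gauss (\<epsilon> k *\<^sub>R \<xi>)))) \<longlonglongrightarrow> cis (a \<bullet> \<xi>) * g \<xi>"
    proof (rule AE_I2)
      fix \<xi> :: 'a
      have "(\<lambda>k. g \<xi> * (cis (a \<bullet> \<xi>) * of_real (exp (- (norm (\<epsilon> k *\<^sub>R \<xi>))\<^sup>2 / 2)))) \<longlonglongrightarrow>
        g \<xi> * (cis (a \<bullet> \<xi>) * of_real (exp (- (norm (0 *\<^sub>R \<xi>))\<^sup>2 / 2)))"
        by (intro tendsto_intros \<epsilon>0) auto
      then show "(\<lambda>k. g \<xi> * (cis (a \<bullet> \<xi>) * of_real (gauss (\<epsilon> k *\<^sub>R \<xi>)))) \<longlonglongrightarrow> cis (a \<bullet> \<xi>) * g \<xi>"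
        by (simp add: gauss_def mult.commute)
    qed
  qed auto
  have Rb: "norm (R k a) \<le> (\<integral>\<xi>. norm (g \<xi>) \<partial>lborel)" for k a
  proof -
    have "norm (R k a) \<le> (\<integral>\<xi>. norm (g \<xi> * (cis (a \<bullet> \<xi>) * of_real (gauss (\<epsilon> k *\<^sub>R \<xi>)))) \<partial>lborel)"
      unfolding R_def by (rule integral_norm_bound)
    also have "\<dots> \<le> (\<integral>\<xi>. norm (g \<xi>) \<partial>lborel)"
      by (rule integral_mono_AE')
        (use g in \<open>auto simp: norm_mult intro!: AE_I2 mult_left_le\<close>)
    finally show ?thesis .
  qed
  have Bint: "integrable lborel (indicator (cbox p q) :: 'a \<Rightarrow> real)"
    using emeasure_lborel_cbox_finite[of p q] by (intro integrable_real_indicator) auto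
  have lim1: "(\<lambda>k. \<integral>a. ?B a * R k a \<partial>lborel) \<longlonglongrightarrow> (\<integral>a. ?B a * w a \<partial>lborel)"
  proof (rule integral_dominated_convergence)
    show "integrable lborel (\<lambda>a::'a. indicator (cbox p q) a * (\<integral>\<xi>. norm (g \<xi>) \<partial>lborel))"
      by (intro integrable_mult_left Bint)
    show "AE a in lborel. norm (?B a * R k a) \<le> indicator (cbox p q) a * (\<integral>\<xi>. norm (g \<xi>) \<partial>lborel)" for k
      using Rb by (auto simp: indicator_def)
    show "AE a in lborel. (\<lambda>k. ?B a * R k a) \<longlonglongrightarrow> ?B a * w a"
      by (intro AE_I2 tendsto_mult tendsto_const Rw)
  qed auto
  define F where "F \<tau> = (\<integral>a. ?B a * v (a + \<tau>) \<partial>lborel)" for \<tau>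
  have Fm [measurable]: "F \<in> borel_measurable borel" unfolding F_def by measurable
  \<comment> \<open>A bound on the box integrals of all translates of \<open>v\<close> at once: on
    the box a modulus is at most 1 plus its square, and the integral of the square is translation
    invariant.\<close>
  define K where "K = (\<integral>a. indicator (cbox p q) (a::'a) \<partial>lborel) + (\<integral>x. (norm (v x))\<^sup>2 \<partial>lborel)"
  have vsq: "integrable lborel (\<lambda>a. (norm (v (a + \<tau>)))\<^sup>2)"
    and vsq_eq: "(\<integral>a. (norm (v (a + \<tau>)))\<^sup>2 \<partial>lborel) = (\<integral>a. (norm (v a))\<^sup>2 \<partial>lborel)" for \<tau>
    using lborel_integrable_affine[OF v, of 1 \<tau>]
      lborel_integral_affine[of "\<lambda>a. (norm (v a))\<^sup>2" 1 \<tau>] by (auto simp: add.commute)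
  have small: "norm (?B a * z) \<le> indicator (cbox p q) a + (norm z)\<^sup>2" for a and z :: complex
  proof -
    have "norm z \<le> 1 + (norm z)\<^sup>2"
      using sum_squares_bound[of 1 "norm z"] norm_ge_zero[of z] by (simp only: power_one mult_1_right)
    then show ?thesis by (auto simp: indicator_def)
  qed
  have Bv: "integrable lborel (\<lambda>a. ?B a * v (a + \<tau>))" for \<tau>
    by (rule Bochner_Integration.integrable_bound[OF Bochner_Integration.integrable_add[OF Bint vsq[of \<tau>]]])
      (use small in \<open>auto intro!: AE_I2 intro: order_trans[OF _ abs_ge_self]\<close>)
  have nK: "(\<integral>a. norm (?B a * v (a + \<tau>)) \<partial>lborel) \<le> K" for \<tau>
  proof -
    have "(\<integral>a. norm (?B a * v (a + \<tau>)) \<partial>lborel) \<le> (\<integral>a. indicator (cbox p q) a + (norm (v (a + \<tau>)))\<^sup>2 \<partial>lborel)"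
      by (intro integral_mono integrable_norm Bv Bochner_Integration.integrable_add Bint vsq small)
    also have "\<dots> = K" unfolding K_def using Bint vsq by (simp add: vsq_eq)
    finally show ?thesis .
  qed
  have FK: "norm (F \<tau>) \<le> K" for \<tau>
    unfolding F_def by (rule order_trans[OF integral_norm_bound nK])
  \<comment> \<open>With the Gaussian integral outermost, the inner quantity \<open>F\<close> is
    bounded by \<open>K\<close> and converges to \<open>F 0\<close>, which is what dominated
    convergence in \<open>lim2\<close> requires.\<close>
  have swap: "(\<integral>a. ?B a * R k a \<partial>lborel) = (\<integral>t. of_real (gauss t) * F (\<epsilon> k *\<^sub>R t) \<partial>lborel)" for k
  proof -
    have int: "integrable (lborel \<Otimes>\<^sub>M lborel) (\<lambda>(t, a). (?G k t a))"
    proof (rule lborel_pair.Fubini_integrable)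
      show "integrable lborel (\<lambda>t. \<integral>a. norm (case (t, a) of (t, a) \<Rightarrow> (?G k t a)) \<partial>lborel)"
      proof (rule Bochner_Integration.integrable_bound)
        show "integrable lborel (\<lambda>t::'a. gauss t * K)" by (intro integrable_mult_left integrable_gauss)
        show "AE t in lborel. norm (\<integral>a. norm (case (t, a) of (t, a) \<Rightarrow> (?G k t a)) \<partial>lborel) \<le> norm (gauss t * K)"
        proof (rule AE_I2)
          fix t :: 'a
          have "(\<integral>a. norm (?G k t a) \<partial>lborel) \<le> gauss t * K"
            using nK[of "\<epsilon> k *\<^sub>R t"] by (subst norm_mult) (simp add: mult_left_mono)
          moreover have "0 \<le> (\<integral>a. norm (?G k t a) \<partial>lborel)" by simp
          ultimately show "norm (\<integral>a. norm (case (t, a) of (t, a) \<Rightarrow> (?G k t a)) \<partial>lborel) \<le> norm (gauss t * K)"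
            unfolding real_norm_def prod.case by linarith
        qed
      qed measurable
      show "AE t in lborel. integrable lborel (\<lambda>a. case (t, a) of (t, a) \<Rightarrow> (?G k t a))"
        using Bv by (auto intro!: AE_I2)
    qed measurable
    have "(\<integral>a. ?B a * R k a \<partial>lborel) = (\<integral>a. (\<integral>t. (?G k t a) \<partial>lborel) \<partial>lborel)"
      unfolding R_def inv[OF \<epsilon>] integral_mult_right_zero[symmetric] by (simp only: mult_ac)
    also have "\<dots> = (\<integral>t. (\<integral>a. (?G k t a) \<partial>lborel) \<partial>lborel)"
      by (rule lborel_pair.Fubini_integral[OF int])
    also have "\<dots> = (\<integral>t. of_real (gauss t) * F (\<epsilon> k *\<^sub>R t) \<partial>lborel)"
      unfolding F_def integral_mult_right_zero ..
    finally show ?thesis .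
  qed
  have lim2: "(\<lambda>k. \<integral>t. of_real (gauss t) * F (\<epsilon> k *\<^sub>R t) \<partial>lborel) \<longlonglongrightarrow> (\<integral>t. of_real (gauss t) * F 0 \<partial>(lborel :: 'a measure))"
  proof (rule integral_dominated_convergence)
    show "integrable lborel (\<lambda>t::'a. gauss t * K)" by (intro integrable_mult_left integrable_gauss)
    show "AE t in lborel. norm (of_real (gauss t) * F (\<epsilon> k *\<^sub>R t)) \<le> gauss t * K" for k
      by (auto simp: norm_mult intro!: AE_I2 mult_left_mono FK)
    show "AE t in lborel. (\<lambda>k. of_real (gauss t) * F (\<epsilon> k *\<^sub>R t)) \<longlonglongrightarrow> of_real (gauss t) * F 0"
    proof (intro AE_I2 tendsto_mult tendsto_const)
      fix t :: 'a
      have "(\<lambda>k. \<epsilon> k *\<^sub>R t) \<longlonglongrightarrow> 0 *\<^sub>R t" by (intro tendsto_intros \<epsilon>0)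
      then show "(\<lambda>k. F (\<epsilon> k *\<^sub>R t)) \<longlonglongrightarrow> F 0"
        unfolding F_def using local_average_continuous[OF vm v, of "\<lambda>k. \<epsilon> k *\<^sub>R t"] by simp
    qed
  qed auto
  have "(\<integral>a. ?B a * w a \<partial>lborel) = (\<integral>t. of_real (gauss t) * F 0 \<partial>(lborel :: 'a measure))"
    by (rule LIMSEQ_unique[OF lim1 lim2[folded swap]])
  also have "\<dots> = of_real ((2 * pi) powr (DIM('a) / 2)) * F 0"
    by (simp only: integral_mult_left_zero integral_complex_of_real integral_gauss)
  finally have "of_real (fourier_const TYPE('a)) * (\<integral>a. ?B a * w a \<partial>lborel) = F 0"
    by (simp add: mult.assoc[symmetric] fourier_const_inverse flip: of_real_mult)
  moreover have "(\<integral>a. ?B a * (of_real (fourier_const TYPE('a)) * w a) \<partial>lborel) = of_real (fourier_const TYPE('a)) * (\<integral>a. ?B a * w a \<partial>lborel)"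
    unfolding integral_mult_right_zero[symmetric] by (simp only: mult_ac)
  ultimately show ?thesis by (simp add: w_def F_def)
qed

text \<open>By Lebesgue differentiation the averages of the difference over cubes with corner
  \<open>x\<close> converge to its value at almost every \<open>x\<close>, and all these averages
  vanish.\<close>

lemma AE_eq_of_box_integrals_eq:
  fixes f g :: "'a::euclidean_space \<Rightarrow> complex"
  assumes f: "\<And>p q. integrable lborel (\<lambda>x. indicator (cbox p q) x * f x)"
    and g: "\<And>p q. integrable lborel (\<lambda>x. indicator (cbox p q) x * g x)"
    and eq: "\<And>p q. (\<integral>x. indicator (cbox p q) x * f x \<partial>lborel) = (\<integral>x. indicator (cbox p q) x * g x \<partial>lborel)"
  shows "AE x in lebesgue. f x = g x"
proof -
  define z where "z x = f x - g x" for x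
  have ind: "indicator (cbox p q) x *\<^sub>R z x = indicator (cbox p q) x * f x - indicator (cbox p q) x * g x" for p q x
    by (simp add: z_def indicator_def)
  have int: "set_integrable lborel (cbox p q) z" for p q
    unfolding set_integrable_def ind by (intro Bochner_Integration.integrable_diff f g)
  have "integral (cbox p q) z = 0" for p q
    unfolding set_borel_integral_eq_integral(2)[OF int, symmetric] set_lebesgue_integral_def ind
    by (simp add: f g eq)
  moreover obtain N where N: "negligible N"
    "\<And>x e. \<lbrakk>x \<notin> N; 0 < e\<rbrakk> \<Longrightarrow> \<exists>d>0. \<forall>h. 0 < h \<and> h < d \<longrightarrow>
        norm(integral (cbox x (x + h *\<^sub>R One)) z /\<^sub>R h ^ DIM('a) - z x) < e"
    using integrable_ccontinuous_explicit[OF set_borel_integral_eq_integral(1)[OF int]] by blast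
  moreover have small: "norm (z x) < e" if xe: "x \<notin> N" "e > 0" for x e
  proof -
    obtain d where d: "d > 0" "\<And>h. 0 < h \<Longrightarrow> h < d \<Longrightarrow>
        norm(integral (cbox x (x + h *\<^sub>R One)) z /\<^sub>R h ^ DIM('a) - z x) < e"
      using N(2)[OF xe] by blast
    then have "norm (integral (cbox x (x + (d/2) *\<^sub>R One)) z /\<^sub>R (d/2) ^ DIM('a) - z x) < e" by simp
    then show ?thesis by (simp add: \<open>\<And>p q. integral (cbox p q) z = 0\<close>)
  qed
  have "z x = 0" if "x \<notin> N" for x
    using small[OF that, of "norm (z x)"] by auto
  then have "x \<in> N" if "f x \<noteq> g x" for x using that by (auto simp: z_def)
  moreover have "N \<in> null_sets lebesgue" using N(1) by (simp add: negligible_iff_null_sets)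
  ultimately show ?thesis by (intro AE_I'[of N]) auto
qed

text \<open>Integrability of \<open>fourier u\<close> makes the right-hand side a bounded function,
  so it has box integrals; they agree with those of \<open>u\<close> by
  \<open>averaged_inversion\<close>.\<close>

theorem fourier_inversion:
  fixes u :: "'a::euclidean_space \<Rightarrow> complex"
  assumes u: "square_integrable u" and "integrable lebesgue (fourier u)"
  shows "AE x in lebesgue. u x = of_real (fourier_const TYPE('a)) * (LINT \<xi>|lebesgue. cis (x \<bullet> \<xi>) * fourier u \<xi>)"
proof -
  obtain v g where vg: "v \<in> borel_measurable borel" "AE x in lebesgue. u x = v x" "integrable lborel (\<lambda>x. (norm (v x))\<^sup>2)"
    "g \<in> borel_measurable borel" "AE \<xi> in lebesgue. fourier u \<xi> = g \<xi>" "integrable lborel (\<lambda>x. (norm (g x))\<^sup>2)"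
    "((\<lambda>R. \<integral>\<^sup>+\<xi>. ennreal ((norm (fourier_integral (trunc R v) \<xi> - g \<xi>))\<^sup>2) \<partial>lborel) \<longlongrightarrow> 0) at_top"
    using fourier_borel_representatives[OF u] .
  note [measurable] = vg(1,4)
  have gl: "g \<in> borel_measurable lebesgue" by (rule measurable_lebesgueI) simp
  have "integrable lebesgue g"
    using integrable_cong_AE_imp[OF assms(2) gl] vg(5) by (auto simp: eq_commute)
  then have g: "integrable lborel g" by (simp add: integrable_completion)
  define w where "w a = of_real (fourier_const TYPE('a)) * (\<integral>\<xi>. cis (a \<bullet> \<xi>) * g \<xi> \<partial>lborel)" for a
  have wm [measurable]: "w \<in> borel_measurable borel" unfolding w_def by measurable
  have w: "w x = of_real (fourier_const TYPE('a)) * (LINT \<xi>|lebesgue. cis (x \<bullet> \<xi>) * fourier u \<xi>)" for x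
  proof -
    have [measurable]: "(\<lambda>\<xi>. cis (x \<bullet> \<xi>)) \<in> borel_measurable lebesgue" by (rule measurable_lebesgueI) measurable
    note [measurable] = gl borel_measurable_integrable[OF assms(2)]
    have "(LINT \<xi>|lebesgue. cis (x \<bullet> \<xi>) * fourier u \<xi>) = (LINT \<xi>|lebesgue. cis (x \<bullet> \<xi>) * g \<xi>)"
      using vg(5) by (intro integral_cong_AE) auto
    also have "\<dots> = (\<integral>\<xi>. cis (x \<bullet> \<xi>) * g \<xi> \<partial>lborel)" by (rule integral_completion) measurable
    finally show ?thesis by (simp add: w_def)
  qed
  have wb: "norm (w a) \<le> fourier_const TYPE('a) * (\<integral>\<xi>. norm (g \<xi>) \<partial>lborel)" for a
  proof -
    have "norm (\<integral>\<xi>. cis (a \<bullet> \<xi>) * g \<xi> \<partial>lborel) \<le> (\<integral>\<xi>. norm (cis (a \<bullet> \<xi>) * g \<xi>) \<partial>lborel)"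
      by (rule integral_norm_bound)
    then show ?thesis unfolding w_def using fourier_const_pos[where 'a='a] by (simp add: norm_mult mult_left_mono)
  qed
  have "AE x in lebesgue. w x = v x"
  proof (rule AE_eq_of_box_integrals_eq)
    fix p q :: 'a
    have Bint: "integrable lborel (indicator (cbox p q) :: 'a \<Rightarrow> real)"
      using emeasure_lborel_cbox_finite[of p q] by (intro integrable_real_indicator) auto
    show "integrable lborel (\<lambda>x. indicator (cbox p q) x * w x)"
    proof (rule Bochner_Integration.integrable_bound)
      show "integrable lborel (\<lambda>x::'a. indicator (cbox p q) x * (fourier_const TYPE('a) * (\<integral>\<xi>. norm (g \<xi>) \<partial>lborel)))"
        by (intro integrable_mult_left Bint)
      show "AE x in lborel. norm (indicator (cbox p q) x * w x) \<le> norm (indicator (cbox p q) x * (fourier_const TYPE('a) * (\<integral>\<xi>. norm (g \<xi>) \<partial>lborel)))"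
        using wb by (auto simp: indicator_def intro!: AE_I2 intro: order_trans[OF _ abs_ge_self])
    qed auto
    obtain r where r: "\<And>x. x \<in> cbox p q \<Longrightarrow> norm x \<le> r" using bounded_cbox[of p q] by (auto simp: bounded_iff)
    show "integrable lborel (\<lambda>x. indicator (cbox p q) x * v x)"
      by (rule Bochner_Integration.integrable_bound[OF integrable_trunc[OF vg(1,3), of r]])
        (use r in \<open>auto simp: indicator_def\<close>)
    show "(\<integral>x. indicator (cbox p q) x * w x \<partial>lborel) = (\<integral>x. indicator (cbox p q) x * v x \<partial>lborel)"
      unfolding w_def by (rule averaged_inversion[OF vg(1,3,4) g gaussian_inversion_L2[OF vg(1,3,4,6,7)]])
  qed
  with vg(2) show ?thesis by eventually_elim (simp add: w)
qed

section \<open>Kernels with a subtracted Taylor polynomial\<close>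

definition sphere_area :: "'a::euclidean_space itself \<Rightarrow> real" where
  "sphere_area _ = real DIM('a) * unit_ball_vol (real DIM('a))"

lemma sphere_area_pos: "sphere_area TYPE('a::euclidean_space) > 0"
  by (simp add: sphere_area_def)

text \<open>The law of \<open>- norm\<close> instead of \<open>norm\<close>, so that the half-lines \<open>{x<..}\<close> have finite mass.\<close>

lemma distr_minus_norm:
  "distr lborel borel (\<lambda>\<xi>::'a::euclidean_space. - norm \<xi>) =
    density lborel (\<lambda>t. ennreal (sphere_area TYPE('a) * (- t) ^ (DIM('a) - 1)) * indicator {..0} t)"
proof (rule measure_eqI_lessThan)
  let ?v = "unit_ball_vol (real DIM('a))" and ?d = "DIM('a)"
  let ?N = "density lborel (\<lambda>t. ennreal (sphere_area TYPE('a) * (- t) ^ (?d - 1)) * indicator {..0} t)"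
  fix x :: real
  have L: "emeasure (distr lborel borel (\<lambda>\<xi>::'a. - norm \<xi>)) {x<..} = ennreal (?v * (max 0 (- x)) ^ ?d)"
  proof -
    have "(\<lambda>\<xi>::'a. - norm \<xi>) -` {x<..} \<inter> space lborel = ball 0 (- x)" by auto
    then have "emeasure (distr lborel borel (\<lambda>\<xi>::'a. - norm \<xi>)) {x<..} = emeasure lborel (ball (0::'a) (- x))"
      by (subst emeasure_distr) auto
    also have "\<dots> = ennreal (?v * (max 0 (- x)) ^ ?d)"
    proof (cases "x \<le> 0")
      case True
      then show ?thesis by (subst emeasure_ball) (auto simp: max_def)
    next
      case False
      then have "ball (0::'a) (- x) = {}" by auto
      then have "emeasure lborel (ball (0::'a) (- x)) = 0" by (simp only: emeasure_empty)
      then show ?thesis using False by (simp add: max_def zero_power)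
    qed
    finally show ?thesis .
  qed
  then show "emeasure (distr lborel borel (\<lambda>\<xi>::'a. - norm \<xi>)) {x<..} < \<infinity>" by simp
  have "emeasure ?N {x<..} = (\<integral>\<^sup>+t. ennreal (sphere_area TYPE('a) * (- t) ^ (?d - 1)) * indicator {..0} t * indicator {x<..} t \<partial>lborel)"
    by (rule emeasure_density) auto
  also have "\<dots> = (\<integral>\<^sup>+t. ennreal (sphere_area TYPE('a) * (- t) ^ (?d - 1)) * indicator {min x 0..0} t \<partial>lborel)"
    by (rule nn_integral_cong_AE, use AE_lborel_singleton[of x] AE_lborel_singleton[of 0] in eventually_elim)
      (auto simp: indicator_def min_def)
  also have "\<dots> = ennreal ((- ?v * (- 0) ^ ?d) - (- ?v * (- min x 0) ^ ?d))"
  proof (rule nn_integral_FTC_Icc)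
    fix t :: real assume "t \<in> {min x 0..0}"
    show "((\<lambda>t. - ?v * (- t) ^ ?d) has_real_derivative sphere_area TYPE('a) * (- t) ^ (?d - 1)) (at t)"
      by (auto intro!: derivative_eq_intros simp: sphere_area_def)
    show "0 \<le> sphere_area TYPE('a) * (- t) ^ (?d - 1)"
      using \<open>t \<in> {min x 0..0}\<close> sphere_area_pos[where 'a='a] by (intro mult_nonneg_nonneg zero_le_power) auto
  qed auto
  also have "\<dots> = ennreal (?v * (max 0 (- x)) ^ ?d)"
    by (auto simp: max_def min_def zero_power)
  finally show "emeasure (distr lborel borel (\<lambda>\<xi>::'a. - norm \<xi>)) {x<..} = emeasure ?N {x<..}"
    by (simp only: L)
qed auto

lemma nn_integral_radial:
  fixes h :: "real \<Rightarrow> ennreal"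
  assumes [measurable]: "h \<in> borel_measurable borel"
  shows "(\<integral>\<^sup>+\<xi>. h (norm \<xi>) \<partial>(lborel :: 'a::euclidean_space measure)) =
    (\<integral>\<^sup>+t. ennreal (sphere_area TYPE('a) * t ^ (DIM('a) - 1)) * indicator {0<..} t * h t \<partial>lborel)"
proof -
  have "(\<integral>\<^sup>+\<xi>. h (norm \<xi>) \<partial>(lborel :: 'a measure)) = (\<integral>\<^sup>+t. h (- t) \<partial>distr lborel borel (\<lambda>\<xi>::'a. - norm \<xi>))"
    by (subst nn_integral_distr) auto
  also have "\<dots> = (\<integral>\<^sup>+t. ennreal (sphere_area TYPE('a) * (- t) ^ (DIM('a) - 1)) * indicator {..0} t * h (- t) \<partial>lborel)"
    unfolding distr_minus_norm by (subst nn_integral_density) auto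
  also have "\<dots> = (\<integral>\<^sup>+t. ennreal (sphere_area TYPE('a) * t ^ (DIM('a) - 1)) * indicator {..0} (- t) * h t \<partial>lborel)"
    by (subst nn_integral_real_affine[of _ "-1" 0]) auto
  also have "\<dots> = (\<integral>\<^sup>+t. ennreal (sphere_area TYPE('a) * t ^ (DIM('a) - 1)) * indicator {0<..} t * h t \<partial>lborel)"
    by (rule nn_integral_cong_AE, use AE_lborel_singleton[of 0] in eventually_elim) (auto simp: indicator_def)
  finally show ?thesis .
qed

abbreviation powr_integral :: "'a::euclidean_space itself \<Rightarrow> real set \<Rightarrow> real \<Rightarrow> ennreal" where
  "powr_integral _ A p \<equiv> \<integral>\<^sup>+\<xi>. ennreal (indicator A (norm \<xi>) * norm \<xi> powr p) \<partial>(lborel :: 'a measure)"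

text \<open>Polar coordinates raise the exponent by \<open>DIM('a) - 1\<close>, so the critical
  power is minus the dimension: above it balls have a finite integral, below it exteriors of balls
  do, and at it annuli produce logarithms.\<close>

lemma nn_integral_norm_powr:
  fixes p I :: real
  assumes [measurable]: "A \<in> sets borel"
    and I: "((\<lambda>t. t powr (p + real DIM('a) - 1)) has_integral I) A" and A: "A \<subseteq> {0..}"
  shows "powr_integral TYPE('a::euclidean_space) A p =
    ennreal (sphere_area TYPE('a) * I)"
proof -
  let ?w = "sphere_area TYPE('a)"
  have w: "?w \<ge> 0" using sphere_area_pos[where 'a='a] by simp
  have d: "real (DIM('a) - 1) = real DIM('a) - 1" by (simp add: of_nat_diff)
  have "powr_integral TYPE('a) A p =
    (\<integral>\<^sup>+t. ennreal (?w * t ^ (DIM('a) - 1)) * indicator {0<..} t * ennreal (indicator A t * t powr p) \<partial>lborel)"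
    by (subst nn_integral_radial) auto
  also have "\<dots> = (\<integral>\<^sup>+t. ennreal ?w * ennreal (indicator A t * t powr (p + real DIM('a) - 1)) \<partial>lborel)"
  proof (rule nn_integral_cong_AE, use AE_lborel_singleton[of 0] in eventually_elim)
    fix t :: real assume "t \<noteq> 0"
    show "ennreal (?w * t ^ (DIM('a) - 1)) * indicator {0<..} t * ennreal (indicator A t * t powr p) =
       ennreal ?w * ennreal (indicator A t * t powr (p + real DIM('a) - 1))"
    proof (cases "t > 0 \<and> t \<in> A")
      case True
      then have "t powr (p + real DIM('a) - 1) = t ^ (DIM('a) - 1) * t powr p"
        by (simp add: powr_realpow[symmetric] d flip: powr_add) (simp add: algebra_simps)
      then show ?thesis using True w by (simp add: ennreal_mult[symmetric] mult_ac)
    next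
      case False
      then show ?thesis using A \<open>t \<noteq> 0\<close> by (auto simp: indicator_def)
    qed
  qed
  also have "\<dots> = ennreal ?w * (\<integral>\<^sup>+t. ennreal (indicator A t * t powr (p + real DIM('a) - 1)) \<partial>lborel)"
    by (rule nn_integral_cmult) measurable
  also have "(\<integral>\<^sup>+t. ennreal (indicator A t * t powr (p + real DIM('a) - 1)) \<partial>lborel) = ennreal I"
    by (rule nn_integral_has_integral_lebesgue[OF _ I]) auto
  finally show ?thesis using w has_integral_nonneg[OF I] by (simp add: ennreal_mult)
qed

lemma nn_integral_norm_powr_ball:
  assumes "p > - real DIM('a)" "a \<ge> 0"
  shows "powr_integral TYPE('a::euclidean_space) {0..a} p =
    ennreal (sphere_area TYPE('a) * (a powr (p + real DIM('a)) / (p + real DIM('a))))"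
  using has_integral_powr_from_0[of "p + real DIM('a) - 1" a] assms by (intro nn_integral_norm_powr) auto

lemma nn_integral_norm_powr_outside:
  assumes "p < - real DIM('a)" "a > 0"
  shows "powr_integral TYPE('a::euclidean_space) {a..} p =
    ennreal (sphere_area TYPE('a) * (a powr (p + real DIM('a)) / (- (p + real DIM('a)))))"
proof (rule nn_integral_norm_powr)
  have minus: "- y / z = y / (- z)" for y z :: real by simp
  show "((\<lambda>t. t powr (p + real DIM('a) - 1)) has_integral a powr (p + real DIM('a)) / (- (p + real DIM('a)))) {a..}"
    using has_integral_powr_to_inf[of "p + real DIM('a) - 1" a] assms unfolding minus by simp
qed (use assms in auto)

lemma nn_integral_norm_powr_annulus:
  assumes "0 < a" "a \<le> b"
  shows "powr_integral TYPE('a::euclidean_space) {a..b} (- real DIM('a)) =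
    ennreal (sphere_area TYPE('a) * (ln b - ln a))"
proof (rule nn_integral_norm_powr)
  have "((\<lambda>t. t powr (- 1)) has_integral (ln b - ln a)) {a..b}"
    by (rule fundamental_theorem_of_calculus)
      (use assms in \<open>auto intro!: derivative_eq_intros simp: powr_minus_divide has_real_derivative_iff_has_vector_derivative[symmetric]\<close>)
  then show "((\<lambda>t. t powr (- real DIM('a) + real DIM('a) - 1)) has_integral (ln b - ln a)) {a..b}" by simp
qed (use assms in auto)

section \<open>Taylor remainders and the energy of the kernel\<close>

definition exp_remainder :: "nat \<Rightarrow> real \<Rightarrow> complex" where
  "exp_remainder n t = cis t - (\<Sum>j\<le>n. (\<i> * of_real t) ^ j / fact j)"

text \<open>The first bound serves small arguments, hence low frequencies; the second serves large
  ones. Both are the standard remainder estimates with the factorials dropped.\<close>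

lemma exp_remainder_bounds:
  "norm (exp_remainder n t) \<le> \<bar>t\<bar> ^ Suc n" "norm (exp_remainder n t) \<le> 2 * \<bar>t\<bar> ^ n"
proof -
  have f: "x / fact k \<le> x" if "x \<ge> 0" for x :: real and k :: nat
    using that fact_ge_1[of k, where 'a=real] by (simp add: divide_le_eq mult_le_cancel_left1)
  show "norm (exp_remainder n t) \<le> \<bar>t\<bar> ^ Suc n"
    using iexp_approx1[of t n] f[of "\<bar>t\<bar> ^ Suc n" "Suc n"]
    unfolding exp_remainder_def cis_conv_exp by (simp del: fact_Suc power_Suc)
  show "norm (exp_remainder n t) \<le> 2 * \<bar>t\<bar> ^ n"
    using iexp_approx2[of t n] f[of "2 * \<bar>t\<bar> ^ n" n] unfolding exp_remainder_def cis_conv_exp by simp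
qed

text \<open>The sets \<open>S j\<close> remove the terms whose subtraction would destroy square integrability
  at high frequencies.\<close>

definition taylor_kernel :: "real \<Rightarrow> nat \<Rightarrow> (nat \<Rightarrow> 'a set) \<Rightarrow> 'a \<Rightarrow> 'a::euclidean_space \<Rightarrow> complex" where
  "taylor_kernel s n S x \<xi> = of_real (norm \<xi> powr (- s)) *
     (cis (x \<bullet> \<xi>) - (\<Sum>j\<le>n. indicator (S j) \<xi> * (\<i> * of_real (x \<bullet> \<xi>)) ^ j / fact j))"

lemma taylor_kernel_UNIV:
  "taylor_kernel s n (\<lambda>_. UNIV) x \<xi> = of_real (norm \<xi> powr (- s)) * exp_remainder n (x \<bullet> \<xi>)"
  by (simp add: taylor_kernel_def exp_remainder_def)

text \<open>Cauchy-Schwarz replaces \<open>x \<bullet> \<xi>\<close> by the product of the norms, so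
  a remainder of order \<open>k\<close> yields a radial power of \<open>\<xi>\<close>. Its exponent
  exceeds minus the dimension exactly when \<open>k\<close> exceeds
  \<open>s - real DIM('a) / 2\<close>.\<close>

lemma norm_powr_scaled_bound:
  fixes x \<xi> :: "'a::euclidean_space"
  assumes "norm r \<le> C * \<bar>x \<bullet> \<xi>\<bar> ^ k" "norm x \<le> X" "C \<ge> 0" "X \<ge> 0" "\<xi> \<noteq> 0"
  shows "(norm (complex_of_real (norm \<xi> powr (- s)) * r))\<^sup>2 \<le> C\<^sup>2 * X ^ (2 * k) * norm \<xi> powr (2 * real k - 2 * s)"
proof -
  have "\<bar>x \<bullet> \<xi>\<bar> \<le> X * norm \<xi>"
    using Cauchy_Schwarz_ineq2[of x \<xi>] mult_right_mono[OF assms(2), of "norm \<xi>"] by simp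
  then have "norm r \<le> C * (X * norm \<xi>) ^ k"
    using assms(1,3) by (meson abs_ge_zero mult_left_mono order_trans power_mono)
  then have "(norm r)\<^sup>2 \<le> (C * (X * norm \<xi>) ^ k)\<^sup>2" by (intro power_mono) auto
  also have "\<dots> = C\<^sup>2 * X ^ (2 * k) * norm \<xi> powr (2 * real k)"
    using \<open>\<xi> \<noteq> 0\<close> powr_realpow[of "norm \<xi>" "2 * k"] by (simp add: power_mult_distrib mult.commute[of 2] power_mult)
  finally have "(norm r)\<^sup>2 \<le> C\<^sup>2 * X ^ (2 * k) * norm \<xi> powr (2 * real k)" .
  note le = this
  have sq: "(norm \<xi> powr (- s))\<^sup>2 = norm \<xi> powr (- 2 * s)"
    by (simp add: power2_eq_square flip: powr_add)
  have "(norm (complex_of_real (norm \<xi> powr (- s)) * r))\<^sup>2 = norm \<xi> powr (- 2 * s) * (norm r)\<^sup>2"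
    unfolding norm_mult power_mult_distrib norm_of_real by (simp only: power2_abs sq)
  also have "\<dots> \<le> norm \<xi> powr (- 2 * s) * (C\<^sup>2 * X ^ (2 * k) * norm \<xi> powr (2 * real k))"
    by (intro mult_left_mono le) auto
  also have "\<dots> = C\<^sup>2 * X ^ (2 * k) * (norm \<xi> powr (2 * real k) * norm \<xi> powr (- 2 * s))"
    by (simp only: mult_ac)
  also have "norm \<xi> powr (2 * real k) * norm \<xi> powr (- 2 * s) = norm \<xi> powr (2 * real k - 2 * s)"
    by (simp flip: powr_add)
  finally show ?thesis .
qed

text \<open>The frequencies are split at \<open>1 / norm x\<close>, where
  \<open>norm x * norm \<xi>\<close> is 1. Below it the remainder bound of order
  \<open>n + 1\<close> is integrable at 0, above it the one of order \<open>n\<close> is integrable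
  at infinity, and both parts scale like the same power of \<open>norm x\<close>. The numerator 4 is
  the square of the 2 in the second remainder bound.\<close>

lemma taylor_kernel_bound_fractional:
  assumes \<sigma>: "\<sigma> = s - real DIM('a) / 2" "real n < \<sigma>" "\<sigma> < real n + 1"
  shows "energy (taylor_kernel s n (\<lambda>_. UNIV) x) \<le>
    ennreal (sphere_area TYPE('a) * (1 / (2 * (real n + 1 - \<sigma>)) + 4 / (2 * (\<sigma> - real n))) * norm (x::'a::euclidean_space) powr (2 * \<sigma>))"
proof (cases "x = 0")
  case True
  have "exp_remainder n 0 = 0"
    using exp_remainder_bounds(1)[of n 0] by simp
  then show ?thesis using True by (simp add: taylor_kernel_UNIV)
next
  case False
  define X where "X = norm x"
  let ?d = "real DIM('a)" and ?w = "sphere_area TYPE('a)"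
  have X: "X > 0" using False by (simp add: X_def)
  have w: "?w \<ge> 0" using sphere_area_pos[where 'a='a] by simp
  define k1 k2 where "k1 = X ^ (2 * Suc n)" and "k2 = 4 * X ^ (2 * n)"
  define p1 p2 where "p1 = 2 * real (Suc n) - 2 * s" and "p2 = 2 * real n - 2 * s"
  \<comment> \<open>These exponents decide convergence: the strict inequalities on
    \<open>\<sigma>\<close> make the first positive and the last negative.\<close>
  have e: "p1 + ?d = 2 * (real n + 1 - \<sigma>)" "- (p2 + ?d) = 2 * (\<sigma> - real n)" "p2 + ?d = - 2 * (\<sigma> - real n)"
    by (simp_all add: \<sigma>(1) p1_def p2_def)
    let ?B = "?w * ((1 / X) powr (p2 + ?d) / (- (p2 + ?d)))"
    let ?A = "?w * ((1 / X) powr (p1 + ?d) / (p1 + ?d))"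
  have "energy (taylor_kernel s n (\<lambda>_. UNIV) x) \<le>
    (\<integral>\<^sup>+\<xi>. ennreal k1 * ennreal (indicator {0..1 / X} (norm \<xi>) * norm \<xi> powr p1) +
       ennreal k2 * ennreal (indicator {1 / X..} (norm \<xi>) * norm \<xi> powr p2) \<partial>(lborel :: 'a measure))"
  proof (rule nn_integral_mono_AE, use AE_lborel_singleton[of 0] in eventually_elim)
    fix \<xi> :: 'a assume \<xi>: "\<xi> \<noteq> 0"
    let ?K = "(norm (taylor_kernel s n (\<lambda>_. UNIV) x \<xi>))\<^sup>2"
    have 1: "?K \<le> k1 * norm \<xi> powr p1"
      using norm_powr_scaled_bound[where C=1 and X=X and k="Suc n", OF _ _ _ _ \<xi>, of "exp_remainder n (x \<bullet> \<xi>)" x s]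
        exp_remainder_bounds(1)[of n "x \<bullet> \<xi>"] X
      by (simp add: taylor_kernel_UNIV k1_def p1_def X_def del: power_Suc mult_Suc_right)
    have 2: "?K \<le> k2 * norm \<xi> powr p2"
      using norm_powr_scaled_bound[where C=2 and X=X and k=n, OF _ _ _ _ \<xi>, of "exp_remainder n (x \<bullet> \<xi>)" x s]
        exp_remainder_bounds(2)[of n "x \<bullet> \<xi>"] X
      by (simp add: taylor_kernel_UNIV k2_def p2_def X_def)
    have k: "k1 \<ge> 0" "k2 \<ge> 0" using X by (auto simp: k1_def k2_def)
    have "?K \<le> k1 * (indicator {0..1 / X} (norm \<xi>) * norm \<xi> powr p1) + k2 * (indicator {1 / X..} (norm \<xi>) * norm \<xi> powr p2)"
    proof (cases "norm \<xi> \<le> 1 / X")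
      case True then show ?thesis using 1 k by (auto simp: indicator_def intro: order_trans)
    next
      case False then show ?thesis using 2 k by (auto simp: indicator_def intro: order_trans)
    qed
    then show "ennreal ?K \<le> ennreal k1 * ennreal (indicator {0..1 / X} (norm \<xi>) * norm \<xi> powr p1) +
       ennreal k2 * ennreal (indicator {1 / X..} (norm \<xi>) * norm \<xi> powr p2)"
      using k by (simp add: ennreal_mult[symmetric] ennreal_leI flip: ennreal_plus)
  qed
  also have "\<dots> = ennreal k1 * powr_integral TYPE('a) {0..1 / X} p1 +
       ennreal k2 * powr_integral TYPE('a) {1 / X..} p2"
    by (subst nn_integral_add) (auto simp: nn_integral_cmult)
  also have "\<dots> = ennreal k1 * ennreal (?A) +
      ennreal k2 * ennreal (?B)"
  proof -
    have "p1 + ?d > 0" "p2 + ?d < 0" unfolding e(1,3) using \<sigma> by auto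
    then have p: "p1 > - ?d" "p2 < - ?d" by linarith+
    have "0 \<le> 1 / X" "0 < 1 / X" using X by simp_all
    with p show ?thesis by (simp only: nn_integral_norm_powr_ball nn_integral_norm_powr_outside)
  qed
  also have "\<dots> = ennreal (k1 * (?A) + k2 * (?B))"
  proof -
    have "p1 + ?d > 0" "- (p2 + ?d) > 0" unfolding e using \<sigma> by auto
    moreover have "0 \<le> ?w * (y powr a / b)" if "b > 0" for y a b using w that by simp
    ultimately have "0 \<le> ?A" "0 \<le> ?B"
      by blast+
    moreover have "k1 \<ge> 0" "k2 \<ge> 0" using X by (auto simp: k1_def k2_def)
    ultimately show ?thesis by (simp only: ennreal_mult ennreal_plus mult_nonneg_nonneg)
  qed
  also have "k1 * (?A) + k2 * (?B)
     = ?w * (1 / (2 * (real n + 1 - \<sigma>)) + 4 / (2 * (\<sigma> - real n))) * X powr (2 * \<sigma>)"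
  proof -
    have "X ^ (2 * Suc n) * (1 / X) powr (2 * (real n + 1 - \<sigma>)) = X powr (2 * \<sigma>)"
      using X powr_realpow[OF X, of "2 * Suc n"]
      by (simp add: powr_divide powr_minus[symmetric] field_simps flip: powr_add powr_diff del: mult_Suc_right)
    moreover have "X ^ (2 * n) * (1 / X) powr (- 2 * (\<sigma> - real n)) = X powr (2 * \<sigma>)"
      using X powr_realpow[OF X, of "2 * n"]
      by (simp add: powr_divide powr_minus[symmetric] field_simps flip: powr_add powr_diff)
    ultimately show ?thesis
      unfolding e(1,2) unfolding e(3) k1_def k2_def
      by (simp only: distrib_left distrib_right times_divide_eq_left times_divide_eq_right mult_ac mult_1_left)
  qed
  finally show ?thesis by (simp only: X_def)
qed

lemma japanese_bracket_ge: "1 \<le> japanese_bracket x" "norm x \<le> japanese_bracket x"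
  unfolding japanese_bracket_def by (auto intro: real_le_rsqrt)

lemma japanese_bracket_measurable [measurable]: "japanese_bracket \<in> borel_measurable borel"
  unfolding japanese_bracket_def by measurable

text \<open>Three frequency ranges are used. Up to \<open>1 / X\<close> the remainder of order
  \<open>n + 1\<close> converges at 0; from there to 1 the critical power integrates to
  \<open>ln X\<close>; beyond 1 the degree \<open>n\<close> term is absent and the bound of order
  \<open>n - 1\<close> converges at infinity. Using the bracket for \<open>X\<close> ensures that
  \<open>1 / X\<close> is at most 1.\<close>

lemma taylor_kernel_bound_integer:
  assumes n: "real n = s - real DIM('a) / 2" "n \<ge> 1"
  defines "S \<equiv> \<lambda>j. if j < n then UNIV else cball (0::'a::euclidean_space) 1"
  shows "energy (taylor_kernel s n S x) \<le>
    ennreal (4 * sphere_area TYPE('a) * (japanese_bracket x ^ (2 * n) * (1 + ln (japanese_bracket x))))"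
proof -
  define X where "X = japanese_bracket x"
  let ?d = "real DIM('a)" and ?w = "sphere_area TYPE('a)"
  have X: "X \<ge> 1" "norm x \<le> X" using japanese_bracket_ge[of x] by (simp_all add: X_def)
  have w: "?w \<ge> 0" using sphere_area_pos[where 'a='a] by simp
  define k1 k2 k3 where "k1 = X ^ (2 * Suc n)" and "k2 = 4 * X ^ (2 * n)" and "k3 = 4 * X ^ (2 * (n - 1))"
  have k: "k1 \<ge> 0" "k2 \<ge> 0" "k3 \<ge> 0" using X by (auto simp: k1_def k2_def k3_def)
  define q where "q = 2 * real n - 2 * s"
  have q: "q = - ?d" using n by (simp add: q_def)
  have "energy (taylor_kernel s n S x) \<le>
    (\<integral>\<^sup>+\<xi>. (ennreal k1 * ennreal (indicator {0..1 / X} (norm \<xi>) * norm \<xi> powr (2 - ?d)) +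
       ennreal k2 * ennreal (indicator {1 / X..1} (norm \<xi>) * norm \<xi> powr (- ?d))) +
       ennreal k3 * ennreal (indicator {1..} (norm \<xi>) * norm \<xi> powr (- 2 - ?d)) \<partial>(lborel :: 'a measure))"
  proof (rule nn_integral_mono_AE, use AE_lborel_singleton[of 0] in eventually_elim)
    fix \<xi> :: 'a assume \<xi>: "\<xi> \<noteq> 0"
    let ?K = "(norm (taylor_kernel s n S x \<xi>))\<^sup>2"
    define c where "c A = (indicator A (norm \<xi>) :: real)" for A
    have c0: "c A \<ge> 0" for A by (simp add: c_def)
    \<comment> \<open>Inside the unit ball all terms are subtracted, giving the remainder of degree
      \<open>n\<close>; outside it the term \<open>j = n\<close> drops out, giving degree
      \<open>n - 1\<close>.\<close>
    have low: "taylor_kernel s n S x \<xi> = of_real (norm \<xi> powr (- s)) * exp_remainder n (x \<bullet> \<xi>)" if "norm \<xi> \<le> 1"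
    proof -
      have "indicator (S j) \<xi> = (1::complex)" for j using that by (simp add: S_def)
      then show ?thesis by (simp add: taylor_kernel_def exp_remainder_def)
    qed
    have high: "taylor_kernel s n S x \<xi> = of_real (norm \<xi> powr (- s)) * exp_remainder (n - 1) (x \<bullet> \<xi>)" if "norm \<xi> > 1"
    proof -
      have "(\<Sum>j\<le>n. indicator (S j) \<xi> * (\<i> * of_real (x \<bullet> \<xi>)) ^ j / fact j) = (\<Sum>j\<le>n - 1. (\<i> * of_real (x \<bullet> \<xi>)) ^ j / fact j)"
        using that n(2) by (intro sum.mono_neutral_cong_right) (auto simp: S_def)
      then show ?thesis by (simp add: taylor_kernel_def exp_remainder_def)
    qed
    have "?K \<le> k1 * (c {0..1 / X} * norm \<xi> powr (2 - ?d)) + k2 * (c {1 / X..1} * norm \<xi> powr (- ?d)) +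
        k3 * (c {1..} * norm \<xi> powr (- 2 - ?d))"
    proof -
      have nn: "0 \<le> k1 * (c {0..1 / X} * norm \<xi> powr (2 - ?d))" "0 \<le> k2 * (c {1 / X..1} * norm \<xi> powr (- ?d))"
        "0 \<le> k3 * (c {1..} * norm \<xi> powr (- 2 - ?d))"
        using k c0 by auto
      consider "norm \<xi> \<le> 1 / X" | "1 / X \<le> norm \<xi>" "norm \<xi> \<le> 1" | "norm \<xi> > 1" by linarith
      then show ?thesis
      proof cases
        case 1
        have "1 / X \<le> 1" using X by simp
        with 1 have le1: "norm \<xi> \<le> 1" by linarith
        have "?K \<le> 1\<^sup>2 * X ^ (2 * Suc n) * norm \<xi> powr (2 * real (Suc n) - 2 * s)"
          unfolding low[OF le1] using exp_remainder_bounds(1)[of n "x \<bullet> \<xi>"] X \<xi> by (intro norm_powr_scaled_bound) auto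
        also have "2 * real (Suc n) - 2 * s = 2 - ?d" using n by simp
        also have "1\<^sup>2 * X ^ (2 * Suc n) * norm \<xi> powr (2 - ?d) = k1 * (c {0..1 / X} * norm \<xi> powr (2 - ?d))"
          using 1 by (simp add: c_def k1_def)
        finally show ?thesis using nn by linarith
      next
        case 2
        have "?K \<le> 2\<^sup>2 * X ^ (2 * n) * norm \<xi> powr (2 * real n - 2 * s)"
          unfolding low[OF 2(2)] using exp_remainder_bounds(2)[of n "x \<bullet> \<xi>"] X \<xi> by (intro norm_powr_scaled_bound) auto
        also have "2 * real n - 2 * s = - ?d" using n by simp
        also have "2\<^sup>2 * X ^ (2 * n) * norm \<xi> powr (- ?d) = k2 * (c {1 / X..1} * norm \<xi> powr (- ?d))"
          using 2 by (simp add: c_def k2_def)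
        finally show ?thesis using nn by linarith
      next
        case 3
        have "?K \<le> 2\<^sup>2 * X ^ (2 * (n - 1)) * norm \<xi> powr (2 * real (n - 1) - 2 * s)"
          unfolding high[OF 3] using exp_remainder_bounds(2)[of "n - 1" "x \<bullet> \<xi>"] X \<xi> by (intro norm_powr_scaled_bound) auto
        also have "2 * real (n - 1) - 2 * s = - 2 - ?d" using n by (simp add: of_nat_diff)
        also have "2\<^sup>2 * X ^ (2 * (n - 1)) * norm \<xi> powr (- 2 - ?d) = k3 * (c {1..} * norm \<xi> powr (- 2 - ?d))"
          using 3 by (simp add: c_def k3_def)
        finally show ?thesis using nn by linarith
      qed
    qed
    then have "ennreal ?K \<le> ennreal (k1 * (c {0..1 / X} * norm \<xi> powr (2 - ?d)) + k2 * (c {1 / X..1} * norm \<xi> powr (- ?d)) +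
        k3 * (c {1..} * norm \<xi> powr (- 2 - ?d)))" by (rule ennreal_leI)
    also have "\<dots> = ennreal k1 * ennreal (c {0..1 / X} * norm \<xi> powr (2 - ?d)) + ennreal k2 * ennreal (c {1 / X..1} * norm \<xi> powr (- ?d)) +
       ennreal k3 * ennreal (c {1..} * norm \<xi> powr (- 2 - ?d))"
      using k c0 by (simp only: ennreal_mult ennreal_plus mult_nonneg_nonneg powr_ge_zero add_nonneg_nonneg)
    finally show "ennreal ?K \<le> ennreal k1 * ennreal (indicator {0..1 / X} (norm \<xi>) * norm \<xi> powr (2 - ?d)) +
       ennreal k2 * ennreal (indicator {1 / X..1} (norm \<xi>) * norm \<xi> powr (- ?d)) +
       ennreal k3 * ennreal (indicator {1..} (norm \<xi>) * norm \<xi> powr (- 2 - ?d))"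
      unfolding c_def .
  qed
  also have "\<dots> = ennreal k1 * powr_integral TYPE('a) {0..1 / X} (2 - ?d) +
       ennreal k2 * powr_integral TYPE('a) {1 / X..1} (- ?d) +
       ennreal k3 * powr_integral TYPE('a) {1..} (- 2 - ?d)"
    by (subst nn_integral_add, measurable)+ (simp add: nn_integral_cmult)
  also have "\<dots> = ennreal k1 * ennreal (?w * ((1 / X) powr 2 / 2)) + ennreal k2 * ennreal (?w * ln X) + ennreal k3 * ennreal (?w * (1 / 2))"
  proof -
    have "powr_integral TYPE('a) {0..1 / X} (2 - ?d) = ennreal (?w * ((1 / X) powr 2 / 2))"
      using X nn_integral_norm_powr_ball[of "2 - ?d" "1 / X", where 'a='a] by simp
    moreover have "powr_integral TYPE('a) {1 / X..1} (- ?d) = ennreal (?w * ln X)"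
      using X nn_integral_norm_powr_annulus[of "1 / X" 1, where 'a='a] by (simp add: ln_div)
    moreover have "powr_integral TYPE('a) {1..} (- 2 - ?d) = ennreal (?w * (1 / 2))"
      using X nn_integral_norm_powr_outside[of "- 2 - ?d" 1, where 'a='a] by simp
    ultimately show ?thesis by (simp only:)
  qed
  also have "\<dots> = ennreal (k1 * (?w * ((1 / X) powr 2 / 2)) + k2 * (?w * ln X) + k3 * (?w * (1 / 2)))"
  proof -
    have "0 \<le> ?w * ((1 / X) powr 2 / 2)" "0 \<le> ?w * ln X" "0 \<le> ?w * (1 / 2)" using w X by auto
    with k show ?thesis by (simp only: ennreal_mult ennreal_plus mult_nonneg_nonneg add_nonneg_nonneg)
  qed
  \<comment> \<open>In units of \<open>?w * X ^ (2 * n)\<close>, the low frequencies contribute 1/2,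
    the high ones at most 2, and the annulus 4 times the logarithm.\<close>
  also have "\<dots> \<le> ennreal (4 * ?w * (X ^ (2 * n) * (1 + ln X)))"
  proof (rule ennreal_leI)
    have "k1 * (1 / X) powr 2 = X ^ (2 * n)"
      using X by (simp add: k1_def powr_divide power2_eq_square)
    then have 1: "k1 * (?w * ((1 / X) powr 2 / 2)) = ?w * X ^ (2 * n) / 2" by (simp add: mult_ac)
    have "X ^ (2 * (n - 1)) \<le> X ^ (2 * n)" using X(1) by (intro power_increasing) auto
    then have "?w * (4 * X ^ (2 * (n - 1))) \<le> ?w * (4 * X ^ (2 * n))" using w by (intro mult_left_mono) auto
    then have 3: "k3 * (?w * (1 / 2)) \<le> 2 * (?w * X ^ (2 * n))" by (simp add: k3_def mult_ac)
    have "k2 * (?w * ln X) = 4 * (?w * (X ^ (2 * n) * ln X))" by (simp add: k2_def mult_ac)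
    moreover have "4 * ?w * (X ^ (2 * n) * (1 + ln X)) = 4 * (?w * X ^ (2 * n)) + 4 * (?w * (X ^ (2 * n) * ln X))"
      by (simp add: algebra_simps)
    moreover have "0 \<le> ?w * X ^ (2 * n)" using w X by simp
    ultimately show "k1 * (?w * ((1 / X) powr 2 / 2)) + k2 * (?w * ln X) + k3 * (?w * (1 / 2)) \<le> 4 * ?w * (X ^ (2 * n) * (1 + ln X))"
      using 1 3 by linarith
  qed
  finally show ?thesis by (simp only: X_def)
qed

text \<open>Paired by Cauchy-Schwarz with the bracket weight times \<open>fourier u\<close>, this
  makes the moments of degree \<open>j\<close> finite. Below the critical degree they exist on the
  whole space; at the critical degree the cutoff to the unit ball secures convergence.\<close>

lemma weighted_monomial_square_integrable:
  fixes S :: "'a::euclidean_space set"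
  assumes "S \<in> sets borel" "s \<ge> 0" "real j < s - real DIM('a) / 2 \<or> S \<subseteq> cball 0 1"
  shows "square_integrable (\<lambda>\<xi>. of_real (japanese_bracket \<xi> powr (- s) * norm \<xi> ^ j * indicator S \<xi>) :: complex)"
proof -
  have [measurable]: "S \<in> sets borel" by fact
  let ?f = "\<lambda>\<xi>::'a. complex_of_real (japanese_bracket \<xi> powr (- s) * norm \<xi> ^ j * indicator S \<xi>)"
  have [measurable]: "?f \<in> borel_measurable borel" by measurable
  define p where "p = 2 * real j - 2 * s"
  let ?o = "\<lambda>\<xi>. ennreal (indicator (S - cball 0 1) \<xi> * (indicator {1..} (norm \<xi>) * norm \<xi> powr p))"
  have pt: "(norm (?f \<xi>))\<^sup>2 \<le> indicator (cball 0 1) \<xi> + indicator (S - cball 0 1) \<xi> * (indicator {1..} (norm \<xi>) * norm \<xi> powr p)" for \<xi>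
  proof (cases "norm \<xi> \<le> 1")
    case True
    have "japanese_bracket \<xi> powr (- s) \<le> 1 powr (- s)"
      using japanese_bracket_ge(1)[of \<xi>] \<open>s \<ge> 0\<close> by (intro powr_mono2') auto
    moreover have "norm \<xi> ^ j \<le> 1" using True by (intro power_le_one) auto
    ultimately have "japanese_bracket \<xi> powr (- s) * norm \<xi> ^ j * indicator S \<xi> \<le> 1"
      by (auto simp: indicator_def intro: mult_le_one)
    then have "(norm (?f \<xi>))\<^sup>2 \<le> 1" unfolding norm_of_real by (intro power_le_one) (auto simp: indicator_def)
    then show ?thesis using True by (auto simp: indicator_def)
  next
    case False
    have "japanese_bracket \<xi> powr (- s) \<le> norm \<xi> powr (- s)"
      using japanese_bracket_ge(2)[of \<xi>] False \<open>s \<ge> 0\<close> by (intro powr_mono2') auto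
    then have "japanese_bracket \<xi> powr (- s) * norm \<xi> ^ j \<le> norm \<xi> powr (- s) * norm \<xi> ^ j"
      by (intro mult_right_mono) auto
    then have "(japanese_bracket \<xi> powr (- s) * norm \<xi> ^ j)\<^sup>2 \<le> (norm \<xi> powr (- s) * norm \<xi> ^ j)\<^sup>2"
      by (intro power_mono) auto
    also have "\<dots> = norm \<xi> powr p"
    proof -
      have "norm \<xi> > 0" using False norm_ge_zero[of \<xi>] by linarith
      then have "norm \<xi> powr (- s) * norm \<xi> ^ j = norm \<xi> powr (real j - s)"
        by (simp add: powr_realpow[symmetric] flip: powr_add)
      then show ?thesis by (simp add: p_def power2_eq_square flip: powr_add)
    qed
    finally have le: "(japanese_bracket \<xi> powr (- s) * norm \<xi> ^ j)\<^sup>2 \<le> norm \<xi> powr p" .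
    have "(norm (?f \<xi>))\<^sup>2 = (japanese_bracket \<xi> powr (- s) * norm \<xi> ^ j * indicator S \<xi>)\<^sup>2"
      by (simp only: norm_of_real power2_abs)
    then show ?thesis using False le by (auto simp: indicator_def)
  qed
  have "energy ?f \<le>
    (\<integral>\<^sup>+\<xi>. indicator (cball 0 1) \<xi> + (?o \<xi>) \<partial>lborel)"
    by (intro nn_integral_mono order_trans[OF ennreal_leI[OF pt]]) (auto simp: ennreal_plus ennreal_indicator)
  also have "\<dots> = emeasure lborel (cball (0::'a) 1) + (\<integral>\<^sup>+\<xi>. (?o \<xi>) \<partial>lborel)"
    by (subst nn_integral_add) auto
  also have "\<dots> < \<infinity>"
  proof -
    have "(\<integral>\<^sup>+\<xi>. (?o \<xi>) \<partial>lborel) < \<infinity>"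
    proof (cases "S \<subseteq> cball 0 1")
      case True
      then have empty: "S - cball 0 1 = {}" by auto
      show ?thesis unfolding empty by simp
    next
      case False
      with assms have p: "p < - real DIM('a)" by (simp add: p_def)
      have "(\<integral>\<^sup>+\<xi>. (?o \<xi>) \<partial>lborel)
         \<le> powr_integral TYPE('a) {1..} p"
        by (intro nn_integral_mono ennreal_leI) (auto simp: indicator_def)
      also have "\<dots> < \<infinity>" by (subst nn_integral_norm_powr_outside[OF p]) auto
      finally show ?thesis .
    qed
    then show ?thesis using emeasure_lborel_cball_finite[of "0::'a" 1] by (auto simp: less_top)
  qed
  finally have "integrable lborel (\<lambda>\<xi>. (norm (?f \<xi>))\<^sup>2)" by (auto simp: integrable_iff_bounded)
  then show ?thesis
    unfolding square_integrable_def by (auto simp: integrable_completion intro: measurable_completion)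
qed

section \<open>Counting eigenfunctions\<close>

lemma schroedinger_form_hermitian: "schroedinger_form s V w u = cnj (schroedinger_form s V u w)"
  unfolding schroedinger_form_def complex_cnj_diff Bochner_Integration.integral_cnj[symmetric]
  by (simp add: mult_ac)

lemma eigenspace_schroedinger:
  assumes "u \<in> eigenspace (schroedinger_operator s V) \<mu>"
  shows "u \<in> sobolev_space s"
    and "w \<in> sobolev_space s \<Longrightarrow> schroedinger_form s V u w = of_real \<mu> * L2_inner u w"
proof -
  have 1: "(u, \<lambda>x. of_real \<mu> * u x) \<in> schroedinger_operator s V"
    using assms by (simp add: eigenspace_def)
  then show "u \<in> sobolev_space s" by (simp add: schroedinger_operator_def)
  assume "w \<in> sobolev_space s"
  with 1 have "schroedinger_form s V u w = L2_inner (\<lambda>x. of_real \<mu> * u x) w"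
    by (simp add: schroedinger_operator_def)
  also have "\<dots> = of_real \<mu> * L2_inner u w"
    by (simp add: L2_inner_def mult.assoc)
  finally show "schroedinger_form s V u w = of_real \<mu> * L2_inner u w" .
qed

lemma eigenspaces_orthogonal:
  assumes u: "u \<in> eigenspace (schroedinger_operator s V) \<mu>"
    and w: "w \<in> eigenspace (schroedinger_operator s V) \<nu>" and "\<mu> \<noteq> \<nu>"
  shows "L2_inner u w = 0"
proof -
  have "of_real \<mu> * L2_inner u w = schroedinger_form s V u w"
    by (simp add: eigenspace_schroedinger(2)[OF u eigenspace_schroedinger(1)[OF w]])
  also have "\<dots> = cnj (schroedinger_form s V w u)" by (rule schroedinger_form_hermitian)
  also have "\<dots> = of_real \<nu> * cnj (L2_inner w u)"
    by (simp add: eigenspace_schroedinger(2)[OF w eigenspace_schroedinger(1)[OF u]])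
  also have "cnj (L2_inner w u) = L2_inner u w" by (rule L2_inner_commute[symmetric])
  finally show ?thesis using \<open>\<mu> \<noteq> \<nu>\<close> by simp
qed

text \<open>The supremum may be infinite and not attained. If every admissible size were below
  \<open>k\<close>, the supremum would be at most \<open>k - 1\<close>; a family that is too long is
  cut down, with zero coefficients for the dropped members.\<close>

lemma ae_independent_of_le_ae_dim:
  assumes "enat k \<le> ae_dim E"
  shows "\<exists>e. (\<forall>i<k. e i \<in> E) \<and> ae_independent k e"
proof (cases "k = 0")
  case True
  then show ?thesis by (simp add: ae_independent_def)
next
  case False
  define K where "K = {k. \<exists>e. (\<forall>i<k. e i \<in> E) \<and> ae_independent k e}"
  have dim: "ae_dim E = Sup (enat ` K)" unfolding ae_dim_def K_def by (intro arg_cong[of _ _ Sup]) auto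
  have "\<exists>k'\<in>K. k \<le> k'"
  proof (rule ccontr)
    assume "\<not> ?thesis"
    then have "Sup (enat ` K) \<le> enat (k - 1)" by (intro Sup_least) auto
    then have "enat k \<le> enat (k - 1)" using assms dim by (metis order_trans)
    then show False using False by simp
  qed
  then obtain k' e where k': "k \<le> k'" "\<forall>i<k'. e i \<in> E" "ae_independent k' e" unfolding K_def by blast
  have "ae_independent k e"
    unfolding ae_independent_def
  proof (intro allI impI)
    fix c i assume ae: "AE x in lebesgue. (\<Sum>i<k. c i * e i x) = 0" and i: "i < k"
    define c' where "c' j = (if j < k then c j else 0)" for j
    have "(\<Sum>i<k'. c' i * e i x) = (\<Sum>i<k. c i * e i x)" for x
      using k'(1) by (intro sum.mono_neutral_cong_right) (auto simp: c'_def)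
    with ae have "AE x in lebesgue. (\<Sum>i<k'. c' i * e i x) = 0" by simp
    with k' i have "c' i = 0" unfolding ae_independent_def by (meson less_le_trans)
    then show "c i = 0" using i by (simp add: c'_def)
  qed
  with k' show ?thesis by (intro exI[of _ e]) auto
qed

text \<open>An infinite sum in \<open>enat\<close> is the supremum of its finite partial sums. For
  finitely many eigenvalues, independent families taken from each eigenspace are joined into one
  family indexed by pairs of eigenvalue and position; orthogonality of eigenspaces keeps it
  independent.\<close>

lemma num_negative_eigenvalues_le:
  fixes V :: "'a::euclidean_space \<Rightarrow> real"
  assumes bound: "\<And>(J :: (real \<times> nat) set) e \<mu>. finite J \<Longrightarrow>
      (\<And>j. j \<in> J \<Longrightarrow> \<mu> j < 0 \<and> e j \<in> eigenspace (schroedinger_operator s V) (\<mu> j)) \<Longrightarrow>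
      (\<And>c. (AE x in lebesgue. (\<Sum>j\<in>J. c j * e j x) = 0) \<Longrightarrow> \<forall>j\<in>J. c j = 0) \<Longrightarrow> card J \<le> N"
  shows "num_negative_eigenvalues (schroedinger_operator s V) \<le> enat N"
  unfolding num_negative_eigenvalues_def
proof (rule infsum_le_finite_sums)
  let ?E = "eigenspace (schroedinger_operator s V)"
  show "(\<lambda>\<mu>. ae_dim (?E \<mu>)) summable_on {..<0}" by (rule nonneg_summable_on_complete) simp
  fix F :: "real set" assume F: "finite F" "F \<subseteq> {..<0}"
  have main: "sum k F \<le> N" if k: "\<And>\<mu>. \<mu> \<in> F \<Longrightarrow> enat (k \<mu>) \<le> ae_dim (?E \<mu>)" for k
  proof -
    have "\<exists>e. \<forall>\<mu>\<in>F. (\<forall>i<k \<mu>. e \<mu> i \<in> ?E \<mu>) \<and> ae_independent (k \<mu>) (e \<mu>)"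
      using ae_independent_of_le_ae_dim[OF k] by (intro bchoice) blast
    then obtain e where e: "\<And>\<mu> i. \<mu> \<in> F \<Longrightarrow> i < k \<mu> \<Longrightarrow> e \<mu> i \<in> ?E \<mu>"
      "\<And>\<mu>. \<mu> \<in> F \<Longrightarrow> ae_independent (k \<mu>) (e \<mu>)" by blast
    define J where "J = Sigma F (\<lambda>\<mu>. {..<k \<mu>})"
    define f where "f p = e (fst p) (snd p)" for p
    have finJ: "finite J" using F by (simp add: J_def)
    have fE: "f p \<in> ?E (fst p)" if "p \<in> J" for p using e(1) that by (auto simp: J_def f_def)
    have f2: "square_integrable (f p)" if "p \<in> J" for p
      using eigenspace_schroedinger(1)[OF fE[OF that]] by (simp add: sobolev_space_def)
    have "\<forall>j\<in>J. c j = 0" if ae: "AE x in lebesgue. (\<Sum>j\<in>J. c j * f j x) = 0" for c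
    proof
      fix p assume "p \<in> J"
      define \<nu> where "\<nu> = fst p"
      have \<nu>: "\<nu> \<in> F" "snd p < k \<nu>" using \<open>p \<in> J\<close> by (auto simp: J_def \<nu>_def)
      define J' where "J' = {q\<in>J. fst q = \<nu>}"
      have J': "finite J'" "J' \<subseteq> J" using finJ by (auto simp: J'_def)
      define w where "w x = (\<Sum>q\<in>J'. c q * f q x)" for x
      have w2: "square_integrable w" unfolding w_def using f2 J' by (intro square_integrable_lincomb) auto
      \<comment> \<open>Pairing the vanishing combination with its component \<open>w\<close> for
        the eigenvalue \<open>\<nu>\<close> leaves only \<open>L2_inner w w\<close>, because the
        other terms lie in eigenspaces orthogonal to \<open>w\<close>.\<close>
      have "0 = L2_inner (\<lambda>x. \<Sum>q\<in>J. c q * f q x) w"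
      proof -
        have "square_integrable (\<lambda>x. \<Sum>q\<in>J. c q * f q x)" by (intro square_integrable_lincomb f2)
        then have "(LINT x|lebesgue. (\<Sum>q\<in>J. c q * f q x) * cnj (w x)) = (LINT x|(lebesgue :: 'a measure). 0)"
          using ae w2 by (intro integral_cong_AE) (auto simp: square_integrable_def)
        then show ?thesis by (simp add: L2_inner_def)
      qed
      also have "\<dots> = (\<Sum>q\<in>J. c q * L2_inner (f q) w)" by (intro L2_inner_lincomb_left f2 w2)
      also have "\<dots> = (\<Sum>q\<in>J'. c q * L2_inner (f q) w)"
      proof (rule sum.mono_neutral_right[OF finJ J'(2)], safe)
        fix \<mu> i assume q: "(\<mu>, i) \<in> J" "(\<mu>, i) \<notin> J'"
        have "L2_inner (f (\<mu>, i)) w = (\<Sum>r\<in>J'. cnj (c r) * L2_inner (f (\<mu>, i)) (f r))"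
          unfolding w_def using f2 q J' by (intro L2_inner_lincomb_right) auto
        also have "\<dots> = 0"
        proof (intro sum.neutral ballI)
          fix r assume r: "r \<in> J'"
          then have "fst r \<noteq> \<mu>" using q by (auto simp: J'_def)
          then show "cnj (c r) * L2_inner (f (\<mu>, i)) (f r) = 0"
            using eigenspaces_orthogonal[OF fE[OF q(1)] fE[of r]] r J' by auto
        qed
        finally show "c (\<mu>, i) * L2_inner (f (\<mu>, i)) w = 0" by simp
      qed
      also have "\<dots> = L2_inner w w"
      proof -
        have ww: "w = (\<lambda>x. \<Sum>q\<in>J'. c q * f q x)" by (simp add: w_def fun_eq_iff)
        have "L2_inner (\<lambda>x. \<Sum>q\<in>J'. c q * f q x) w = (\<Sum>q\<in>J'. c q * L2_inner (f q) w)"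
          using f2 J' by (intro L2_inner_lincomb_left w2) auto
        then show ?thesis using ww by simp
      qed
      finally have "AE x in lebesgue. w x = 0" using w2 by (intro L2_inner_self_eq_0) auto
      moreover have "w x = (\<Sum>i<k \<nu>. c (\<nu>, i) * e \<nu> i x)" for x
        unfolding w_def by (rule sum.reindex_bij_witness[where j = snd and i = "\<lambda>i. (\<nu>, i)"])
          (use \<nu> in \<open>auto simp: J'_def J_def f_def\<close>)
      ultimately have "c (\<nu>, snd p) = 0"
        using e(2)[OF \<nu>(1)] \<nu>(2) unfolding ae_independent_def
        by (elim allE[of _ "\<lambda>i. c (\<nu>, i)"]) auto
      then show "c p = 0" by (simp add: \<nu>_def)
    qed
    moreover have "fst j < 0 \<and> f j \<in> ?E (fst j)" if "j \<in> J" for j using fE[OF that] that F by (auto simp: J_def)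
    ultimately have "card J \<le> N" by (intro bound[OF finJ, of fst f])
    then show ?thesis using F by (simp add: J_def)
  qed
  have fin: "ae_dim (?E \<mu>) \<noteq> \<infinity>" if "\<mu> \<in> F" for \<mu>
  proof
    assume "ae_dim (?E \<mu>) = \<infinity>"
    \<comment> \<open>An infinite dimension would allow \<open>N + 1\<close> independent
      eigenfunctions at \<open>\<mu>\<close> alone.\<close>
    then have "sum (\<lambda>\<nu>. if \<nu> = \<mu> then Suc N else 0) F \<le> N"
      by (intro main) (auto simp: zero_enat_def[symmetric])
    then show False using F that by simp
  qed
  have fin_enat: "enat (the_enat (ae_dim (?E \<mu>))) = ae_dim (?E \<mu>)" if "\<mu> \<in> F" for \<mu>
    using fin[OF that] by (cases "ae_dim (?E \<mu>)") auto
  have "(\<Sum>\<mu>\<in>F. ae_dim (?E \<mu>)) = (\<Sum>\<mu>\<in>F. enat (the_enat (ae_dim (?E \<mu>))))"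
    using fin by (intro sum.cong refl) (auto simp: fin_enat)
  also have "\<dots> = enat (\<Sum>\<mu>\<in>F. the_enat (ae_dim (?E \<mu>)))"
    by (simp add: of_nat_eq_enat[symmetric] of_nat_sum)
  also have "\<dots> \<le> enat N" using main[of "\<lambda>\<mu>. the_enat (ae_dim (?E \<mu>))"] by (simp add: fin_enat)
  finally show "(\<Sum>\<mu>\<in>F. ae_dim (?E \<mu>)) \<le> enat N" .
qed

section \<open>Functions in the form domain\<close>

lemma abs_monomial_le:
  "\<bar>\<Prod>b\<in>Basis. (\<xi> \<bullet> b) ^ \<alpha> b\<bar> \<le> norm (\<xi>::'a::euclidean_space) ^ (\<Sum>b\<in>Basis. \<alpha> b)"
proof -
  have "\<bar>\<Prod>b\<in>Basis. (\<xi> \<bullet> b) ^ \<alpha> b\<bar> = (\<Prod>b\<in>Basis. \<bar>\<xi> \<bullet> b\<bar> ^ \<alpha> b)"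
    by (simp add: abs_prod power_abs)
  also have "\<dots> \<le> (\<Prod>b\<in>Basis. norm \<xi> ^ \<alpha> b)"
    by (intro prod_mono conjI power_mono) (auto simp: Basis_le_norm)
  also have "\<dots> = norm \<xi> ^ (\<Sum>b\<in>Basis. \<alpha> b)" by (simp add: power_sum)
  finally show ?thesis .
qed

text \<open>Everything comes from square integrability of the bracket weight times
  \<open>fourier u\<close>. Cauchy-Schwarz against a weighted monomial gives the moments; degree 0
  is allowed on the whole space because \<open>s\<close> exceeds half the dimension, so
  \<open>fourier u\<close> is integrable, and inversion then shows that \<open>u\<close> is
  essentially bounded.\<close>

lemma sobolev_space_facts:
  fixes u :: "'a::euclidean_space \<Rightarrow> complex"
  assumes s: "s > real DIM('a) / 2" and u: "u \<in> sobolev_space s"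
  shows "square_integrable u"
    and "square_integrable (\<lambda>\<xi>. of_real (norm \<xi> powr s) * fourier u \<xi>)"
    and "\<And>h S j. \<lbrakk>h \<in> borel_measurable borel; S \<in> sets borel; \<And>\<xi>. norm (h \<xi>) \<le> norm \<xi> ^ j;
        real j < s - real DIM('a) / 2 \<or> S \<subseteq> cball 0 1\<rbrakk> \<Longrightarrow>
        integrable lebesgue (\<lambda>\<xi>. indicator S \<xi> * h \<xi> * fourier u \<xi>)"
    and "integrable lebesgue (fourier u)"
    and "AE x in lebesgue. u x = of_real (fourier_const TYPE('a)) * (LINT \<xi>|lebesgue. cis (x \<bullet> \<xi>) * fourier u \<xi>)"
    and "\<exists>M. AE x in lebesgue. norm (u x) \<le> M"
proof -
  have s0: "s \<ge> 0" using s by (smt (verit) of_nat_0_le_iff divide_nonneg_nonneg)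
  have jb: "square_integrable (\<lambda>\<xi>. of_real (japanese_bracket \<xi> powr s) * fourier u \<xi>)"
    using u by (simp add: sobolev_space_def)
  show u2: "square_integrable u" using u by (simp add: sobolev_space_def)
  have [measurable]: "fourier u \<in> borel_measurable lebesgue"
    using fourier_spec(1)[OF u2] by (simp add: square_integrable_def)
  have nm [measurable]: "(\<lambda>\<xi>::'a. complex_of_real (norm \<xi> powr s)) \<in> borel_measurable lebesgue"
    by (rule measurable_lebesgueI) measurable
  show "square_integrable (\<lambda>\<xi>. of_real (norm \<xi> powr s) * fourier u \<xi>)"
  proof (rule square_integrable_bound[OF jb])
    fix \<xi> :: 'a
    have "norm \<xi> powr s \<le> japanese_bracket \<xi> powr s"
      using japanese_bracket_ge(2)[of \<xi>] s0 by (intro powr_mono2) auto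
    then show "norm (of_real (norm \<xi> powr s) * fourier u \<xi>) \<le> norm (of_real (japanese_bracket \<xi> powr s) * fourier u \<xi>)"
      by (simp add: norm_mult mult_right_mono)
  qed measurable
  show mono: "integrable lebesgue (\<lambda>\<xi>. indicator S \<xi> * h \<xi> * fourier u \<xi>)"
    if [measurable]: "h \<in> borel_measurable borel" and S [measurable]: "S \<in> sets borel" and h: "\<And>\<xi>. norm (h \<xi>) \<le> norm \<xi> ^ j"
      and j: "real j < s - real DIM('a) / 2 \<or> S \<subseteq> cball 0 1" for h S j
  proof -
    have "(\<lambda>\<xi>. indicator S \<xi> * h \<xi>) \<in> borel_measurable lebesgue" by (rule measurable_lebesgueI) measurable
    note [measurable] = this
    let ?H = "\<lambda>\<xi>. of_real (japanese_bracket \<xi> powr (- s) * norm \<xi> ^ j * indicator S \<xi>) *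
        (of_real (japanese_bracket \<xi> powr s) * fourier u \<xi>)"
    have "integrable lebesgue (\<lambda>\<xi>. (?H \<xi>))"
      by (intro square_integrable_product jb weighted_monomial_square_integrable S s0 j)
    then show ?thesis
    proof (rule Bochner_Integration.integrable_bound)
      show "AE \<xi> in lebesgue. norm (indicator S \<xi> * h \<xi> * fourier u \<xi>) \<le>
        norm (?H \<xi>)"
      proof (rule AE_I2)
        fix \<xi> :: 'a
        have "japanese_bracket \<xi> > 0" using japanese_bracket_ge(1)[of \<xi>] by linarith
        then have "japanese_bracket \<xi> powr (- s) * japanese_bracket \<xi> powr s = 1"
          by (simp flip: powr_add)
        then have "norm (of_real (japanese_bracket \<xi> powr (- s) * norm \<xi> ^ j * indicator S \<xi>) *
            (of_real (japanese_bracket \<xi> powr s) * fourier u \<xi>)) = indicator S \<xi> * norm \<xi> ^ j * norm (fourier u \<xi>)"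
          by (simp add: norm_mult norm_power indicator_def mult_ac)
        moreover have "norm (indicator S \<xi> * h \<xi> * fourier u \<xi>) \<le> indicator S \<xi> * norm \<xi> ^ j * norm (fourier u \<xi>)"
          using h[of \<xi>] by (auto simp: norm_mult indicator_def mult_right_mono)
        ultimately show "norm (indicator S \<xi> * h \<xi> * fourier u \<xi>) \<le>
          norm (of_real (japanese_bracket \<xi> powr (- s) * norm \<xi> ^ j * indicator S \<xi>) *
          (of_real (japanese_bracket \<xi> powr s) * fourier u \<xi>))" by simp
      qed
    qed measurable
  qed
  show int: "integrable lebesgue (fourier u)"
    using mono[of "\<lambda>_. 1" UNIV 0] s by simp
  show inv: "AE x in lebesgue. u x = of_real (fourier_const TYPE('a)) * (LINT \<xi>|lebesgue. cis (x \<bullet> \<xi>) * fourier u \<xi>)"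
    by (rule fourier_inversion[OF u2 int])
  show "\<exists>M. AE x in lebesgue. norm (u x) \<le> M"
  proof
    show "AE x in lebesgue. norm (u x) \<le> fourier_const TYPE('a) * (LINT \<xi>|lebesgue. norm (fourier u \<xi>))"
      using inv
    proof eventually_elim
      case (elim x)
      have "norm (LINT \<xi>|lebesgue. cis (x \<bullet> \<xi>) * fourier u \<xi>) \<le> (LINT \<xi>|lebesgue. norm (cis (x \<bullet> \<xi>) * fourier u \<xi>))"
        by (rule integral_norm_bound)
      then show ?case
        unfolding elim using fourier_const_pos[where 'a='a] by (simp add: norm_mult mult_left_mono)
    qed
  qed
qed

text \<open>\<open>V\<close> is integrable and \<open>u\<close> essentially bounded, so the
  potential term of the form is finite and can be treated as an inner product.\<close>

lemma sqrt_potential_square_integrable: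
  assumes V: "V \<in> borel_measurable lebesgue" "\<And>x. 0 \<le> V x" "square_integrable (\<lambda>x. sqrt (V x))"
    and u: "u \<in> borel_measurable lebesgue" "AE x in lebesgue. norm (u x) \<le> M"
  shows "square_integrable (\<lambda>x. complex_of_real (sqrt (V x)) * u x)"
  unfolding square_integrable_def
proof
  note [measurable] = V(1) u(1)
  show "(\<lambda>x. complex_of_real (sqrt (V x)) * u x) \<in> borel_measurable lebesgue" by measurable
  have "integrable lebesgue V" using V by (simp add: square_integrable_def)
  then have "integrable lebesgue (\<lambda>x. M\<^sup>2 * V x)" by simp
  then show "integrable lebesgue (\<lambda>x. (norm (complex_of_real (sqrt (V x)) * u x))\<^sup>2)"
  proof (rule Bochner_Integration.integrable_bound)
    show "AE x in lebesgue. norm ((norm (complex_of_real (sqrt (V x)) * u x))\<^sup>2) \<le> norm (M\<^sup>2 * V x)"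
      using u(2)
    proof eventually_elim
      case (elim x)
      then have "(norm (u x))\<^sup>2 \<le> M\<^sup>2" by (intro power_mono) auto
      then show ?case using V(2)[of x] by (simp add: norm_mult power_mult_distrib mult.commute mult_left_mono)
    qed
  qed measurable
qed

text \<open>The form becomes a difference of two Gram products, one kinetic and one from the
  potential, so sesquilinear algebra for \<open>L2_inner\<close> covers both terms.\<close>

lemma schroedinger_form_eq:
  assumes "\<And>x. 0 \<le> V x"
  shows "schroedinger_form s V u w =
    L2_inner (\<lambda>\<xi>. of_real (norm \<xi> powr s) * fourier u \<xi>) (\<lambda>\<xi>. of_real (norm \<xi> powr s) * fourier w \<xi>)
    - L2_inner (\<lambda>x. of_real (sqrt (V x)) * u x) (\<lambda>x. of_real (sqrt (V x)) * w x)"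
proof -
  have 1: "of_real (norm \<xi> powr (2 * s)) * fourier u \<xi> * cnj (fourier w \<xi>) =
     (of_real (norm \<xi> powr s) * fourier u \<xi>) * cnj (of_real (norm \<xi> powr s) * fourier w \<xi>)" for \<xi>
  proof -
    have "norm \<xi> powr (2 * s) = norm \<xi> powr s * norm \<xi> powr s" by (simp flip: powr_add)
    then show ?thesis by (simp add: mult_ac)
  qed
  have 2: "of_real (V x) * u x * cnj (w x) = (of_real (sqrt (V x)) * u x) * cnj (of_real (sqrt (V x)) * w x)" for x
  proof -
    have "V x = sqrt (V x) * sqrt (V x)" using assms[of x] by simp
    then have "complex_of_real (V x) = of_real (sqrt (V x)) * of_real (sqrt (V x))" by (metis of_real_mult)
    then show ?thesis by (simp add: mult_ac)
  qed
  show ?thesis unfolding schroedinger_form_def L2_inner_def 1 2 ..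
qed

lemma taylor_kernel_measurable [measurable]:
  assumes [measurable]: "\<And>j. S j \<in> sets borel"
  shows "taylor_kernel s n S x \<in> borel_measurable borel"
  unfolding taylor_kernel_def[abs_def] by measurable

section \<open>The bound for a finite family of eigenfunctions\<close>

lemma sum_over_fibres:
  fixes f :: "'i \<Rightarrow> 'i \<Rightarrow> 'b::comm_monoid_add"
  assumes "finite J" "\<And>i j. i \<in> J \<Longrightarrow> j \<in> J \<Longrightarrow> \<mu> i \<noteq> \<mu> j \<Longrightarrow> f i j = 0"
  shows "(\<Sum>i\<in>J. \<Sum>j\<in>J. f i j) = (\<Sum>\<nu>\<in>\<mu> ` J. \<Sum>i\<in>{i\<in>J. \<mu> i = \<nu>}. \<Sum>j\<in>{j\<in>J. \<mu> j = \<nu>}. f i j)"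
proof -
  have inner: "(\<Sum>j\<in>{j\<in>J. \<mu> j = \<nu>}. f i j) = (\<Sum>j\<in>J. f i j)" if "i \<in> {i\<in>J. \<mu> i = \<nu>}" for i \<nu>
  proof (rule sum.mono_neutral_left)
    show "\<forall>j\<in>J - {j \<in> J. \<mu> j = \<nu>}. f i j = 0"
      using that assms(2)[of i] by (metis (mono_tags, lifting) DiffE mem_Collect_eq)
  qed (use assms(1) in auto)
  have "(\<Sum>\<nu>\<in>\<mu> ` J. \<Sum>i\<in>{i\<in>J. \<mu> i = \<nu>}. \<Sum>j\<in>{j\<in>J. \<mu> j = \<nu>}. f i j) =
      (\<Sum>\<nu>\<in>\<mu> ` J. \<Sum>i\<in>{i\<in>J. \<mu> i = \<nu>}. \<Sum>j\<in>J. f i j)"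
    by (intro sum.cong refl inner)
  also have "\<dots> = (\<Sum>i\<in>J. \<Sum>j\<in>J. f i j)" using assms(1) by (intro sum.group) auto
  finally show ?thesis ..
qed

text \<open>\<open>S\<close> and \<open>W\<close> are left abstract so that the fractional and the
  integer case share one argument. The condition on \<open>S\<close> makes all moments of degree at
  most \<open>n\<close> finite, and \<open>W\<close> is a pointwise majorant of the kernel
  integral.\<close>

lemma eigenfunction_count_bound:
  fixes e :: "'j \<Rightarrow> 'a::euclidean_space \<Rightarrow> complex" and V W :: "'a \<Rightarrow> real"
  assumes s: "s > real DIM('a) / 2"
    and V: "V \<in> borel_measurable lebesgue" "\<And>x. 0 \<le> V x" "square_integrable (\<lambda>x. sqrt (V x))"
    and S: "\<And>j. S j \<in> sets borel" "\<And>j. j \<le> n \<Longrightarrow> real j < s - real DIM('a) / 2 \<or> S j \<subseteq> cball 0 1"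
    and W: "\<And>x. 0 \<le> W x" "\<And>x. energy (taylor_kernel s n S x) \<le> ennreal (W x)"
      "integrable lebesgue (\<lambda>x. W x * V x)"
    and J: "finite J"
    and eig: "\<And>j. j \<in> J \<Longrightarrow> \<mu> j < 0 \<and> e j \<in> eigenspace (schroedinger_operator s V) (\<mu> j)"
    and indep: "\<And>c. (AE x in lebesgue. (\<Sum>j\<in>J. c j * e j x) = 0) \<Longrightarrow> \<forall>j\<in>J. c j = 0"
  shows "real (card J) \<le> real ((DIM('a) + n) choose DIM('a)) +
    (fourier_const TYPE('a))\<^sup>2 * (LINT x|lebesgue. W x * V x)"
proof -
  let ?c = "fourier_const TYPE('a)"
  define \<phi> where "\<phi> j = fourier (e j)" for j
  define \<psi> where "\<psi> j \<xi> = complex_of_real (norm \<xi> powr s) * \<phi> j \<xi>" for j \<xi>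
  define b where "b j x = complex_of_real (sqrt (V x)) * e j x" for j x
  have s0: "s > 0" using s by (smt (verit) of_nat_0_le_iff divide_nonneg_nonneg)
  have sob: "e j \<in> sobolev_space s" if "j \<in> J" for j
    using eig[OF that] eigenspace_schroedinger(1) by blast
  note facts = sobolev_space_facts[OF s sob]
  have e2: "square_integrable (e j)" if "j \<in> J" for j using facts(1)[OF that] .
  have em: "e j \<in> borel_measurable lebesgue" if "j \<in> J" for j using e2[OF that] by (simp add: square_integrable_def)
  have \<psi>2: "square_integrable (\<psi> j)" if "j \<in> J" for j
    using facts(2)[OF that] by (simp add: \<psi>_def[abs_def] \<phi>_def)
  have \<phi>1: "integrable lebesgue (\<phi> j)" if "j \<in> J" for j using facts(4)[OF that] by (simp add: \<phi>_def)
  have b2: "square_integrable (b j)" if j: "j \<in> J" for j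
  proof -
    obtain M where "AE x in lebesgue. norm (e j x) \<le> M" using facts(6)[OF j] by blast
    then show ?thesis
      unfolding b_def[abs_def] by (intro sqrt_potential_square_integrable V em j)
  qed
  have inv: "AE x in lebesgue. \<forall>j\<in>J. e j x = of_real ?c * (LINT \<xi>|lebesgue. cis (x \<bullet> \<xi>) * \<phi> j \<xi>)"
    using facts(5) J unfolding \<phi>_def by (subst AE_finite_all) auto
  have cis_int: "integrable lebesgue (\<lambda>\<xi>. cis (x \<bullet> \<xi>) * \<phi> j \<xi>)" if "j \<in> J" for j x
  proof (rule Bochner_Integration.integrable_bound[OF \<phi>1[OF that]])
    have "(\<lambda>\<xi>. cis (x \<bullet> \<xi>)) \<in> borel_measurable lebesgue" by (rule measurable_lebesgueI) measurable
    then show "(\<lambda>\<xi>. cis (x \<bullet> \<xi>) * \<phi> j \<xi>) \<in> borel_measurable lebesgue"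
      using \<phi>1[OF that] by (intro borel_measurable_times) auto
  qed (simp add: norm_mult)

  define A where "A i j = L2_inner (\<psi> i) (\<psi> j)" for i j
  have Aherm: "A j i = cnj (A i j)" for i j unfolding A_def by (rule L2_inner_commute)
  let ?G = "\<lambda>c i j. c i * cnj (c j) * L2_inner (e i) (e j)"
  let ?b = "\<lambda>c. (LINT x|lebesgue. (norm (\<Sum>j\<in>J. c j * b j x))\<^sup>2)"
  let ?a = "\<lambda>c. (LINT \<xi>|lebesgue. (norm (\<Sum>j\<in>J. c j * \<psi> j \<xi>))\<^sup>2)"
  have form: "A i j - L2_inner (b i) (b j) = of_real (\<mu> i) * L2_inner (e i) (e j)" if "i \<in> J" "j \<in> J" for i j
    using eigenspace_schroedinger(2)[OF eig[OF that(1), THEN conjunct2] sob[OF that(2)]] V(2)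
    by (simp add: schroedinger_form_eq A_def \<psi>_def[abs_def] \<phi>_def b_def[abs_def])
  have A_self: "(\<Sum>i\<in>J. \<Sum>j\<in>J. c i * cnj (d j) * A i j) =
      L2_inner (\<lambda>\<xi>. \<Sum>j\<in>J. c j * \<psi> j \<xi>) (\<lambda>\<xi>. \<Sum>j\<in>J. d j * \<psi> j \<xi>)" for c d
    unfolding A_def by (rule L2_inner_lincomb_self[OF \<psi>2, symmetric])
  have B_self: "(\<Sum>i\<in>J. \<Sum>j\<in>J. c i * cnj (d j) * L2_inner (b i) (b j)) =
      L2_inner (\<lambda>x. \<Sum>j\<in>J. c j * b j x) (\<lambda>x. \<Sum>j\<in>J. d j * b j x)" for c d
    by (rule L2_inner_lincomb_self[OF b2, symmetric])
  \<comment> \<open>On the span the form equals the sum over the eigenvalues \<open>\<nu>\<close> of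
    \<open>\<nu>\<close> times the squared norm of the corresponding component, because mixed terms
    vanish by orthogonality; each summand is nonpositive.\<close>
  have neg: "(?a c) \<le> (?b c)" for c
  proof -
    define P where "P \<nu> = {i\<in>J. \<mu> i = \<nu>}" for \<nu>
    have "complex_of_real ((?a c) - (?b c))
      = (\<Sum>i\<in>J. \<Sum>j\<in>J. c i * cnj (c j) * A i j) - (\<Sum>i\<in>J. \<Sum>j\<in>J. c i * cnj (c j) * L2_inner (b i) (b j))"
      unfolding of_real_diff L2_inner_self[symmetric] A_self B_self ..
    also have "\<dots> = (\<Sum>i\<in>J. \<Sum>j\<in>J. c i * cnj (c j) * (A i j - L2_inner (b i) (b j)))"
      by (simp add: sum_subtractf right_diff_distrib)
    also have "\<dots> = (\<Sum>i\<in>J. \<Sum>j\<in>J. of_real (\<mu> i) * (?G c i j))"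
      by (intro sum.cong refl) (simp add: form)
    also have "\<dots> = (\<Sum>\<nu>\<in>\<mu> ` J. \<Sum>i\<in>P \<nu>. \<Sum>j\<in>P \<nu>. of_real (\<mu> i) * (?G c i j))"
      unfolding P_def
    proof (rule sum_over_fibres[OF J])
      fix i j assume "i \<in> J" "j \<in> J" "\<mu> i \<noteq> \<mu> j"
      then have "L2_inner (e i) (e j) = 0" using eig by (intro eigenspaces_orthogonal[of "e i" s V "\<mu> i" "e j" "\<mu> j"]) auto
      then show "of_real (\<mu> i) * (?G c i j) = 0" by simp
    qed
    also have "\<dots> = (\<Sum>\<nu>\<in>\<mu> ` J. of_real \<nu> * (\<Sum>i\<in>P \<nu>. \<Sum>j\<in>P \<nu>. (?G c i j)))"
      unfolding sum_distrib_left by (intro sum.cong refl) (auto simp: P_def)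
    also have "\<dots> = (\<Sum>\<nu>\<in>\<mu> ` J. of_real \<nu> * L2_inner (\<lambda>x. \<Sum>i\<in>P \<nu>. c i * e i x) (\<lambda>x. \<Sum>i\<in>P \<nu>. c i * e i x))"
      by (intro sum.cong refl) (subst L2_inner_lincomb_self, auto simp: P_def e2)
    also have "\<dots> = complex_of_real (\<Sum>\<nu>\<in>\<mu> ` J. \<nu> * (LINT x|lebesgue. (norm (\<Sum>i\<in>P \<nu>. c i * e i x))\<^sup>2))"
      by (simp add: L2_inner_self)
    finally have "(?a c) - (?b c)
      = (\<Sum>\<nu>\<in>\<mu> ` J. \<nu> * (LINT x|lebesgue. (norm (\<Sum>i\<in>P \<nu>. c i * e i x))\<^sup>2))"
      by (simp only: of_real_eq_iff)
    also have "\<dots> \<le> 0"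
      using eig by (intro sum_nonpos mult_nonpos_nonneg) (auto intro: less_imp_le)
    finally show ?thesis by simp
  qed
  \<comment> \<open>The quantifier over \<open>c\<close> stands inside the almost everywhere
    statement: the exceptional set comes from the finitely many \<open>e j\<close> and serves every
    combination.\<close>
  have expand: "AE x in lebesgue. \<forall>c. (\<Sum>j\<in>J. c j * e j x) =
      of_real ?c * (LINT \<xi>|lebesgue. cis (x \<bullet> \<xi>) * (\<Sum>j\<in>J. c j * \<phi> j \<xi>))"
    using inv
  proof eventually_elim
    case (elim x)
    show ?case
    proof
      fix c :: "'j \<Rightarrow> complex"
      have "(LINT \<xi>|lebesgue. cis (x \<bullet> \<xi>) * (\<Sum>j\<in>J. c j * \<phi> j \<xi>)) = (LINT \<xi>|lebesgue. (\<Sum>j\<in>J. c j * (cis (x \<bullet> \<xi>) * \<phi> j \<xi>)))"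
        by (simp add: sum_distrib_left mult_ac)
      also have "\<dots> = (\<Sum>j\<in>J. c j * (LINT \<xi>|lebesgue. cis (x \<bullet> \<xi>) * \<phi> j \<xi>))"
        using cis_int by (subst Bochner_Integration.integral_sum) auto
      finally show "(\<Sum>j\<in>J. c j * e j x) = of_real ?c * (LINT \<xi>|lebesgue. cis (x \<bullet> \<xi>) * (\<Sum>j\<in>J. c j * \<phi> j \<xi>))"
        using elim by (simp add: sum_distrib_left mult_ac)
    qed
  qed
  have \<xi>0: "AE \<xi> in lebesgue. \<xi> \<noteq> (0::'a)" by (rule AE_completion[OF AE_lborel_singleton])
  have \<psi>sum: "(\<Sum>j\<in>J. c j * \<psi> j \<xi>) = of_real (norm \<xi> powr s) * (\<Sum>j\<in>J. c j * \<phi> j \<xi>)" for c \<xi>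
    by (simp add: \<psi>_def sum_distrib_left mult_ac)
  have pos: "\<exists>r>0. (\<Sum>i\<in>J. \<Sum>j\<in>J. c i * cnj (c j) * A i j) = complex_of_real r" if c: "\<exists>j\<in>J. c j \<noteq> 0" for c
  proof (rule exI, rule conjI)
    show eq: "(\<Sum>i\<in>J. \<Sum>j\<in>J. c i * cnj (c j) * A i j) = complex_of_real (?a c)"
      by (simp only: A_self L2_inner_self)
    \<comment> \<open>The kinetic Gram matrix is definite: if the weighted combination vanishes, so
      does the combination of the \<open>\<phi> j\<close> away from the origin, hence by inversion
      that of the \<open>e j\<close>, contrary to independence.\<close>
    have "(?a c) \<noteq> 0"
    proof
      assume "(?a c) = 0"
      then have "AE \<xi> in lebesgue. (\<Sum>j\<in>J. c j * \<psi> j \<xi>) = 0"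
        by (intro L2_inner_self_eq_0 square_integrable_lincomb \<psi>2) (simp_all only: L2_inner_self of_real_0)
      with \<xi>0 have \<phi>0: "AE \<xi> in lebesgue. (\<Sum>j\<in>J. c j * \<phi> j \<xi>) = 0"
        by eventually_elim (simp add: \<psi>sum)
      have "(LINT \<xi>|lebesgue. cis (x \<bullet> \<xi>) * (\<Sum>j\<in>J. c j * \<phi> j \<xi>)) = 0" for x
        by (rule integral_eq_zero_AE) (use \<phi>0 in eventually_elim, simp)
      with expand have "AE x in lebesgue. (\<Sum>j\<in>J. c j * e j x) = 0"
        by (auto elim: eventually_mono)
      with indep c show False by blast
    qed
    then show "0 < (?a c)"
      by (simp add: less_le integral_nonneg_AE)
  qed

  define I where "I = multi_indices TYPE('a) n"
  define m where "m \<alpha> \<xi> = (\<Prod>b\<in>Basis. (\<xi> \<bullet> b) ^ \<alpha> b)" for \<alpha> and \<xi> :: 'a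
  have [measurable]: "m \<alpha> \<in> borel_measurable borel" for \<alpha> unfolding m_def by measurable
  let ?p = "\<lambda>\<alpha> \<xi>. indicator (S (sum \<alpha> Basis)) \<xi> * of_real (m \<alpha> \<xi>)"
  \<comment> \<open>The moments as linear functionals on coefficient vectors, with the cutoff that
    belongs to the degree of \<open>\<alpha>\<close>.\<close>
  define L where "L \<alpha> j = (LINT \<xi>|lebesgue. ?p \<alpha> \<xi> * \<phi> j \<xi>)" for \<alpha> j
  have Lint: "integrable lebesgue (\<lambda>\<xi>. ?p \<alpha> \<xi> * \<phi> j \<xi>)"
    if "\<alpha> \<in> I" "j \<in> J" for \<alpha> j
    unfolding \<phi>_def
  proof (rule facts(3)[OF that(2)])
    show "norm (complex_of_real (m \<alpha> \<xi>)) \<le> norm \<xi> ^ sum \<alpha> Basis" for \<xi>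
      using abs_monomial_le[of \<xi> \<alpha>] by (simp add: m_def del: of_real_prod)
    show "real (sum \<alpha> Basis) < s - real DIM('a) / 2 \<or> S (sum \<alpha> Basis) \<subseteq> cball 0 1"
      using that(1) by (intro S(2)) (simp add: I_def multi_indices_def)
  qed (use S(1) in measurable)
  have finI: "finite I" unfolding I_def by (rule multi_indices_card)

  \<comment> \<open>The dimension left after imposing all moment conditions. Subtraction truncates
    at 0, so the case of fewer functions than conditions is settled separately by the binomial
    term.\<close>
  define k where "k = card J - card I"
  show ?thesis
  proof (cases "card I \<le> card J")
    case False
    then have "real (card J) \<le> real ((DIM('a) + n) choose DIM('a))"
      using multi_indices_card(2)[of n, where 'a='a] unfolding I_def by linarith
    moreover have "0 \<le> ?c\<^sup>2 * (LINT x|lebesgue. W x * V x)"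
      using W(1) V(2) by (intro mult_nonneg_nonneg integral_nonneg_AE) auto
    ultimately show ?thesis by linarith
  next
    case True
    then have "card I + k \<le> card J" by (simp add: k_def)
    from orthonormal_family_in_kernel[where A = A and L = L, OF finI J Aherm pos this]
    obtain a where aL: "\<And>l \<alpha>. l < k \<Longrightarrow> \<alpha> \<in> I \<Longrightarrow> (\<Sum>j\<in>J. L \<alpha> j * a l j) = 0"
      and aA: "\<And>l l'. l < k \<Longrightarrow> l' < k \<Longrightarrow> (\<Sum>i\<in>J. \<Sum>j\<in>J. a l i * cnj (a l' j) * A i j) = (if l = l' then 1 else 0)"
      by blast
    define f where "f l \<xi> = (\<Sum>j\<in>J. a l j * \<psi> j \<xi>)" for l \<xi>
    define g where "g l \<xi> = (\<Sum>j\<in>J. a l j * \<phi> j \<xi>)" for l \<xi>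
    define w where "w l x = (\<Sum>j\<in>J. a l j * e j x)" for l x
    have f2: "square_integrable (f l)" for l unfolding f_def by (intro square_integrable_lincomb \<psi>2)
    have orth: "L2_inner (f l) (f l') = (if l = l' then 1 else 0)" if "l < k" "l' < k" for l l'
      using aA[OF that] unfolding A_self f_def .
    have moment: "(LINT \<xi>|lebesgue. ?p \<alpha> \<xi> * g l \<xi>) = 0" if "l < k" "\<alpha> \<in> I" for l \<alpha>
    proof -
      have "(LINT \<xi>|lebesgue. ?p \<alpha> \<xi> * g l \<xi>) =
          (LINT \<xi>|lebesgue. (\<Sum>j\<in>J. a l j * (?p \<alpha> \<xi> * \<phi> j \<xi>)))"
        by (simp add: g_def sum_distrib_left mult_ac)
      also have "\<dots> = (\<Sum>j\<in>J. a l j * L \<alpha> j)"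
        unfolding L_def using Lint[OF that(2)] by (subst Bochner_Integration.integral_sum) auto
      finally show ?thesis using aL[OF that] by (simp add: mult.commute)
    qed
    have moment_int: "integrable lebesgue (\<lambda>\<xi>. ?p \<alpha> \<xi> * g l \<xi>)" if "\<alpha> \<in> I" for l \<alpha>
    proof -
      have "integrable lebesgue (\<lambda>\<xi>. \<Sum>j\<in>J. a l j * (?p \<alpha> \<xi> * \<phi> j \<xi>))"
        using Lint[OF that] by (intro Bochner_Integration.integrable_sum integrable_mult_right)
      then show ?thesis by (simp add: g_def sum_distrib_left mult_ac)
    qed
    let ?T = "\<lambda>x j \<xi>. indicator (S j) \<xi> * (\<i> * of_real (x \<bullet> \<xi>)) ^ j / fact j"
    \<comment> \<open>Each term of the Taylor polynomial is a combination of monomials of one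
      degree, all carrying the same cutoff \<open>S j\<close>, so the vanishing moments annihilate
      it.\<close>
    have taylor: "integrable lebesgue (\<lambda>\<xi>. ?T x j \<xi> * g l \<xi>)"
      "(LINT \<xi>|lebesgue. ?T x j \<xi> * g l \<xi>) = 0" if "l < k" "j \<le> n" for l j x
    proof -
      obtain q where q: "\<And>\<xi>. (x \<bullet> \<xi>) ^ j = (\<Sum>\<alpha>\<in>{\<alpha>\<in>multi_indices TYPE('a) j. sum \<alpha> Basis = j}. q \<alpha> * m \<alpha> \<xi>)"
        using inner_power_multi_index_expansion[of x j] unfolding m_def by blast
      let ?M = "{\<alpha>\<in>multi_indices TYPE('a) j. sum \<alpha> Basis = j}"
      have M: "\<alpha> \<in> I" "sum \<alpha> Basis = j" if "\<alpha> \<in> ?M" for \<alpha>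
        using that \<open>j \<le> n\<close> by (auto simp: I_def multi_indices_def)
      have eq: "?T x j \<xi> * g l \<xi> =
        (\<Sum>\<alpha>\<in>?M. (\<i> ^ j * of_real (q \<alpha>) / fact j) * (?p \<alpha> \<xi> * g l \<xi>))" for \<xi>
      proof -
        define T where "T = (\<Sum>\<alpha>\<in>?M. complex_of_real (q \<alpha>) * of_real (m \<alpha> \<xi>))"
        have "complex_of_real (x \<bullet> \<xi>) ^ j = T"
          unfolding of_real_power[symmetric] q T_def by simp
        then have "?T x j \<xi> * g l \<xi> =
            (indicator (S j) \<xi> * \<i> ^ j / fact j * g l \<xi>) * T"
          by (simp add: power_mult_distrib)
        also have "\<dots> = (\<Sum>\<alpha>\<in>?M. (\<i> ^ j * of_real (q \<alpha>) / fact j) * (?p \<alpha> \<xi> * g l \<xi>))"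
          unfolding T_def sum_distrib_left
        proof (rule sum.cong[OF refl])
          fix \<alpha> assume "\<alpha> \<in> ?M"
          from M(2)[OF this] show "indicator (S j) \<xi> * \<i> ^ j / fact j * g l \<xi> * (complex_of_real (q \<alpha>) * of_real (m \<alpha> \<xi>)) =
            (\<i> ^ j * of_real (q \<alpha>) / fact j) * (?p \<alpha> \<xi> * g l \<xi>)"
            by simp
        qed
        finally show ?thesis .
      qed
      show "integrable lebesgue (\<lambda>\<xi>. ?T x j \<xi> * g l \<xi>)"
        unfolding eq by (intro Bochner_Integration.integrable_sum integrable_mult_right moment_int M)
      show "(LINT \<xi>|lebesgue. ?T x j \<xi> * g l \<xi>) = 0"
        unfolding eq
        by (subst Bochner_Integration.integral_sum)
          (use moment[OF \<open>l < k\<close> M(1)] in \<open>auto intro!: integrable_mult_right moment_int M sum.neutral\<close>)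
    qed
    have cis_g: "integrable lebesgue (\<lambda>\<xi>. cis (x \<bullet> \<xi>) * g l \<xi>)" for x l
    proof -
      have "integrable lebesgue (\<lambda>\<xi>. \<Sum>j\<in>J. a l j * (cis (x \<bullet> \<xi>) * \<phi> j \<xi>))"
        by (intro Bochner_Integration.integrable_sum integrable_mult_right cis_int)
      then show ?thesis by (simp add: g_def sum_distrib_left mult_ac)
    qed
    have K2: "square_integrable (taylor_kernel s n S x)"
      and KW: "(LINT \<xi>|lebesgue. (norm (taylor_kernel s n S x \<xi>))\<^sup>2) \<le> W x" for x
    proof -
      have [measurable]: "taylor_kernel s n S x \<in> borel_measurable borel" using S(1) by (rule taylor_kernel_measurable)
      have "energy (taylor_kernel s n S x) < \<infinity>"
        using W(2)[of x] by (simp add: le_less_trans)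
      then have int: "integrable lborel (\<lambda>\<xi>. (norm (taylor_kernel s n S x \<xi>))\<^sup>2)" by (simp add: integrable_iff_bounded)
      then show "square_integrable (taylor_kernel s n S x)" by (subst square_integrable_borel_iff) auto
      have "ennreal (\<integral>\<xi>. (norm (taylor_kernel s n S x \<xi>))\<^sup>2 \<partial>lborel) \<le> ennreal (W x)"
        using W(2)[of x] by (subst (asm) nn_integral_eq_integral[OF int]) auto
      then show "(LINT \<xi>|lebesgue. (norm (taylor_kernel s n S x \<xi>))\<^sup>2) \<le> W x"
        using W(1)[of x] by (subst integral_completion) (auto simp: ennreal_le_iff)
    qed
    have pointwise: "AE x in lebesgue. (\<Sum>l<k. (norm (w l x))\<^sup>2) \<le> ?c\<^sup>2 * W x"
      using expand
    proof eventually_elim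
      case (elim x)
      let ?K = "taylor_kernel s n S x"
      \<comment> \<open>The vanishing Taylor integrals are subtracted from the inversion formula and
        the factor 1, split into the powers \<open>- s\<close> and \<open>s\<close> of the norm, is
        inserted; this exhibits the value at \<open>x\<close> as an inner product of the kernel with
        \<open>f l\<close>.\<close>
      have wK: "w l x = of_real ?c * cnj (L2_inner (\<lambda>\<xi>. cnj (?K \<xi>)) (f l))" if "l < k" for l
      proof -
        have "w l x = of_real ?c * (LINT \<xi>|lebesgue. cis (x \<bullet> \<xi>) * g l \<xi>)"
          using elim by (simp add: w_def g_def)
        also have "(LINT \<xi>|lebesgue. cis (x \<bullet> \<xi>) * g l \<xi>) =
          (LINT \<xi>|lebesgue. cis (x \<bullet> \<xi>) * g l \<xi>) - (\<Sum>j\<le>n. (LINT \<xi>|lebesgue. ?T x j \<xi> * g l \<xi>))"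
          using taylor(2)[OF that] by simp
        also have "\<dots> = (LINT \<xi>|lebesgue. cis (x \<bullet> \<xi>) * g l \<xi> - (\<Sum>j\<le>n. ?T x j \<xi> * g l \<xi>))"
          using taylor(1)[OF that] cis_g by (subst Bochner_Integration.integral_diff) (auto simp: Bochner_Integration.integral_sum)
        also have "\<dots> = (LINT \<xi>|lebesgue. ?K \<xi> * f l \<xi>)"
        proof (rule integral_cong_AE)
          show "AE \<xi> in lebesgue. cis (x \<bullet> \<xi>) * g l \<xi> - (\<Sum>j\<le>n. ?T x j \<xi> * g l \<xi>) = ?K \<xi> * f l \<xi>"
            using \<xi>0
          proof eventually_elim
            case (elim \<xi>)
            have "norm \<xi> powr (- s) * norm \<xi> powr s = 1" using elim by (simp flip: powr_add)
            then have 1: "complex_of_real (norm \<xi> powr (- s)) * of_real (norm \<xi> powr s) = 1"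
              unfolding of_real_mult[symmetric] by simp
            have "?K \<xi> * f l \<xi> = (complex_of_real (norm \<xi> powr (- s)) * of_real (norm \<xi> powr s)) *
              ((cis (x \<bullet> \<xi>) - (\<Sum>j\<le>n. ?T x j \<xi>)) * g l \<xi>)"
              unfolding taylor_kernel_def f_def \<psi>sum g_def by (simp only: mult_ac)
            then show ?case unfolding 1 by (simp add: left_diff_distrib sum_distrib_right)
          qed
          show "(\<lambda>\<xi>. ?K \<xi> * f l \<xi>) \<in> borel_measurable lebesgue"
            using K2 f2 by (intro borel_measurable_times) (auto simp: square_integrable_def)
          show "(\<lambda>\<xi>. cis (x \<bullet> \<xi>) * g l \<xi> - (\<Sum>j\<le>n. ?T x j \<xi> * g l \<xi>)) \<in> borel_measurable lebesgue"
            using taylor(1)[OF that] cis_g by (intro borel_measurable_diff borel_measurable_sum) auto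
        qed
        also have "\<dots> = cnj (L2_inner (\<lambda>\<xi>. cnj (?K \<xi>)) (f l))"
          unfolding L2_inner_def Bochner_Integration.integral_cnj[symmetric] by simp
        finally show ?thesis .
      qed
      have "(\<Sum>l<k. (norm (w l x))\<^sup>2) = (\<Sum>l<k. ?c\<^sup>2 * (norm (L2_inner (\<lambda>\<xi>. cnj (?K \<xi>)) (f l)))\<^sup>2)"
        by (intro sum.cong refl) (simp add: wK norm_mult power_mult_distrib)
      also have "\<dots> = ?c\<^sup>2 * (\<Sum>l<k. (norm (L2_inner (\<lambda>\<xi>. cnj (?K \<xi>)) (f l)))\<^sup>2)" by (simp add: sum_distrib_left)
      also have "\<dots> \<le> ?c\<^sup>2 * W x"
      proof (intro mult_left_mono)
        have "(\<Sum>l<k. (norm (L2_inner (\<lambda>\<xi>. cnj (?K \<xi>)) (f l)))\<^sup>2) \<le> (LINT \<xi>|lebesgue. (norm (cnj (?K \<xi>)))\<^sup>2)"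
          by (intro L2_bessel_inequality f2 square_integrable_cnj K2 orth)
        also have "\<dots> \<le> W x" using KW[of x] by simp
        finally show "(\<Sum>l<k. (norm (L2_inner (\<lambda>\<xi>. cnj (?K \<xi>)) (f l)))\<^sup>2) \<le> W x" .
      qed simp
      finally show ?case .
    qed
    have bw: "(\<Sum>j\<in>J. a l j * b j x) = complex_of_real (sqrt (V x)) * w l x" for l x
      by (simp add: b_def w_def sum_distrib_left mult_ac)
    have bw2: "square_integrable (\<lambda>x. complex_of_real (sqrt (V x)) * w l x)" for l
      unfolding bw[symmetric] by (intro square_integrable_lincomb b2)
    have nbw: "(norm (complex_of_real (sqrt (V x)) * w l x))\<^sup>2 = V x * (norm (w l x))\<^sup>2" for l x
      using V(2)[of x] by (simp add: norm_mult power_mult_distrib)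
    have Vw: "integrable lebesgue (\<lambda>x. V x * (norm (w l x))\<^sup>2)" for l
      using bw2[of l] by (simp add: square_integrable_def nbw)
    \<comment> \<open>\<open>f l\<close> has unit norm, and by \<open>neg\<close> the kinetic energy
      is at most the potential energy.\<close>
    have one: "1 \<le> (LINT x|lebesgue. V x * (norm (w l x))\<^sup>2)" if "l < k" for l
    proof -
      have "complex_of_real (LINT \<xi>|lebesgue. (norm (f l \<xi>))\<^sup>2) = 1"
        using orth[OF that that] by (simp only: L2_inner_self) simp
      then have "1 = (LINT \<xi>|lebesgue. (norm (f l \<xi>))\<^sup>2)" by (metis of_real_1 of_real_eq_iff)
      also have "\<dots> \<le> (LINT x|lebesgue. (norm (\<Sum>j\<in>J. a l j * b j x))\<^sup>2)" unfolding f_def by (rule neg)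
      finally show ?thesis unfolding bw nbw .
    qed
    have "real k = (\<Sum>l<k. 1)" by simp
    also have "\<dots> \<le> (\<Sum>l<k. (LINT x|lebesgue. V x * (norm (w l x))\<^sup>2))" by (intro sum_mono one) simp
    also have "\<dots> = (LINT x|lebesgue. (\<Sum>l<k. V x * (norm (w l x))\<^sup>2))"
      by (rule Bochner_Integration.integral_sum[symmetric]) (rule Vw)
    also have "\<dots> \<le> (LINT x|lebesgue. ?c\<^sup>2 * (W x * V x))"
    proof (rule integral_mono_AE)
      show "integrable lebesgue (\<lambda>x. \<Sum>l<k. V x * (norm (w l x))\<^sup>2)" by (intro Bochner_Integration.integrable_sum Vw)
      show "integrable lebesgue (\<lambda>x. ?c\<^sup>2 * (W x * V x))" by (intro integrable_mult_right W(3))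
      show "AE x in lebesgue. (\<Sum>l<k. V x * (norm (w l x))\<^sup>2) \<le> ?c\<^sup>2 * (W x * V x)"
        using pointwise
      proof eventually_elim
        case (elim x)
        then have "V x * (\<Sum>l<k. (norm (w l x))\<^sup>2) \<le> V x * (?c\<^sup>2 * W x)" using V(2)[of x] by (rule mult_left_mono)
        then show ?case by (simp add: sum_distrib_left mult_ac)
      qed
    qed
    also have "\<dots> = ?c\<^sup>2 * (LINT x|lebesgue. W x * V x)" by simp
    finally have "real k \<le> ?c\<^sup>2 * (LINT x|lebesgue. W x * V x)" .
    moreover have "real (card J) = real (card I) + real k" using True by (simp add: k_def)
    moreover have "real (card I) \<le> real ((DIM('a) + n) choose DIM('a))"
      using multi_indices_card(2)[of n, where 'a='a] by (simp add: I_def)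
    ultimately show ?thesis by linarith
  qed
qed

text \<open>The bound on finite families does not depend on the family, so it passes to the whole
  count and in particular shows that the count is finite.\<close>

theorem num_negative_eigenvalues_bound:
  fixes V W :: "'a::euclidean_space \<Rightarrow> real"
  assumes s: "s > real DIM('a) / 2"
    and V: "V \<in> borel_measurable lebesgue" "\<And>x. 0 \<le> V x" "square_integrable (\<lambda>x. sqrt (V x))"
    and S: "\<And>j. S j \<in> sets borel" "\<And>j. j \<le> n \<Longrightarrow> real j < s - real DIM('a) / 2 \<or> S j \<subseteq> cball 0 1"
    and W: "\<And>x. 0 \<le> W x" "\<And>x. energy (taylor_kernel s n S x) \<le> ennreal (W x)"
      "integrable lebesgue (\<lambda>x. W x * V x)"
  shows "ereal_of_enat (num_negative_eigenvalues (schroedinger_operator s V))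
      - ereal (real ((DIM('a) + n) choose DIM('a)))
    \<le> ereal ((fourier_const TYPE('a))\<^sup>2 * (LINT x|lebesgue. W x * V x))"
proof -
  let ?B = "real ((DIM('a) + n) choose DIM('a))" and ?R = "(fourier_const TYPE('a))\<^sup>2 * (LINT x|lebesgue. W x * V x)"
  have R: "0 \<le> ?R" using W(1) V(2) by (intro mult_nonneg_nonneg integral_nonneg_AE) auto
  \<comment> \<open>Cardinalities are integers, so the real bound may be rounded down to the natural
    number required by \<open>num_negative_eigenvalues_le\<close>.\<close>
  have "num_negative_eigenvalues (schroedinger_operator s V) \<le> enat (nat \<lfloor>?B + ?R\<rfloor>)"
  proof (rule num_negative_eigenvalues_le)
    fix J :: "(real \<times> nat) set" and e :: "real \<times> nat \<Rightarrow> 'a \<Rightarrow> complex" and \<mu> :: "real \<times> nat \<Rightarrow> real"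
    assume *: "finite J" "\<And>j. j \<in> J \<Longrightarrow> \<mu> j < 0 \<and> e j \<in> eigenspace (schroedinger_operator s V) (\<mu> j)"
      "\<And>c. (AE x in lebesgue. (\<Sum>j\<in>J. c j * e j x) = 0) \<Longrightarrow> \<forall>j\<in>J. c j = 0"
    have "real (card J) \<le> ?B + ?R"
      by (rule eigenfunction_count_bound[where \<mu> = \<mu> and e = e, OF s V S W *])
    then show "card J \<le> nat \<lfloor>?B + ?R\<rfloor>" by (rule le_nat_floor)
  qed
  then obtain N where N: "num_negative_eigenvalues (schroedinger_operator s V) = enat N" "N \<le> nat \<lfloor>?B + ?R\<rfloor>"
    by (cases "num_negative_eigenvalues (schroedinger_operator s V)") auto
  have "real N \<le> real (nat \<lfloor>?B + ?R\<rfloor>)" using N(2) by (rule of_nat_mono)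
  also have "\<dots> \<le> ?B + ?R" using R by (intro of_nat_floor) simp
  finally have "real N \<le> ?B + ?R" .
  then show ?thesis unfolding N(1) by simp
qed

theorem theorem1p1:
  fixes s :: real and n :: nat
  assumes s: "s > real CARD('d::finite) / 2"
    and n: "n = nat \<lfloor>s - real CARD('d) / 2\<rfloor>"
  shows "\<exists>C::real. C > 0 \<and>
    (\<forall>V :: real ^ 'd \<Rightarrow> real.
      V \<in> borel_measurable lebesgue \<longrightarrow> (\<forall>x. 0 \<le> V x) \<longrightarrow> square_integrable (\<lambda>x. sqrt (V x)) \<longrightarrow>
      (s - real CARD('d) / 2 \<notin> \<nat> \<longrightarrow>
       square_integrable (\<lambda>x. norm x powr (s - real CARD('d) / 2) * sqrt (V x)) \<longrightarrow>
         ereal_of_enat (num_negative_eigenvalues (schroedinger_operator s V))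
           - ereal (real ((CARD('d) + n) choose CARD('d)))
         \<le> ereal (C * (L2_norm (\<lambda>x. norm x powr (s - real CARD('d) / 2) * sqrt (V x)))\<^sup>2)) \<and>
      (s - real CARD('d) / 2 \<in> \<nat> - {0} \<longrightarrow>
       square_integrable (\<lambda>x. japanese_bracket x powr (s - real CARD('d) / 2)
           * sqrt (1 + ln (japanese_bracket x)) * sqrt (V x)) \<longrightarrow>
         ereal_of_enat (num_negative_eigenvalues (schroedinger_operator s V))
           - ereal (real ((CARD('d) + n) choose CARD('d)))
         \<le> ereal (C * (L2_norm (\<lambda>x. japanese_bracket x powr (s - real CARD('d) / 2)
             * sqrt (1 + ln (japanese_bracket x)) * sqrt (V x)))\<^sup>2)))"
proof -
  define \<sigma> where "\<sigma> = s - real CARD('d) / 2"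
  have dim: "DIM(real ^ 'd) = CARD('d)" by simp
  let ?w = "sphere_area TYPE(real ^ 'd)" and ?c = "fourier_const TYPE(real ^ 'd)"
  have \<sigma>: "\<sigma> > 0" "n = nat \<lfloor>\<sigma>\<rfloor>" using s n by (simp_all add: \<sigma>_def)
  have w: "?w > 0" "?c > 0" by (rule sphere_area_pos fourier_const_pos)+
  have L2: "(L2_norm f)\<^sup>2 = (LINT x|lebesgue. (f x)\<^sup>2)" for f :: "real ^ 'd \<Rightarrow> real"
    by (simp add: L2_norm_def)
  show ?thesis
  proof (cases "\<sigma> \<in> \<nat>")
    case False
    have "real n = of_int \<lfloor>\<sigma>\<rfloor>" using \<sigma> by simp
    then have "real n \<le> \<sigma>" "\<sigma> < real n + 1" by linarith+
    moreover have "real n \<noteq> \<sigma>" using False by (metis of_nat_in_Nats)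
    ultimately have n\<sigma>: "real n < \<sigma>" "\<sigma> < real n + 1" by auto
    \<comment> \<open>The constant of \<open>taylor_kernel_bound_fractional\<close>. It is positive
      since \<open>\<sigma>\<close> lies strictly between \<open>n\<close> and \<open>n + 1\<close>,
      and it blows up as \<open>\<sigma>\<close> approaches either end.\<close>
    define K where "K = ?w * (1 / (2 * (real n + 1 - \<sigma>)) + 4 / (2 * (\<sigma> - real n)))"
    have K: "K > 0" unfolding K_def using n\<sigma> w by (intro mult_pos_pos add_pos_pos) auto
    show ?thesis
      unfolding \<sigma>_def[symmetric]
    proof (intro exI[of _ "?c\<^sup>2 * K"] conjI allI impI)
      show "?c\<^sup>2 * K > 0" using K w by simp
      fix V :: "real ^ 'd \<Rightarrow> real"
      assume V: "V \<in> borel_measurable lebesgue" "\<forall>x. 0 \<le> V x" "square_integrable (\<lambda>x. sqrt (V x))"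
      {
        assume sq: "square_integrable (\<lambda>x. norm x powr \<sigma> * sqrt (V x))"
        have eq: "(norm x powr \<sigma> * sqrt (V x))\<^sup>2 = norm x powr (2 * \<sigma>) * V x" for x
        proof -
          have "(norm x powr \<sigma>)\<^sup>2 = norm x powr (2 * \<sigma>)" by (simp add: power2_eq_square flip: powr_add)
          then show ?thesis using V(2) by (simp add: power_mult_distrib)
        qed
        have "ereal_of_enat (num_negative_eigenvalues (schroedinger_operator s V))
            - ereal (real ((DIM(real ^ 'd) + n) choose DIM(real ^ 'd)))
          \<le> ereal (?c\<^sup>2 * (LINT x|lebesgue. (K * norm x powr (2 * \<sigma>)) * V x))"
        proof (rule num_negative_eigenvalues_bound[where S = "\<lambda>_. UNIV"])
          show "energy (taylor_kernel s n (\<lambda>_. UNIV) x) \<le> ennreal (K * norm x powr (2 * \<sigma>))" for x :: "real ^ 'd"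
            unfolding K_def using n\<sigma> by (intro taylor_kernel_bound_fractional) (simp_all add: \<sigma>_def)
          have "integrable lebesgue (\<lambda>x. K * (norm x powr (2 * \<sigma>) * V x))"
            using sq by (intro integrable_mult_right) (simp add: square_integrable_def eq)
          then show "integrable lebesgue (\<lambda>x. K * norm x powr (2 * \<sigma>) * V x)" by (simp add: mult.assoc)
          show "real j < s - real DIM(real ^ 'd) / 2 \<or> UNIV \<subseteq> cball (0 :: real ^ 'd) 1" if "j \<le> n" for j
            using that n\<sigma> by (simp add: \<sigma>_def)
        qed (use V s K in auto)
        also have "?c\<^sup>2 * (LINT x|lebesgue. (K * norm x powr (2 * \<sigma>)) * V x) =
            ?c\<^sup>2 * K * (L2_norm (\<lambda>x. norm x powr \<sigma> * sqrt (V x)))\<^sup>2"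
          unfolding L2 eq by (simp add: mult.assoc)
        finally show "ereal_of_enat (num_negative_eigenvalues (schroedinger_operator s V))
           - ereal (real ((CARD('d) + n) choose CARD('d)))
         \<le> ereal (?c\<^sup>2 * K * (L2_norm (\<lambda>x. norm x powr \<sigma> * sqrt (V x)))\<^sup>2)" by (simp only: dim)
      }
    qed (use False in auto)
  next
    case True
    then have n\<sigma>: "real n = \<sigma>" using \<sigma>(2) by (auto elim: Nats_cases)
    \<comment> \<open>Positivity of \<open>\<sigma>\<close> excludes \<open>n = 0\<close>; outside
      the unit ball the kernel uses the Taylor polynomial of degree \<open>n - 1\<close>.\<close>
    then have n1: "n \<ge> 1" using \<sigma> by (cases n) auto
    define K where "K = 4 * ?w"
    have K: "K > 0" unfolding K_def using w by simp
    \<comment> \<open>Moments of degree below \<open>n = \<sigma>\<close> converge on the whole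
      space; degree \<open>n\<close> is the critical one, so it is cut off to the unit ball.\<close>
    define S where "S = (\<lambda>j. if j < n then UNIV else cball (0 :: real ^ 'd) 1)"
    define W where "W x = K * (japanese_bracket x ^ (2 * n) * (1 + ln (japanese_bracket x)))" for x :: "real ^ 'd"
    have ln0: "0 \<le> ln (japanese_bracket x)" for x :: "real ^ 'd" using japanese_bracket_ge(1)[of x] by simp
    have jb0: "0 < japanese_bracket x" for x :: "real ^ 'd" using japanese_bracket_ge(1)[of x] by linarith
    show ?thesis
      unfolding \<sigma>_def[symmetric]
    proof (intro exI[of _ "?c\<^sup>2 * K"] conjI allI impI)
      show "?c\<^sup>2 * K > 0" using K w by simp
      fix V :: "real ^ 'd \<Rightarrow> real"
      assume V: "V \<in> borel_measurable lebesgue" "\<forall>x. 0 \<le> V x" "square_integrable (\<lambda>x. sqrt (V x))"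
      {
        assume sq: "square_integrable (\<lambda>x. japanese_bracket x powr \<sigma> * sqrt (1 + ln (japanese_bracket x)) * sqrt (V x))"
        have eq: "(japanese_bracket x powr \<sigma> * sqrt (1 + ln (japanese_bracket x)) * sqrt (V x))\<^sup>2 =
            japanese_bracket x ^ (2 * n) * (1 + ln (japanese_bracket x)) * V x" for x
        proof -
          have "(japanese_bracket x powr \<sigma>)\<^sup>2 = japanese_bracket x ^ (2 * n)"
            unfolding n\<sigma>[symmetric] powr_realpow[OF jb0] by (simp add: power_mult[symmetric] mult.commute)
          then show ?thesis using V(2) ln0[of x] by (simp add: power_mult_distrib)
        qed
        have WV: "W x * V x = K * (japanese_bracket x ^ (2 * n) * (1 + ln (japanese_bracket x)) * V x)" for x
          by (simp add: W_def mult.assoc)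
        have "ereal_of_enat (num_negative_eigenvalues (schroedinger_operator s V))
            - ereal (real ((DIM(real ^ 'd) + n) choose DIM(real ^ 'd)))
          \<le> ereal (?c\<^sup>2 * (LINT x|lebesgue. W x * V x))"
        proof (rule num_negative_eigenvalues_bound[where S = S])
          show "energy (taylor_kernel s n S x) \<le> ennreal (W x)" for x
            unfolding W_def K_def S_def using n\<sigma> n1 by (intro taylor_kernel_bound_integer) (simp_all add: \<sigma>_def)
          show "integrable lebesgue (\<lambda>x. W x * V x)"
            unfolding WV using sq by (intro integrable_mult_right) (simp add: square_integrable_def eq)
          show "real j < s - real DIM(real ^ 'd) / 2 \<or> S j \<subseteq> cball (0 :: real ^ 'd) 1" if "j \<le> n" for j
            using that n\<sigma> by (auto simp: \<sigma>_def S_def)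
          show "0 \<le> W x" for x
            unfolding W_def using K jb0[of x] ln0[of x] by (intro mult_nonneg_nonneg) auto
        qed (use V s in \<open>auto simp: S_def\<close>)
        also have "?c\<^sup>2 * (LINT x|lebesgue. W x * V x) =
            ?c\<^sup>2 * K * (L2_norm (\<lambda>x. japanese_bracket x powr \<sigma> * sqrt (1 + ln (japanese_bracket x)) * sqrt (V x)))\<^sup>2"
          unfolding L2 eq WV by simp
        finally show "ereal_of_enat (num_negative_eigenvalues (schroedinger_operator s V))
           - ereal (real ((CARD('d) + n) choose CARD('d)))
         \<le> ereal (?c\<^sup>2 * K * (L2_norm (\<lambda>x. japanese_bracket x powr \<sigma>
             * sqrt (1 + ln (japanese_bracket x)) * sqrt (V x)))\<^sup>2)" by (simp only: dim)
      }
    qed (use True in auto)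
  qed
qed

end
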